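(* Let $p$ be a prime. The orbit of the $p$-adic wavelet $\psi(x)=\chi(p^{-1}x)\,\Omega(|x|_p)$ with respect to the unitary action on $L^2(\mathbb{Q}_p)$ of the group of ball-morphisms of $\mathbb{Q}_p$ is a tight uniform frame in $L^2(\mathbb{Q}_p)$. This orbit is the union over all balls $B$ in $\mathbb{Q}_p$ of sets of functions related to $B$, where the set corresponding to a ball $B$ consists of all functions supported on $B$ which are constant on each maximal subball of $B$ and whose values on the maximal subballs of $B$ are, up to the normalization of the function to unit $L^2$-norm by a positive factor, the $p$-th roots of unity $\exp(2\pi i m/p)$, $m=0,1,\dots,p-1$, with different values at different maximal subballs. The bound of this frame is equal to $p!/(p-1)$.
   Context: A ball is a set $\{x\in\mathbb{Q}_p:|x-a|_p\le p^{k}\}$, $a\in\mathbb{Q}_p$, $k\in\mathbb{Z}$; it has exactly $p$ maximal proper subballs (its "maximal subballs"). A ball-morphism of $\mathbb{Q}_p$ is a bijection $\mathbb{Q}_p\to\mathbb{Q}_p$ for which the image and inverse image of any ball are balls; every ball-morphism is a composition of an isometry and a multiplication by a power of $p$. The unitary action: to the ball-morphism $x\mapsto\phi(p^{\gamma}x)$, with $\phi$ an isometry of $\mathbb{Q}_p$ and $\gamma\in\mathbb{Z}$, corresponds the unitary operator $f(x)\mapsto p^{-\gamma/2}f(\phi(p^{\gamma}x))$ on $L^2(\mathbb{Q}_p)$ (Haar measure normalized so that $\mathbb{Z}_p$ has measure one). $\Omega(|x|_p)$ is the characteristic function of $\mathbb{Z}_p$; $\chi$ is the character $\chi(x)=\exp\bigl(2\pi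 i\sum_{j=\gamma}^{-1}x_jp^j\bigr)$ for $x=\sum_{j\ge\gamma}x_jp^j$, $x_j\in\{0,\dots,p-1\}$. A function related to a ball $B$ is a mean zero linear combination of characteristic functions of maximal subballs of $B$. The orbit is regarded as a set of functions (each function counted once). A set $\{f_n\}$ in a Hilbert space $\mathcal{H}$ is a frame if there are constants $A,B>0$ with $A\|g\|^2\le\sum_n|\langle g,f_n\rangle|^2\le B\|g\|^2$ for all $g\in\mathcal{H}$; it is tight with bound $A$ if one can take $A=B$, and uniform if all its elements have equal norms. *)

theory Defs
  imports "HOL-Analysis.Analysis" "HOL-Computational_Algebra.Primes"
begin

text \<open>
  The prime \<open>p\<close> is a type parameter, \<open>p = CARD('p)\<close>, so that \<open>'p padic\<close> is a type
  carrying the field and metric structure of \<open>\<rat>\<^sub>p\<close>. A free type variable of this class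
  ranges over all primes.
\<close>

class prime_card = finite +
  assumes prime_card: "prime CARD('a)"

subsection \<open>The \<open>p\<close>-adic absolute value on the rationals\<close>

definition padic_abs :: "nat \<Rightarrow> rat \<Rightarrow> real" where
  "padic_abs p q =
     (if q = 0 then 0
      else case quotient_of q of (a, b) \<Rightarrow>
        real p powi (int (multiplicity (int p) b) - int (multiplicity (int p) a)))"

lemma padic_abs_zero [simp]: "padic_abs p 0 = 0"
  by (simp add: padic_abs_def)

lemma padic_abs_Fract:
  assumes p: "prime p" and ab: "a \<noteq> 0" "b \<noteq> 0"
  shows "padic_abs p (Fract a b) =
    real p powi (int (multiplicity (int p) b) - int (multiplicity (int p) a))"
proof -
  obtain c d where q: "quotient_of (Fract a b) = (c, d)" by force
  have d: "d > 0" using q by (rule quotient_of_denom_pos)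
  have "Fract a b = Fract c d"
    using quotient_of_div[OF q] by (simp add: Fract_of_int_quotient)
  then have eq: "a * d = c * b" using ab d by (simp add: eq_rat)
  have c: "c \<noteq> 0" using eq ab d by auto
  have pe: "prime_elem (int p)" using p by simp
  have "multiplicity (int p) (a * d) = multiplicity (int p) (c * b)" by (simp add: eq)
  then have "multiplicity (int p) a + multiplicity (int p) d
      = multiplicity (int p) c + multiplicity (int p) b"
    using ab c d by (simp add: prime_elem_multiplicity_mult_distrib[OF pe])
  then have "int (multiplicity (int p) d) - int (multiplicity (int p) c)
      = int (multiplicity (int p) b) - int (multiplicity (int p) a)"
    by linarith
  moreover have "Fract a b \<noteq> 0" using ab by (simp add: Zero_rat_def eq_rat)
  ultimately show ?thesis by (simp add: padic_abs_def q)
qed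

lemma padic_abs_nonneg [simp]: "padic_abs p q \<ge> 0"
  by (auto simp: padic_abs_def split: prod.splits)

lemma padic_abs_eq_0_iff [simp]: "prime p \<Longrightarrow> padic_abs p q = 0 \<longleftrightarrow> q = 0"
  using prime_gt_0_nat[of p] by (auto simp: padic_abs_def split: prod.splits)

lemma padic_abs_one [simp]: "prime p \<Longrightarrow> padic_abs p 1 = 1"
  using padic_abs_Fract[of p 1 1] by (simp add: One_rat_def)

lemma padic_abs_mult:
  assumes p: "prime p" shows "padic_abs p (x * y) = padic_abs p x * padic_abs p y"
proof (cases "x = 0 \<or> y = 0")
  case False
  obtain a b where x: "x = Fract a b" "b > 0" by (cases x) auto
  obtain c d where y: "y = Fract c d" "d > 0" by (cases y) auto
  have nz: "a \<noteq> 0" "c \<noteq> 0" using False x y by (auto simp: rat_number_collapse)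
  have pe: "prime_elem (int p)" using p by simp
  have p0: "real p \<noteq> 0" using p prime_gt_0_nat by fastforce
  show ?thesis
    using p nz x y p0
    by (simp add: padic_abs_Fract prime_elem_multiplicity_mult_distrib[OF pe]
       power_int_add[symmetric] algebra_simps)
qed auto

lemma padic_abs_minus [simp]: "padic_abs p (- x) = padic_abs p x"
proof -
  have "multiplicity (int p) (- a) = multiplicity (int p) a" for a
    using multiplicity_times_unit_right[of "- 1" "int p" a] by simp
  then show ?thesis
    by (auto simp: padic_abs_def rat_uminus_code Let_def split: prod.splits)
qed

lemma padic_abs_add_le_max:
  assumes p: "prime p" shows "padic_abs p (x + y) \<le> max (padic_abs p x) (padic_abs p y)"
proof (cases "x = 0 \<or> y = 0 \<or> x + y = 0")
  case False
  obtain a b where x: "x = Fract a b" "b > 0" by (cases x) auto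
  obtain c d where y: "y = Fract c d" "d > 0" by (cases y) auto
  define s t u where "s = a * d" and "t = c * b" and "u = b * d"
  have u: "u > 0" using x y by (simp add: u_def)
  have xs: "x = Fract s u" using x y by (simp add: s_def u_def eq_rat)
  have yt: "y = Fract t u" using x y by (simp add: t_def u_def eq_rat)
  have st: "x + y = Fract (s + t) u"
    unfolding xs yt using u by (simp add: eq_rat algebra_simps)
  have nz: "s \<noteq> 0" "t \<noteq> 0" "s + t \<noteq> 0"
    using False xs yt st by (auto simp: rat_number_collapse)
  have p1: "real p \<ge> 1" using p prime_ge_1_nat by auto
  let ?m = "multiplicity (int p)"
  have "int p ^ min (?m s) (?m t) dvd s + t"
    by (intro dvd_add multiplicity_dvd') auto
  then have m: "min (?m s) (?m t) \<le> ?m (s + t)"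
    using nz p by (intro multiplicity_geI) (auto simp: prime_gt_1_nat)
  have "padic_abs p (x + y) = real p powi (int (?m u) - int (?m (s + t)))"
    using st nz u p padic_abs_Fract by simp
  also have "\<dots> \<le> real p powi (int (?m u) - int (min (?m s) (?m t)))"
    using m p1 by (intro power_int_increasing) auto
  also have "\<dots> \<le> max (padic_abs p x) (padic_abs p y)"
    unfolding xs yt using nz u p by (simp add: padic_abs_Fract min_def)
  finally show ?thesis .
qed (auto simp: add_eq_0_iff)

lemma padic_abs_inverse: "prime p \<Longrightarrow> padic_abs p (inverse x) = inverse (padic_abs p x)"
  by (cases "x = 0")
    (auto intro!: inverse_unique[symmetric] simp: padic_abs_mult[symmetric])

lemma padic_abs_minus_commute: "padic_abs p (x - y) = padic_abs p (y - x)"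
  by (metis minus_diff_eq padic_abs_minus)

lemma padic_abs_diff_triangle:
  assumes p: "prime p" shows "\<bar>padic_abs p x - padic_abs p y\<bar> \<le> padic_abs p (x - y)"
proof -
  have "padic_abs p x \<le> max (padic_abs p (x - y)) (padic_abs p y)"
    using padic_abs_add_le_max[OF p, of "x - y" y] by simp
  moreover have "padic_abs p y \<le> max (padic_abs p (x - y)) (padic_abs p x)"
    using padic_abs_add_le_max[OF p, of "y - x" x] by (simp add: padic_abs_minus_commute[of p y x])
  ultimately show ?thesis
    using padic_abs_nonneg[of p x] padic_abs_nonneg[of p y] padic_abs_nonneg[of p "x - y"]
    by linarith
qed

definition padic_cauchy :: "nat \<Rightarrow> (nat \<Rightarrow> rat) \<Rightarrow> bool" where
  "padic_cauchy p X \<longleftrightarrow> (\<forall>e>0. \<exists>N. \<forall>m\<ge>N. \<forall>n\<ge>N. padic_abs p (X m - X n) < e)"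

lemma padic_cauchyI:
  "(\<And>e. e > 0 \<Longrightarrow> \<exists>N. \<forall>m\<ge>N. \<forall>n\<ge>N. padic_abs p (X m - X n) < e) \<Longrightarrow> padic_cauchy p X"
  by (simp add: padic_cauchy_def)

lemma padic_cauchyD:
  "padic_cauchy p X \<Longrightarrow> e > 0 \<Longrightarrow> \<exists>N. \<forall>m\<ge>N. \<forall>n\<ge>N. padic_abs p (X m - X n) < e"
  by (simp add: padic_cauchy_def)

lemma padic_cauchy_const: "padic_cauchy p (\<lambda>n. c)"
  by (auto simp: padic_cauchy_def)

lemma padic_cauchy_add:
  assumes p: "prime p" and X: "padic_cauchy p X" and Y: "padic_cauchy p Y"
  shows "padic_cauchy p (\<lambda>n. X n + Y n)"
proof (rule padic_cauchyI)
  fix e :: real assume e: "e > 0"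
  obtain M where M: "\<forall>m\<ge>M. \<forall>n\<ge>M. padic_abs p (X m - X n) < e"
    using padic_cauchyD[OF X e] by blast
  obtain N where N: "\<forall>m\<ge>N. \<forall>n\<ge>N. padic_abs p (Y m - Y n) < e"
    using padic_cauchyD[OF Y e] by blast
  show "\<exists>N. \<forall>m\<ge>N. \<forall>n\<ge>N. padic_abs p (X m + Y m - (X n + Y n)) < e"
  proof (intro exI[of _ "max M N"] allI impI)
    fix m n assume mn: "max M N \<le> m" "max M N \<le> n"
    have "padic_abs p (X m + Y m - (X n + Y n)) = padic_abs p ((X m - X n) + (Y m - Y n))"
      by (simp add: algebra_simps)
    also have "\<dots> \<le> max (padic_abs p (X m - X n)) (padic_abs p (Y m - Y n))"
      by (rule padic_abs_add_le_max[OF p])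
    also have "\<dots> < e" using mn M N by simp
    finally show "padic_abs p (X m + Y m - (X n + Y n)) < e" .
  qed
qed

lemma padic_cauchy_minus: "padic_cauchy p X \<Longrightarrow> padic_cauchy p (\<lambda>n. - X n)"
  unfolding padic_cauchy_def minus_diff_minus padic_abs_minus .

lemma padic_cauchy_abs:
  assumes p: "prime p" and X: "padic_cauchy p X"
  shows "convergent (\<lambda>n. padic_abs p (X n))"
proof -
  have "Cauchy (\<lambda>n. padic_abs p (X n))"
  proof (rule metric_CauchyI)
    fix e :: real assume e: "e > 0"
    obtain M where "\<forall>m\<ge>M. \<forall>n\<ge>M. padic_abs p (X m - X n) < e"
      using padic_cauchyD[OF X e] by blast
    then show "\<exists>M. \<forall>m\<ge>M. \<forall>n\<ge>M. dist (padic_abs p (X m)) (padic_abs p (X n)) < e"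
      unfolding dist_real_def using padic_abs_diff_triangle[OF p] le_less_trans by blast
  qed
  then show ?thesis by (rule Cauchy_convergent)
qed

lemma padic_cauchy_bounded:
  assumes p: "prime p" and X: "padic_cauchy p X"
  obtains b where "b > 0" "\<And>n. padic_abs p (X n) \<le> b"
proof -
  have "Bseq (\<lambda>n. padic_abs p (X n))"
    using padic_cauchy_abs[OF p X] by (rule convergent_imp_Bseq)
  then show ?thesis using that by (auto simp: Bseq_def)
qed

lemma padic_cauchy_mult:
  assumes p: "prime p" and X: "padic_cauchy p X" and Y: "padic_cauchy p Y"
  shows "padic_cauchy p (\<lambda>n. X n * Y n)"
proof (rule padic_cauchyI)
  fix e :: real assume e: "e > 0"
  obtain a where a: "a > 0" "\<And>n. padic_abs p (X n) \<le> a" using padic_cauchy_bounded[OF p X] by blast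
  obtain b where b: "b > 0" "\<And>n. padic_abs p (Y n) \<le> b" using padic_cauchy_bounded[OF p Y] by blast
  obtain M where M: "\<forall>m\<ge>M. \<forall>n\<ge>M. padic_abs p (X m - X n) < e / b"
    using padic_cauchyD[OF X, of "e / b"] e b by auto
  obtain N where N: "\<forall>m\<ge>N. \<forall>n\<ge>N. padic_abs p (Y m - Y n) < e / a"
    using padic_cauchyD[OF Y, of "e / a"] e a by auto
  show "\<exists>N. \<forall>m\<ge>N. \<forall>n\<ge>N. padic_abs p (X m * Y m - X n * Y n) < e"
  proof (intro exI[of _ "max M N"] allI impI)
    fix m n assume mn: "max M N \<le> m" "max M N \<le> n"
    have "padic_abs p (X m) * padic_abs p (Y m - Y n) \<le> a * padic_abs p (Y m - Y n)"
      using a by (intro mult_right_mono) auto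
    also have "\<dots> < e" using N mn a by (auto simp: field_simps)
    finally have 1: "padic_abs p (X m * (Y m - Y n)) < e" by (simp add: padic_abs_mult[OF p])
    have "padic_abs p (X m - X n) * padic_abs p (Y n) \<le> padic_abs p (X m - X n) * b"
      using b by (intro mult_left_mono) auto
    also have "\<dots> < e" using M mn b by (auto simp: field_simps)
    finally have 2: "padic_abs p ((X m - X n) * Y n) < e" by (simp add: padic_abs_mult[OF p])
    show "padic_abs p (X m * Y m - X n * Y n) < e"
      unfolding mult_diff_mult
      using padic_abs_add_le_max[OF p, of "X m * (Y m - Y n)" "(X m - X n) * Y n"] 1 2 by simp
  qed
qed


subsection \<open>The field of \<open>p\<close>-adic numbers, as the completion of the rationals\<close>

typedef ('p::prime_card) padic_seq = "{X :: nat \<Rightarrow> rat. padic_cauchy CARD('p) X}"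
  morphisms seq_of Padic_seq
  using padic_cauchy_const by blast

setup_lifting type_definition_padic_seq

instantiation padic_seq :: (prime_card) comm_ring_1
begin

lift_definition zero_padic_seq :: "'a padic_seq" is "\<lambda>n. 0"
  by (rule padic_cauchy_const)

lift_definition one_padic_seq :: "'a padic_seq" is "\<lambda>n. 1"
  by (rule padic_cauchy_const)

lift_definition plus_padic_seq :: "'a padic_seq \<Rightarrow> 'a padic_seq \<Rightarrow> 'a padic_seq"
  is "\<lambda>X Y n. X n + Y n"
  by (rule padic_cauchy_add[OF prime_card])

lift_definition uminus_padic_seq :: "'a padic_seq \<Rightarrow> 'a padic_seq" is "\<lambda>X n. - X n"
  by (rule padic_cauchy_minus)

lift_definition minus_padic_seq :: "'a padic_seq \<Rightarrow> 'a padic_seq \<Rightarrow> 'a padic_seq"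
  is "\<lambda>X Y n. X n - Y n"
  using padic_cauchy_add[OF prime_card, OF _ padic_cauchy_minus] by simp

lift_definition times_padic_seq :: "'a padic_seq \<Rightarrow> 'a padic_seq \<Rightarrow> 'a padic_seq"
  is "\<lambda>X Y n. X n * Y n"
  by (rule padic_cauchy_mult[OF prime_card])

instance
  by (standard; transfer) (auto simp: algebra_simps fun_eq_iff)

end

lift_definition seq_abs :: "'p::prime_card padic_seq \<Rightarrow> real"
  is "\<lambda>X. lim (\<lambda>n. padic_abs CARD('p) (X n))" .

lemma seq_abs_tendsto:
  fixes X :: "'p::prime_card padic_seq"
  shows "(\<lambda>n. padic_abs CARD('p) (seq_of X n)) \<longlonglongrightarrow> seq_abs X"
  using padic_cauchy_abs[OF prime_card, of "seq_of X"] seq_of[of X]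
  by (simp add: seq_abs.rep_eq convergent_LIMSEQ_iff)

lemma seq_abs_eqI:
  fixes X :: "'p::prime_card padic_seq"
  shows "(\<lambda>n. padic_abs CARD('p) (seq_of X n)) \<longlonglongrightarrow> c \<Longrightarrow> seq_abs X = c"
  using LIMSEQ_unique seq_abs_tendsto by blast

lemma seq_abs_nonneg: "seq_abs X \<ge> 0"
  by (rule LIMSEQ_le_const[OF seq_abs_tendsto]) auto

lemma seq_abs_zero [simp]: "seq_abs 0 = 0"
  by (rule seq_abs_eqI) (simp add: zero_padic_seq.rep_eq)

lemma seq_abs_one [simp]: "seq_abs 1 = 1"
  by (rule seq_abs_eqI) (simp add: one_padic_seq.rep_eq prime_card)

lemma seq_abs_minus [simp]: "seq_abs (- X) = seq_abs X"
  by (rule seq_abs_eqI) (simp add: uminus_padic_seq.rep_eq seq_abs_tendsto)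

lemma seq_abs_mult: "seq_abs (X * Y) = seq_abs X * seq_abs Y"
  by (rule seq_abs_eqI)
    (simp add: times_padic_seq.rep_eq padic_abs_mult prime_card seq_abs_tendsto tendsto_mult)

lemma seq_abs_add_le_max: "seq_abs (X + Y) \<le> max (seq_abs X) (seq_abs Y)"
  by (rule LIMSEQ_le[OF seq_abs_tendsto tendsto_max[OF seq_abs_tendsto seq_abs_tendsto]])
    (auto simp: plus_padic_seq.rep_eq intro!: padic_abs_add_le_max prime_card)

definition padic_rel :: "'p::prime_card padic_seq \<Rightarrow> 'p padic_seq \<Rightarrow> bool" where
  "padic_rel X Y \<longleftrightarrow> seq_abs (X - Y) = 0"

lemma seq_abs_diff_commute: "seq_abs (X - Y) = seq_abs (Y - X)"
  by (metis minus_diff_eq seq_abs_minus)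

lemma padic_rel_abs: "padic_rel X Y \<Longrightarrow> seq_abs X = seq_abs Y"
  using seq_abs_add_le_max[of "X - Y" Y] seq_abs_add_le_max[of "Y - X" X]
    seq_abs_nonneg[of X] seq_abs_nonneg[of Y]
  by (simp add: padic_rel_def seq_abs_diff_commute[of Y X])

lemma padic_rel_add:
  assumes "padic_rel X X'" "padic_rel Y Y'" shows "padic_rel (X + Y) (X' + Y')"
  using seq_abs_add_le_max[of "X - X'" "Y - Y'"] assms seq_abs_nonneg[of "X - X' + (Y - Y')"]
  by (simp add: padic_rel_def algebra_simps)

lemma padic_rel_minus: "padic_rel X X' \<Longrightarrow> padic_rel (- X) (- X')"
  by (simp add: padic_rel_def seq_abs_diff_commute[of X])

lemma padic_rel_mult:
  assumes "padic_rel X X'" "padic_rel Y Y'" shows "padic_rel (X * Y) (X' * Y')"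
  using seq_abs_add_le_max[of "X * (Y - Y')" "(X - X') * Y'"] assms seq_abs_nonneg[of "X * Y - X' * Y'"]
  by (simp add: padic_rel_def seq_abs_mult mult_diff_mult)

lemma equivp_padic_rel: "equivp (padic_rel :: 'p::prime_card padic_seq \<Rightarrow> _)"
proof (rule equivpI)
  show "reflp (padic_rel :: 'p padic_seq \<Rightarrow> _)"
    by (rule reflpI) (simp add: padic_rel_def)
  show "symp (padic_rel :: 'p padic_seq \<Rightarrow> _)"
    by (rule sympI) (simp add: padic_rel_def seq_abs_diff_commute)
  show "transp (padic_rel :: 'p padic_seq \<Rightarrow> _)"
  proof (rule transpI)
    fix X Y Z :: "'p padic_seq"
    assume "padic_rel X Y" "padic_rel Y Z"
    then show "padic_rel X Z"
      using seq_abs_add_le_max[of "X - Y" "Y - Z"] seq_abs_nonneg[of "X - Z"]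
      by (simp add: padic_rel_def)
  qed
qed

lemma padic_seq_inverse_ex:
  fixes X :: "'p::prime_card padic_seq"
  assumes X: "\<not> padic_rel X 0"
  shows "\<exists>Y. padic_rel (X * Y) 1"
proof -
  let ?N = "padic_abs CARD('p)" and ?x = "seq_of X"
  note pr = prime_card[where 'a = 'p]
  define c where "c = seq_abs X / 2"
  have c: "c > 0" "c < seq_abs X" using X seq_abs_nonneg[of X] by (auto simp: padic_rel_def c_def)
  obtain M where M: "\<And>n. n \<ge> M \<Longrightarrow> ?N (?x n) > c"
    using order_tendstoD(1)[OF seq_abs_tendsto c(2)] by (auto simp: eventually_sequentially)
  have nz: "?x n \<noteq> 0" if "n \<ge> M" for n using M[OF that] c by auto
  have X': "padic_cauchy CARD('p) ?x" using seq_of[of X] by simp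
  have C: "padic_cauchy CARD('p) (\<lambda>n. inverse (?x n))"
  proof (rule padic_cauchyI)
    fix e :: real assume e: "e > 0"
    obtain K where K: "\<forall>m\<ge>K. \<forall>n\<ge>K. ?N (?x m - ?x n) < e * (c * c)"
      using padic_cauchyD[OF X', of "e * (c * c)"] e c by auto
    show "\<exists>N. \<forall>m\<ge>N. \<forall>n\<ge>N. ?N (inverse (?x m) - inverse (?x n)) < e"
    proof (intro exI[of _ "max M K"] allI impI)
      fix m n assume mn: "max M K \<le> m" "max M K \<le> n"
      have "?N (inverse (?x m) - inverse (?x n))
          = inverse (?N (?x m)) * ?N (?x m - ?x n) * inverse (?N (?x n))"
        using mn nz by (simp add: inverse_diff_inverse padic_abs_mult[OF pr] padic_abs_inverse[OF pr])
      also have "\<dots> = ?N (?x m - ?x n) / (?N (?x m) * ?N (?x n))" by (simp add: divide_simps)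
      also have "\<dots> \<le> ?N (?x m - ?x n) / (c * c)"
        using M[of m] M[of n] mn c by (intro divide_left_mono mult_mono mult_pos_pos) auto
      also have "\<dots> < e" using K mn c by (simp add: divide_simps)
      finally show "?N (inverse (?x m) - inverse (?x n)) < e" .
    qed
  qed
  define Y :: "'p padic_seq" where "Y = Padic_seq (\<lambda>n. inverse (?x n))"
  have Y: "seq_of Y = (\<lambda>n. inverse (?x n))"
    unfolding Y_def using C by (simp add: Padic_seq_inverse)
  have "\<forall>\<^sub>F n in sequentially. ?N (seq_of (X * Y - 1) n) = 0"
    using eventually_ge_at_top[of M]
    by eventually_elim
      (simp add: minus_padic_seq.rep_eq times_padic_seq.rep_eq one_padic_seq.rep_eq Y nz)
  then have "seq_abs (X * Y - 1) = 0" by (intro seq_abs_eqI tendsto_eventually)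
  then show ?thesis unfolding padic_rel_def by blast
qed

quotient_type 'p padic = "'p::prime_card padic_seq" / padic_rel
  by (rule equivp_padic_rel)

instantiation padic :: (prime_card) comm_ring_1
begin

lift_definition zero_padic :: "'a padic" is 0 .

lift_definition one_padic :: "'a padic" is 1 .

lift_definition plus_padic :: "'a padic \<Rightarrow> 'a padic \<Rightarrow> 'a padic" is "(+)"
  by (rule padic_rel_add)

lift_definition uminus_padic :: "'a padic \<Rightarrow> 'a padic" is uminus
  by (rule padic_rel_minus)

lift_definition times_padic :: "'a padic \<Rightarrow> 'a padic \<Rightarrow> 'a padic" is "(*)"
  by (rule padic_rel_mult)

definition minus_padic :: "'a padic \<Rightarrow> 'a padic \<Rightarrow> 'a padic" where
  "minus_padic x y = x + - y"

lemma padic_rel_refl: "padic_rel X X"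
  by (simp add: padic_rel_def)

instance
proof
  fix a b c :: "'a padic"
  show "a + b + c = a + (b + c)" by transfer (simp add: algebra_simps padic_rel_refl)
  show "a + b = b + a" by transfer (simp add: algebra_simps padic_rel_refl)
  show "0 + a = a" by transfer (simp add: padic_rel_refl)
  show "- a + a = 0" by transfer (simp add: padic_rel_refl)
  show "a - b = a + - b" by (fact minus_padic_def)
  show "a * b * c = a * (b * c)" by transfer (simp add: algebra_simps padic_rel_refl)
  show "a * b = b * a" by transfer (simp add: algebra_simps padic_rel_refl)
  show "1 * a = a" by transfer (simp add: padic_rel_refl)
  show "(a + b) * c = a * c + b * c" by transfer (simp add: algebra_simps padic_rel_refl)
  show "(0::'a padic) \<noteq> 1" by transfer (simp add: padic_rel_def)
qed

end

lift_definition padic_norm :: "'p::prime_card padic \<Rightarrow> real" is seq_abs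
  by (rule padic_rel_abs)

lemma padic_norm_nonneg [simp]: "padic_norm x \<ge> 0"
  by transfer (rule seq_abs_nonneg)

lemma padic_norm_eq_0_iff [simp]: "padic_norm x = 0 \<longleftrightarrow> x = 0"
  by transfer (simp add: padic_rel_def)

lemma padic_norm_one [simp]: "padic_norm 1 = 1"
  by transfer simp

lemma padic_norm_minus [simp]: "padic_norm (- x) = padic_norm x"
  by transfer simp

lemma padic_norm_mult: "padic_norm (x * y) = padic_norm x * padic_norm y"
  by transfer (rule seq_abs_mult)

lemma padic_norm_add_le_max: "padic_norm (x + y) \<le> max (padic_norm x) (padic_norm y)"
  by transfer (rule seq_abs_add_le_max)

instantiation padic :: (prime_card) field
begin

definition inverse_padic :: "'a padic \<Rightarrow> 'a padic" where
  "inverse_padic x = (if x = 0 then 0 else THE y. x * y = 1)"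

definition divide_padic :: "'a padic \<Rightarrow> 'a padic \<Rightarrow> 'a padic" where
  "divide_padic x y = x * inverse y"

instance
proof
  fix x y :: "'a padic"
  show "x div y = x * inverse y" by (fact divide_padic_def)
  show "inverse (0::'a padic) = 0" by (simp add: inverse_padic_def)
  assume x: "x \<noteq> 0"
  then obtain z where z: "x * z = 1"
    by transfer (use padic_seq_inverse_ex in blast)
  have "(THE y. x * y = 1) = z"
  proof (rule the_equality)
    show "x * z = 1" by (rule z)
    fix w assume "x * w = 1"
    have "w = w * (x * z)" by (simp add: z)
    also have "\<dots> = (x * w) * z" by (simp only: mult_ac)
    finally show "w = z" by (simp add: \<open>x * w = 1\<close>)
  qed
  then show "inverse x * x = 1" using x z by (simp add: inverse_padic_def mult.commute)
qed

end

lemma padic_norm_of_int: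
  "padic_norm (of_int k :: 'p::prime_card padic) = padic_abs CARD('p) (of_int k)"
proof -
  have nat: "of_nat n = (abs_padic (Padic_seq (\<lambda>_. of_nat n)) :: 'p padic)" for n
  proof (induction n)
    case 0
    then show ?case by (simp add: zero_padic_def zero_padic_seq_def)
  next
    case (Suc n)
    then show ?case
      by (simp add: one_padic_def one_padic_seq_def plus_padic.abs_eq plus_padic_seq.abs_eq
        eq_onp_def padic_cauchy_const)
  qed
  have nat': "padic_norm (of_nat n :: 'p padic) = padic_abs CARD('p) (of_nat n)" for n
    unfolding nat padic_norm.abs_eq by (rule seq_abs_eqI) (simp add: Padic_seq_inverse padic_cauchy_const)
  show ?thesis
  proof (cases "k \<ge> 0")
    case True
    then show ?thesis using nat'[of "nat k"] by simp
  next
    case False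
    then have "k = - int (nat (- k))" by simp
    then obtain n where "k = - int n" by blast
    then show ?thesis using nat'[of n] by simp
  qed
qed

instance padic :: (prime_card) field_char_0
proof
  show "inj (of_nat :: nat \<Rightarrow> 'a padic)"
  proof (rule injI)
    fix m n :: nat assume "of_nat m = (of_nat n :: 'a padic)"
    then have "padic_norm (of_int (int m - int n) :: 'a padic) = 0" by simp
    then show "m = n" unfolding padic_norm_of_int by (simp add: prime_card)
  qed
qed

instantiation padic :: (prime_card) metric_space
begin

definition dist_padic :: "'a padic \<Rightarrow> 'a padic \<Rightarrow> real" where
  "dist_padic x y = padic_norm (x - y)"

definition uniformity_padic :: "('a padic \<times> 'a padic) filter" where
  "uniformity_padic = (INF e\<in>{0<..}. principal {(x, y). dist x y < e})"

definition open_padic :: "'a padic set \<Rightarrow> bool" where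
  "open_padic U \<longleftrightarrow> (\<forall>x\<in>U. eventually (\<lambda>(x', y). x' = x \<longrightarrow> y \<in> U) uniformity)"

instance
proof
  fix x y z :: "'a padic"
  show "dist x y = 0 \<longleftrightarrow> x = y" by (simp add: dist_padic_def)
  have "padic_norm (x - y) = padic_norm ((x - z) + (z - y))" by simp
  also have "\<dots> \<le> max (padic_norm (x - z)) (padic_norm (z - y))"
    by (rule padic_norm_add_le_max)
  also have "padic_norm (z - y) = padic_norm (y - z)" by (metis minus_diff_eq padic_norm_minus)
  finally show "dist x y \<le> dist x z + dist y z"
    using padic_norm_nonneg[of "x - z"] padic_norm_nonneg[of "y - z"] 
    unfolding dist_padic_def by linarith
qed (simp_all add: uniformity_padic_def open_padic_def)

end

lemma padic_norm_of_rat: "padic_norm (of_rat q :: 'p::prime_card padic) = padic_abs CARD('p) q"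
proof -
  obtain a b where q: "q = Fract a b" "b > 0" by (cases q) auto
  define r :: "'p padic" where "r = of_rat q"
  have b: "of_int b \<noteq> (0::rat)" using q by simp
  have "r * of_int b = of_int a"
    using q by (simp add: r_def of_rat_rat)
  then have 1: "padic_norm r * padic_abs CARD('p) (of_int b) = padic_abs CARD('p) (of_int a)"
    by (simp only: padic_norm_of_int[symmetric, where 'p = 'p] padic_norm_mult[symmetric])
  have "q * of_int b = of_int a"
    using q by (simp add: Fract_of_int_quotient)
  then have 2: "padic_abs CARD('p) q * padic_abs CARD('p) (of_int b) = padic_abs CARD('p) (of_int a)"
    by (simp only: padic_abs_mult[OF prime_card, symmetric])
  have 3: "padic_abs CARD('p) (of_int b) \<noteq> 0"
    unfolding padic_abs_eq_0_iff[OF prime_card] by (rule b)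
  have "padic_norm r = padic_abs CARD('p) q"
    by (rule mult_right_cancel[OF 3, THEN iffD1]) (simp only: 1 2)
  then show ?thesis by (unfold r_def)
qed


subsection \<open>Balls, ball-morphisms and the unitary action\<close>

definition padic_ball :: "'p::prime_card padic set \<Rightarrow> bool" where
  "padic_ball B \<longleftrightarrow> (\<exists>a. \<exists>k::int. B = {x. padic_norm (x - a) \<le> real CARD('p) powi k})"

definition maximal_subballs :: "'p::prime_card padic set \<Rightarrow> 'p padic set set" where
  "maximal_subballs B =
     {C. padic_ball C \<and> C \<subset> B \<and> (\<forall>D. padic_ball D \<and> D \<subset> B \<and> C \<subseteq> D \<longrightarrow> D = C)}"

definition ball_morphism :: "('p::prime_card padic \<Rightarrow> 'p padic) \<Rightarrow> bool" where
  "ball_morphism G \<longleftrightarrow>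
     bij G \<and> (\<forall>B. padic_ball B \<longrightarrow> padic_ball (G ` B) \<and> padic_ball (G -` B))"

definition padic_isometry :: "('p::prime_card padic \<Rightarrow> 'p padic) \<Rightarrow> bool" where
  "padic_isometry \<phi> \<longleftrightarrow> bij \<phi> \<and> (\<forall>x y. padic_norm (\<phi> x - \<phi> y) = padic_norm (x - y))"

text \<open>
  The exponent \<open>\<gamma>\<close> in \<open>G x = \<phi> (p\<^sup>\<gamma> x)\<close>, \<open>\<phi>\<close> an isometry: every ball-morphism has such a
  representation, and \<open>G\<close> determines \<open>\<gamma>\<close> because it scales all distances by \<open>p\<^sup>-\<^sup>\<gamma>\<close>.
\<close>

definition dilation_exponent :: "('p::prime_card padic \<Rightarrow> 'p padic) \<Rightarrow> int" where
  "dilation_exponent G =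
     (THE \<gamma>. \<exists>\<phi>. padic_isometry \<phi> \<and> G = (\<lambda>x. \<phi> (of_nat CARD('p) powi \<gamma> * x)))"

definition unitary_action ::
  "('p::prime_card padic \<Rightarrow> 'p padic) \<Rightarrow> ('p padic \<Rightarrow> complex) \<Rightarrow> 'p padic \<Rightarrow> complex" where
  "unitary_action G f =
     (\<lambda>x. of_real (real CARD('p) powr (- real_of_int (dilation_exponent G) / 2)) * f (G x))"

definition ball_morphism_orbit ::
  "('p::prime_card padic \<Rightarrow> complex) \<Rightarrow> ('p padic \<Rightarrow> complex) set" where
  "ball_morphism_orbit f = {unitary_action G f | G. ball_morphism G}"


subsection \<open>The \<open>p\<close>-adic wavelet\<close>

definition padic_integers :: "'p::prime_card padic set" where
  "padic_integers = {x. padic_norm x \<le> 1}"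

definition padic_expansion :: "'p::prime_card padic \<Rightarrow> int \<Rightarrow> (int \<Rightarrow> nat) \<Rightarrow> bool" where
  "padic_expansion x \<gamma> d \<longleftrightarrow>
     (\<forall>j\<ge>\<gamma>. d j < CARD('p)) \<and>
     (\<lambda>n. of_nat (d (\<gamma> + int n)) * of_nat CARD('p) powi (\<gamma> + int n)) sums x"

text \<open>
  Expansions of \<open>x\<close> from different starting indices \<open>\<gamma>\<close> differ only by leading zero digits, so
  the value described here does not depend on \<open>\<gamma>\<close>; the sum is empty if \<open>\<gamma> \<ge> 0\<close>.
\<close>

definition padic_char :: "'p::prime_card padic \<Rightarrow> complex" where
  "padic_char x =
     (THE z. \<exists>\<gamma> d. padic_expansion x \<gamma> d \<and>
        z = exp (2 * of_real pi * \<i> * (\<Sum>j\<in>{\<gamma>..-1}. of_nat (d j) * of_nat CARD('p) powi j)))"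

definition padic_wavelet :: "'p::prime_card padic \<Rightarrow> complex" where
  "padic_wavelet x = padic_char (inverse (of_nat CARD('p)) * x) * indicator padic_integers x"


subsection \<open>Haar measure, \<open>L\<^sup>2\<close> and frames\<close>

text \<open>
  The normalized Haar measure on the Borel sets. Finiteness on compact sets is implied: the
  translates of the open set \<open>\<int>\<^sub>p\<close> cover, and each has measure one.
\<close>

definition normalized_haar :: "'p::prime_card padic measure \<Rightarrow> bool" where
  "normalized_haar \<mu> \<longleftrightarrow>
     sets \<mu> = sets borel \<and>
     (\<forall>a. \<forall>A\<in>sets borel. emeasure \<mu> ((\<lambda>x. a + x) ` A) = emeasure \<mu> A) \<and>
     emeasure \<mu> padic_integers = 1"

definition square_integrable :: "'a measure \<Rightarrow> ('a \<Rightarrow> complex) \<Rightarrow> bool" where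
  "square_integrable M f \<longleftrightarrow>
     f \<in> borel_measurable M \<and> integrable M (\<lambda>x. (cmod (f x))\<^sup>2)"

definition l2_inner :: "'a measure \<Rightarrow> ('a \<Rightarrow> complex) \<Rightarrow> ('a \<Rightarrow> complex) \<Rightarrow> complex" where
  "l2_inner M f g = (\<integral>x. f x * cnj (g x) \<partial>M)"

definition l2_norm :: "'a measure \<Rightarrow> ('a \<Rightarrow> complex) \<Rightarrow> real" where
  "l2_norm M f = sqrt (\<integral>x. (cmod (f x))\<^sup>2 \<partial>M)"

text \<open>
  Elements of \<open>L\<^sup>2\<close> are represented by functions. The second condition says that the
  functions in \<open>F\<close> represent pairwise different elements of \<open>L\<^sup>2\<close>, so that a sum over \<open>F\<close> is a
  sum over a set of elements of \<open>L\<^sup>2\<close>.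
\<close>

definition l2_set :: "'a measure \<Rightarrow> ('a \<Rightarrow> complex) set \<Rightarrow> bool" where
  "l2_set M F \<longleftrightarrow>
     (\<forall>f\<in>F. square_integrable M f) \<and>
     (\<forall>f\<in>F. \<forall>g\<in>F. (AE x in M. f x = g x) \<longrightarrow> f = g)"

definition l2_frame_bounds :: "'a measure \<Rightarrow> ('a \<Rightarrow> complex) set \<Rightarrow> real \<Rightarrow> real \<Rightarrow> bool" where
  "l2_frame_bounds M F A B \<longleftrightarrow>
     l2_set M F \<and> 0 < A \<and> 0 < B \<and>
     (\<forall>g. square_integrable M g \<longrightarrow>
        (\<lambda>f. (cmod (l2_inner M g f))\<^sup>2) summable_on F \<and>
        A * (l2_norm M g)\<^sup>2 \<le> (\<Sum>\<^sub>\<infinity>f\<in>F. (cmod (l2_inner M g f))\<^sup>2) \<and>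
        (\<Sum>\<^sub>\<infinity>f\<in>F. (cmod (l2_inner M g f))\<^sup>2) \<le> B * (l2_norm M g)\<^sup>2)"

definition l2_tight_frame :: "'a measure \<Rightarrow> ('a \<Rightarrow> complex) set \<Rightarrow> real \<Rightarrow> bool" where
  "l2_tight_frame M F A \<longleftrightarrow> l2_frame_bounds M F A A"

definition l2_uniform :: "'a measure \<Rightarrow> ('a \<Rightarrow> complex) set \<Rightarrow> bool" where
  "l2_uniform M F \<longleftrightarrow> (\<exists>c. \<forall>f\<in>F. l2_norm M f = c)"


subsection \<open>Functions related to a ball\<close>

definition related_to_ball ::
  "'p::prime_card padic measure \<Rightarrow> 'p padic set \<Rightarrow> ('p padic \<Rightarrow> complex) \<Rightarrow> bool" where
  "related_to_ball \<mu> B f \<longleftrightarrow>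
     (\<exists>c. f = (\<lambda>x. \<Sum>C\<in>maximal_subballs B. c C * indicator C x)) \<and> (\<integral>x. f x \<partial>\<mu>) = 0"

definition ball_wavelets ::
  "'p::prime_card padic measure \<Rightarrow> 'p padic set \<Rightarrow> ('p padic \<Rightarrow> complex) set" where
  "ball_wavelets \<mu> B =
     {f. (\<forall>x. x \<notin> B \<longrightarrow> f x = 0) \<and> l2_norm \<mu> f = 1 \<and>
         (\<exists>c>0. \<exists>m :: 'p padic set \<Rightarrow> nat.
            m ` maximal_subballs B \<subseteq> {..<CARD('p)} \<and> inj_on m (maximal_subballs B) \<and>
            (\<forall>C\<in>maximal_subballs B. \<forall>x\<in>C.
               f x = of_real c * exp (2 * of_real pi * \<i> * of_nat (m C) / of_nat CARD('p))))}"

end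

theory Submission
  imports Defs
begin

text \<open>
  Write \<open>p\<close> for the cardinality of the index type. The proof has two independent halves.

  \<^bold>\<open>The orbit.\<close> A ball-morphism preserves the relation of being a maximal subball, so on each
  increasing chain of balls it shifts all radii by the same power of \<open>p\<close>; since any two points
  lie in a common ball, the shift is global, and a ball-morphism is the same thing as a bijection
  that multiplies every distance by one and the same power of \<open>p\<close>
  (\<open>ball_morphism_scales_distances\<close>). For such a \<open>G\<close> the preimage of \<open>\<int>\<^sub>p\<close> is a ball whose maximal
  subballs correspond to the residue classes modulo \<open>p\<close>, and on the class of \<open>n\<close> the wavelet is
  the constant \<open>exp (2\<pi>in/p)\<close> (\<open>padic_wavelet_eq\<close>). Hence \<open>\<psi> \<circ> G\<close> distributes the \<open>p\<close>-th roots of unity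
  bijectively over these subballs. Every distribution occurs, because any permutation of the
  zeroth digit is an isometry (\<open>digit_permutation_isometry\<close>). So the orbit consists of the
  functions \<open>ball_wavelet a k \<sigma>\<close> with \<open>\<sigma>\<close> a permutation of \<open>{..<p}\<close>
  (\<open>ball_morphism_orbit_wavelet\<close>), and each ball contributes \<open>p!\<close> of them.

  \<^bold>\<open>The frame.\<close> For numbers \<open>a\<^sub>0, \<dots>, a\<^sub>p\<^sub>-\<^sub>1\<close>, averaging over all permutations gives
  \<open>\<Sum>\<^sub>\<sigma> |\<Sum>\<^sub>j a\<^sub>j \<omega>\<^sup>-\<^sup>\<sigma>\<^sup>(\<^sup>j\<^sup>)|\<^sup>2 = p!/(p-1) (p \<Sum>\<^sub>j |a\<^sub>j|\<^sup>2 - |\<Sum>\<^sub>j a\<^sub>j|\<^sup>2)\<close>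
  (\<open>sum_permutations_cmod2\<close>), because the \<open>p \<times> p\<close> matrix of the quadratic form on the left is
  invariant under permutations and annihilates constants. With \<open>a\<^sub>j\<close> the integrals of \<open>g\<close> over the
  maximal subballs of \<open>B\<close>, the wavelets of \<open>B\<close> contribute \<open>p!/(p-1)\<close> times the detail energy
  \<open>\<Sum>\<^sub>C E(C) - E(B)\<close>, where \<open>E(B) = |\<integral>\<^sub>B g|\<^sup>2 / \<mu>(B)\<close> and \<open>C\<close> runs over the maximal subballs
  (\<open>sum_ball_wavelets\<close>). Summed over the balls inside a large ball \<open>D\<close> down to some radius, the
  detail energies telescope to \<open>\<Sum>\<^sub>C E(C) - E(D)\<close> with \<open>C\<close> running over the smallest balls. The sum
  over \<open>C\<close> is at most \<open>\<integral>\<^sub>D |g|\<^sup>2\<close> and comes arbitrarily close to it, since locally constant functions are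
  dense in \<open>L\<^sup>2\<close> (\<open>approximable_square_integrable\<close>); and \<open>E(D)\<close> tends to zero as \<open>D\<close> grows, since
  \<open>g\<close> is square integrable and \<open>\<mu>(D)\<close> tends to infinity. Hence the detail energies of \<open>g\<close> sum to \<open>\<parallel>g\<parallel>\<^sup>2\<close>
  (\<open>detail_energy_has_sum\<close>).
\<close>


section \<open>Absolute value and digits of \<open>p\<close>-adic numbers\<close>

lemma CARD_prime_gt_1: "CARD('p::prime_card) > 1"
  using prime_card[where 'a = 'p] prime_gt_1_nat by blast

lemma real_CARD_gt_1: "real CARD('p::prime_card) > 1"
  using CARD_prime_gt_1[where 'p = 'p] by simp

lemma CARD_powi_pos [simp]: "real CARD('p::prime_card) powi k > 0"
  by (simp add: zero_less_power_int)

lemma CARD_powi_le_iff [simp]: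
  "real CARD('p::prime_card) powi k \<le> real CARD('p) powi l \<longleftrightarrow> k \<le> l"
  using power_int_strict_increasing[of l k "real CARD('p)"] power_int_increasing[of k l "real CARD('p)"]
    real_CARD_gt_1[where 'p = 'p] by (metis less_le_not_le linorder_not_less order_less_imp_le)

lemma CARD_powi_less_iff [simp]:
  "real CARD('p::prime_card) powi k < real CARD('p) powi l \<longleftrightarrow> k < l"
  by (simp add: less_le_not_le)

lemma padic_norm_0 [simp]: "padic_norm 0 = 0"
  by simp

lemma padic_norm_minus_commute: "padic_norm (x - y) = padic_norm (y - x)"
  by (metis minus_diff_eq padic_norm_minus)

lemma padic_norm_inverse: "padic_norm (inverse x) = inverse (padic_norm x)"
  by (cases "x = 0") (auto intro!: inverse_unique[symmetric] simp: padic_norm_mult[symmetric])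

lemma padic_norm_CARD: "padic_norm (of_nat CARD('p) :: 'p::prime_card padic) = inverse (real CARD('p))"
proof -
  have m: "multiplicity (int CARD('p)) (int CARD('p)) = 1"
    using CARD_prime_gt_1[where 'p = 'p] by (intro multiplicity_self) auto
  show ?thesis
    using padic_norm_of_int[of "int CARD('p)", where 'p = 'p] padic_abs_Fract[OF prime_card[where 'a = 'p], of "int CARD('p)" 1] m
    by (simp add: of_int_rat[symmetric] power_int_minus)
qed

lemma padic_norm_power: "padic_norm (x ^ n) = padic_norm x ^ n"
  by (induction n) (auto simp: padic_norm_mult)

lemma padic_norm_CARD_powi [simp]:
  "padic_norm (of_nat CARD('p) powi k :: 'p::prime_card padic) = real CARD('p) powi (- k)"
  by (auto simp: power_int_def padic_norm_power padic_norm_inverse padic_norm_CARD power_inverse)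

lemma padic_norm_diff_le: "padic_norm x \<le> c \<Longrightarrow> padic_norm y \<le> c \<Longrightarrow> padic_norm (x - y) \<le> c"
  using padic_norm_add_le_max[of x "- y"] by simp

lemma padic_norm_add_le: "padic_norm x \<le> c \<Longrightarrow> padic_norm y \<le> c \<Longrightarrow> padic_norm (x + y) \<le> c"
  using padic_norm_add_le_max[of x y] by simp

lemma padic_norm_sum_le:
  assumes "\<And>i. i \<in> A \<Longrightarrow> padic_norm (f i) \<le> c" "0 \<le> c"
  shows "padic_norm (sum f A) \<le> c"
  using assms by (induction A rule: infinite_finite_induct) (auto intro: padic_norm_add_le)

lemma padic_norm_eq_of_near:
  assumes "padic_norm (x - y) < padic_norm x" shows "padic_norm y = padic_norm x"
  using assms padic_norm_add_le_max[of "x - y" y] padic_norm_add_le_max[of x "y - x"]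
  by (auto simp: padic_norm_minus_commute[of y x] max_def split: if_splits)

text \<open>
  A \<open>p\<close>-adic number is a class of Cauchy sequences of rationals, and the terms of any
  representative converge to it.
\<close>

lemma of_rat_dense_padic:
  fixes x :: "'p::prime_card padic"
  assumes "e > 0"
  shows "\<exists>q. padic_norm (x - of_rat q) < e"
proof -
  obtain X where x: "x = abs_padic X" using padic.abs_induct[of "\<lambda>x. \<exists>X. x = abs_padic X" x] by blast
  have sof_nat: "seq_of (of_nat n :: 'p padic_seq) = (\<lambda>_. of_nat n)" for n
    by (induction n) (auto simp: zero_padic_seq.rep_eq one_padic_seq.rep_eq plus_padic_seq.rep_eq)
  have sof_int: "seq_of (of_int n :: 'p padic_seq) = (\<lambda>_. of_int n)" for n
    by (cases n) (auto simp: sof_nat uminus_padic_seq.rep_eq simp del: of_nat_Suc)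
  have aof_nat: "abs_padic (of_nat n) = (of_nat n :: 'p padic)" for n
  proof (induction n)
    case (Suc n)
    have "abs_padic (1 + of_nat n) = (1 + of_nat n :: 'p padic)"
      by (simp only: plus_padic.abs_eq[symmetric] Suc one_padic_def)
    then show ?case by simp
  qed (simp add: zero_padic_def)
  have aof_int: "abs_padic (of_int n) = (of_int n :: 'p padic)" for n
    by (cases n) (auto simp: aof_nat uminus_padic.abs_eq[symmetric] simp del: of_nat_Suc)
  have "padic_cauchy CARD('p) (seq_of X)" using seq_of[of X] by simp
  from padic_cauchyD[OF this, of "e / 2"] assms
  obtain N where N: "\<And>m n. m \<ge> N \<Longrightarrow> n \<ge> N \<Longrightarrow> padic_abs CARD('p) (seq_of X m - seq_of X n) < e / 2" by auto
  define q where "q = seq_of X N"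
  obtain a b where q: "q = Fract a b" "b > 0" by (cases q) auto
  have qb: "q * of_int b = of_int a" using q by (simp add: Fract_of_int_quotient)
  have b0: "of_int b \<noteq> (0 :: 'p padic)" using q by simp
  \<comment> \<open>clearing the denominator, only integers need to be compared with their images\<close>
  define Y where "Y = X * of_int b - of_int a"
  have y: "abs_padic Y = x * of_int b - of_int a"
    unfolding Y_def x aof_int[symmetric] times_padic.abs_eq minus_padic_def uminus_padic.abs_eq plus_padic.abs_eq by simp
  have sY: "seq_of Y m = (seq_of X m - q) * of_int b" for m
    unfolding Y_def by (simp add: minus_padic_seq.rep_eq times_padic_seq.rep_eq sof_int qb[symmetric] algebra_simps)
  have nb: "padic_abs CARD('p) (of_int b) > 0"
    using q padic_abs_eq_0_iff[OF prime_card[where 'a = 'p], of "of_int b"] padic_abs_nonneg[of "CARD('p)" "of_int b"]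
    by (metis of_int_eq_0_iff order_le_less order_less_irrefl)
  have "seq_abs Y \<le> e / 2 * padic_abs CARD('p) (of_int b)"
  proof (rule LIMSEQ_le_const2[OF seq_abs_tendsto], intro exI[of _ N] allI impI)
    fix m assume "N \<le> m"
    then show "padic_abs CARD('p) (seq_of Y m) \<le> e / 2 * padic_abs CARD('p) (of_int b)"
      using N[of m N] unfolding sY padic_abs_mult[OF prime_card] q_def
      by (intro mult_right_mono) auto
  qed
  then have "padic_norm (x * of_int b - of_int a) \<le> e / 2 * padic_norm (of_int b :: 'p padic)"
    by (simp add: y[symmetric] padic_norm.abs_eq padic_norm_of_int)
  moreover have "x * of_int b - of_int a = (x - of_rat q) * of_int b"
    using q b0 by (simp add: of_rat_rat field_simps)
  ultimately have "padic_norm (x - of_rat q) \<le> e / 2"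
    using nb by (simp add: padic_norm_mult padic_norm_of_int)
  then show ?thesis using assms by (intro exI[of _ q]) auto
qed

text \<open>
  The values on rationals are powers of \<open>p\<close> by definition, and by the ultrametric inequality \<open>x\<close>
  has the same norm as every rational closer to \<open>x\<close> than \<open>|x|\<close>.
\<close>

lemma padic_norm_value:
  fixes x :: "'p::prime_card padic"
  assumes "x \<noteq> 0"
  obtains k where "padic_norm x = real CARD('p) powi k"
proof -
  have "padic_norm x > 0" using assms padic_norm_nonneg[of x] padic_norm_eq_0_iff[of x] by linarith
  then obtain q where q: "padic_norm (x - of_rat q) < padic_norm x" using of_rat_dense_padic by blast
  then have e: "padic_abs CARD('p) q = padic_norm x"
    using padic_norm_eq_of_near padic_norm_of_rat by metis
  then have "q \<noteq> 0" using assms by auto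
  then show ?thesis using e that by (metis (no_types, lifting) padic_abs_def case_prod_beta)
qed

lemma padic_norm_less_iff:
  fixes x :: "'p::prime_card padic"
  shows "padic_norm x < real CARD('p) powi k \<longleftrightarrow> padic_norm x \<le> real CARD('p) powi (k - 1)"
proof (cases "x = 0")
  case False
  then obtain l where "padic_norm x = real CARD('p) powi l" by (rule padic_norm_value)
  then show ?thesis by auto
qed (auto simp: less_imp_le)

lemma padic_norm_of_int_le_1: "padic_norm (of_int n :: 'p::prime_card padic) \<le> 1"
proof (induction n)
  case (nonneg n)
  then show ?case by (induction n) (auto intro: padic_norm_add_le)
next
  case (neg n)
  have "padic_norm (of_nat m :: 'p padic) \<le> 1" for m
    by (induction m) (auto intro: padic_norm_add_le)
  then show ?case by (simp del: of_nat_Suc)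
qed

lemma padic_norm_of_nat_le_1: "padic_norm (of_nat n :: 'p::prime_card padic) \<le> 1"
  using padic_norm_of_int_le_1[of "int n"] by simp

lemma padic_norm_of_int_le_iff:
  "padic_norm (of_int n :: 'p::prime_card padic) \<le> real CARD('p) powi (- int m) \<longleftrightarrow> int CARD('p) ^ m dvd n"
proof (cases "n = 0")
  case False
  have "\<not> is_unit (int CARD('p))" using CARD_prime_gt_1[where 'p = 'p] by auto
  then have "int CARD('p) ^ m dvd n \<longleftrightarrow> m \<le> multiplicity (int CARD('p)) n"
    using False by (intro power_dvd_iff_le_multiplicity) auto
  moreover have "padic_norm (of_int n :: 'p padic) = real CARD('p) powi (- int (multiplicity (int CARD('p)) n))"
    using padic_norm_of_int[of n, where 'p = 'p] padic_abs_Fract[OF prime_card[where 'a = 'p], of n 1] False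
    by (simp add: of_int_rat[symmetric])
  ultimately show ?thesis by simp
qed auto

lemma of_nat_padic_close_iff:
  "padic_norm (of_nat m - of_nat n :: 'p::prime_card padic) \<le> real CARD('p) powi (-1) \<longleftrightarrow> m mod CARD('p) = n mod CARD('p)"
  using padic_norm_of_int_le_iff[of "int m - int n" 1, where 'p = 'p]
  by (simp add: mod_eq_dvd_iff[symmetric] zmod_int[symmetric] del: of_nat_mod)

text \<open>
  A close rational \<open>a/b\<close> has denominator prime to \<open>p\<close>, so the required residue is \<open>a b\<^sup>-\<^sup>1\<close> modulo \<open>p\<close>.
\<close>

lemma padic_digit_exists:
  fixes x :: "'p::prime_card padic"
  assumes "padic_norm x \<le> 1"
  shows "\<exists>n<CARD('p). padic_norm (x - of_nat n) \<le> real CARD('p) powi (-1)"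
proof -
  let ?p = "int CARD('p)"
  obtain q where q: "padic_norm (x - of_rat q) < real CARD('p) powi (-1)"
    using of_rat_dense_padic[of "real CARD('p) powi (-1)" x] by auto
  have "padic_norm (of_rat q :: 'p padic) \<le> 1"
  proof -
    have "real CARD('p) powi (-1) \<le> real CARD('p) powi 0" by (subst CARD_powi_le_iff) simp
    then show ?thesis using padic_norm_diff_le[of x 1 "x - of_rat q"] q assms by simp
  qed
  then have q1: "padic_abs CARD('p) q \<le> 1" by (simp add: padic_norm_of_rat)
  obtain a b where ab: "quotient_of q = (a, b)" by force
  have b: "b > 0" "coprime a b" "q = of_int a / of_int b"
    using quotient_of_denom_pos[OF ab] quotient_of_coprime[OF ab] quotient_of_div[OF ab] by auto
  have pp: "prime ?p" using prime_card[where 'a = 'p] by simp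
  have nd: "\<not> ?p dvd b"
  proof
    assume d: "?p dvd b"
    then have "\<not> ?p dvd a" using b(2) pp by (meson coprime_common_divisor not_prime_unit)
    then have ma: "multiplicity ?p a = 0" by (simp add: not_dvd_imp_multiplicity_0)
    have mb: "multiplicity ?p b \<ge> 1" using d b pp
      by (metis Suc_leI One_nat_def multiplicity_gt_zero_iff less_irrefl not_prime_unit)
    have "q \<noteq> 0" using \<open>\<not> ?p dvd a\<close> b by auto
    then have "padic_abs CARD('p) q = real CARD('p) powi (int (multiplicity ?p b))"
      using ma by (simp add: padic_abs_def ab)
    moreover have "real CARD('p) powi (int (multiplicity ?p b)) > real CARD('p) powi 0"
      by (subst CARD_powi_less_iff) (use mb in simp)
    ultimately show False using q1 by simp
  qed
  then have "gcd b ?p = 1" using pp by (metis coprime_commute prime_imp_coprime coprime_iff_gcd_eq_1)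
  then obtain c v where c: "c * b + v * ?p = 1" using bezout_int[of b ?p] by auto
  \<comment> \<open>\<open>c\<close> is an inverse of \<open>b\<close> modulo \<open>p\<close>\<close>
  define n where "n = nat ((a * c) mod ?p)"
  have p0: "?p > 0" by simp
  have n: "int n = (a * c) mod ?p" "n < CARD('p)"
    using pos_mod_bound[OF p0, of "a * c"] pos_mod_sign[OF p0, of "a * c"] unfolding n_def
    by (auto simp: nat_less_iff)
  have "a * c = ?p * ((a * c) div ?p) + int n" using n(1) by simp
  then have "a - int n * b = a * (c * b + v * ?p) - (a * c - ?p * ((a * c) div ?p)) * b" using c by simp
  also have "\<dots> = ?p * (a * v + ((a * c) div ?p) * b)" by (simp add: algebra_simps)
  finally have "?p dvd a - int n * b" by simp
  then have "padic_norm (of_int (a - int n * b) :: 'p padic) \<le> real CARD('p) powi (-1)"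
    using padic_norm_of_int_le_iff[of "a - int n * b" 1, where 'p = 'p] by simp
  moreover have "of_int (a - int n * b) = (of_rat q - of_nat n :: 'p padic) * of_int b"
  proof -
    have "q * of_int b = of_int a" using b(1,3) by simp
    then have "of_rat (q * of_int b) = (of_rat (of_int a) :: 'p padic)" by (rule arg_cong)
    then show ?thesis by (simp add: of_rat_mult left_diff_distrib)
  qed
  moreover have "padic_norm (of_int b :: 'p padic) = 1"
  proof -
    have "\<not> padic_norm (of_int b :: 'p padic) < real CARD('p) powi 0"
      unfolding padic_norm_less_iff using nd padic_norm_of_int_le_iff[of b 1, where 'p = 'p] by simp
    then show ?thesis using padic_norm_of_int_le_1[of b, where 'p = 'p] by simp
  qed
  ultimately have "padic_norm (of_rat q - of_nat n :: 'p padic) \<le> real CARD('p) powi (-1)"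
    by (simp add: padic_norm_mult)
  then have "padic_norm ((x - of_rat q) + (of_rat q - of_nat n)) \<le> real CARD('p) powi (-1)"
    using q by (intro padic_norm_add_le) auto
  then show ?thesis using n by auto
qed

definition padic_digit :: "'p::prime_card padic \<Rightarrow> nat" where
  "padic_digit x = (SOME n. n < CARD('p) \<and> padic_norm (x - of_nat n) \<le> real CARD('p) powi (-1))"

lemma padic_digit:
  fixes x :: "'p::prime_card padic"
  assumes "padic_norm x \<le> 1"
  shows "padic_digit x < CARD('p)" "padic_norm (x - of_nat (padic_digit x)) \<le> real CARD('p) powi (-1)"
  using someI_ex[OF padic_digit_exists[OF assms]] by (simp_all add: padic_digit_def)

lemma padic_digit_eqI:
  fixes x :: "'p::prime_card padic"
  assumes "padic_norm (x - of_nat n) \<le> real CARD('p) powi (-1)" "n < CARD('p)"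
  shows "padic_digit x = n" "padic_norm x \<le> 1"
proof -
  have "real CARD('p) powi (-1) \<le> real CARD('p) powi 0" by (subst CARD_powi_le_iff) simp
  then show 1: "padic_norm x \<le> 1"
    using padic_norm_add_le[of "x - of_nat n" 1 "of_nat n"] assms padic_norm_of_nat_le_1[of n, where 'p = 'p] by simp
  have "padic_norm ((x - of_nat n) - (x - of_nat (padic_digit x))) \<le> real CARD('p) powi (-1)"
    by (intro padic_norm_diff_le assms padic_digit[OF 1])
  then have "padic_norm (of_nat (padic_digit x) - of_nat n :: 'p padic) \<le> real CARD('p) powi (-1)"
    by simp
  then have "padic_digit x mod CARD('p) = n mod CARD('p)"
    by (simp only: of_nat_padic_close_iff)
  then show "padic_digit x = n" using assms padic_digit[OF 1] by simp
qed

lemma padic_digit_eq_iff: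
  fixes x y :: "'p::prime_card padic"
  assumes "padic_norm x \<le> 1" "padic_norm y \<le> 1"
  shows "padic_digit x = padic_digit y \<longleftrightarrow> padic_norm (x - y) \<le> real CARD('p) powi (-1)"
proof
  assume "padic_digit x = padic_digit y"
  then show "padic_norm (x - y) \<le> real CARD('p) powi (-1)"
    using padic_norm_diff_le[OF padic_digit(2)[OF assms(1)] padic_digit(2)[OF assms(2)]] by simp
next
  assume "padic_norm (x - y) \<le> real CARD('p) powi (-1)"
  then have "padic_norm ((x - y) + (y - of_nat (padic_digit y))) \<le> real CARD('p) powi (-1)"
    using padic_digit[OF assms(2)] by (intro padic_norm_add_le) auto
  then show "padic_digit x = padic_digit y"
    using padic_digit[OF assms(2)] by (intro padic_digit_eqI) auto
qed


section \<open>The character and the wavelet\<close>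

text \<open>
  This is why the character is well defined: two finite sums of digits below the radix point that
  approximate the same \<open>p\<close>-adic number up to \<open>\<int>\<^sub>p\<close> differ by an integer.
\<close>

lemma rat_Int_of_padic_integral:
  fixes r :: rat
  assumes "padic_abs CARD('p::prime_card) r \<le> 1" "r * of_nat CARD('p) ^ M \<in> \<int>"
  shows "r \<in> \<int>"
proof -
  obtain z where z: "r * of_nat CARD('p) ^ M = of_int z" using assms(2) by (elim Ints_cases)
  have "padic_norm (of_int z :: 'p padic) = padic_norm (of_rat (r * of_nat CARD('p) ^ M) :: 'p padic)"
    by (simp only: z of_rat_of_int_eq)
  also have "\<dots> = padic_norm (of_rat r :: 'p padic) * padic_norm (of_nat CARD('p) powi int M :: 'p padic)"
    by (simp add: of_rat_mult of_rat_power padic_norm_mult)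
  also have "\<dots> \<le> real CARD('p) powi (- int M)"
    using assms(1) by (simp only: padic_norm_of_rat padic_norm_CARD_powi) (simp add: mult_left_le_one_le)
  finally have "int CARD('p) ^ M dvd z" by (simp only: padic_norm_of_int_le_iff)
  then obtain w where w: "z = int CARD('p) ^ M * w" by (elim dvdE)
  have "r * of_nat CARD('p) ^ M = of_int w * of_nat CARD('p) ^ M" by (simp add: z w)
  then have "r = of_int w" by simp
  then show ?thesis by simp
qed

text \<open>
  Digits at nonnegative positions contribute an element of \<open>\<int>\<^sub>p\<close>, and \<open>\<int>\<^sub>p\<close> is closed under
  limits.
\<close>

lemma padic_expansion_head:
  fixes y :: "'p::prime_card padic"
  assumes "padic_expansion y \<gamma> d"
  shows "padic_norm (y - (\<Sum>j\<in>{\<gamma>..-1}. of_nat (d j) * of_nat CARD('p) powi j)) \<le> 1"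
proof -
  define t :: "int \<Rightarrow> 'p padic" where "t j = of_nat (d j) * of_nat CARD('p) powi j" for j
  have "(\<lambda>n. \<Sum>i<n. t (\<gamma> + int i)) \<longlonglongrightarrow> y"
    using assms by (simp add: padic_expansion_def sums_def t_def)
  then have "\<forall>\<^sub>F n in sequentially. dist (\<Sum>i<n. t (\<gamma> + int i)) y < 1" by (rule tendstoD) simp
  moreover have "\<forall>\<^sub>F n in sequentially. n \<ge> nat (- \<gamma>)" by (rule eventually_ge_at_top)
  ultimately have "\<forall>\<^sub>F n in sequentially. dist (\<Sum>i<n. t (\<gamma> + int i)) y < 1 \<and> n \<ge> nat (- \<gamma>)"
    by eventually_elim simp
  then obtain n where n: "dist (\<Sum>i<n. t (\<gamma> + int i)) y < 1" "n \<ge> nat (- \<gamma>)"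
    by (auto simp: eventually_sequentially)
  have "(\<Sum>i<n. t (\<gamma> + int i)) = (\<Sum>j\<in>{\<gamma>..<\<gamma> + int n}. t j)"
    by (rule sum.reindex_bij_witness[of _ "\<lambda>j. nat (j - \<gamma>)" "\<lambda>i. \<gamma> + int i"]) auto
  also have "{\<gamma>..<\<gamma> + int n} = {\<gamma>..-1} \<union> {max 0 \<gamma>..<\<gamma> + int n}" using n(2) by auto
  also have "sum t \<dots> = sum t {\<gamma>..-1} + sum t {max 0 \<gamma>..<\<gamma> + int n}"
    by (rule sum.union_disjoint) auto
  finally have s: "y - sum t {\<gamma>..-1} = sum t {max 0 \<gamma>..<\<gamma> + int n} - ((\<Sum>i<n. t (\<gamma> + int i)) - y)"
    by simp
  have t1: "padic_norm (t j) \<le> 1" if "j \<ge> 0" for j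
  proof -
    have "real CARD('p) powi (-j) \<le> real CARD('p) powi 0" using that by (subst CARD_powi_le_iff) simp
    then have "padic_norm (of_nat (d j) :: 'p padic) * padic_norm (of_nat CARD('p) powi j :: 'p padic) \<le> 1 * 1"
      by (intro mult_mono padic_norm_of_nat_le_1) auto
    then show ?thesis by (simp add: t_def padic_norm_mult)
  qed
  have "padic_norm (sum t {max 0 \<gamma>..<\<gamma> + int n}) \<le> 1"
    by (rule padic_norm_sum_le) (auto intro: t1)
  moreover have "padic_norm ((\<Sum>i<n. t (\<gamma> + int i)) - y) \<le> 1"
    using n(1) by (simp add: dist_padic_def)
  ultimately have "padic_norm (y - sum t {\<gamma>..-1}) \<le> 1" unfolding s by (rule padic_norm_diff_le)
  then show ?thesis by (simp add: t_def)
qed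

text \<open>
  Repeatedly subtracting the zeroth digit and dividing by \<open>p\<close> produces the digits; convergence
  holds because the remainder after \<open>n\<close> steps is \<open>p\<^sup>n\<close> times an element of \<open>\<int>\<^sub>p\<close>. The expansion is stated
  for \<open>p\<^sup>-\<^sup>1x\<close>, the argument of the character in the wavelet.
\<close>

lemma padic_expansion_exists:
  fixes x :: "'p::prime_card padic"
  assumes "padic_norm x \<le> 1"
  shows "\<exists>d. padic_expansion (inverse (of_nat CARD('p)) * x) (-1) d"
proof -
  define P :: "'p padic" where "P = of_nat CARD('p)"
  define t where "t z = (z - of_nat (padic_digit z)) / P" for z :: "'p padic"
  define X where "X n = (t ^^ n) x" for n
  define d where "d j = padic_digit (X (nat (j + 1)))" for j :: int
  have P: "P \<noteq> 0" by (simp add: P_def)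
  have nP: "padic_norm P = real CARD('p) powi (-1)"
    using padic_norm_CARD[where 'p = 'p] by (simp add: P_def)
  have X1: "padic_norm (X n) \<le> 1" for n
  proof (induction n)
    case (Suc n)
    have "padic_norm (X (Suc n)) * padic_norm P = padic_norm (X n - of_nat (padic_digit (X n)))"
      using P by (simp add: X_def t_def padic_norm_mult[symmetric])
    also have "\<dots> \<le> 1 * padic_norm P" using padic_digit(2)[OF Suc] nP by simp
    finally show ?case
      by (simp add: nP)
  qed (use assms in \<open>simp add: X_def\<close>)
  have dl: "d j < CARD('p)" for j using padic_digit(1)[OF X1] by (simp add: d_def)
  have eq: "inverse P * x - (\<Sum>i<n. of_nat (d (- 1 + int i)) * P powi (- 1 + int i)) = P powi (int n - 1) * X n" for n
  proof (induction n)
    case (Suc n)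
    have "X n = P * X (Suc n) + of_nat (d (- 1 + int n))"
      using P by (simp add: X_def t_def d_def)
    then have "inverse P * x - (\<Sum>i<Suc n. of_nat (d (- 1 + int i)) * P powi (- 1 + int i))
      = P powi (int n - 1) * (P * X (Suc n))"
      using Suc by (simp add: algebra_simps)
    also have "\<dots> = P powi (int (Suc n) - 1) * X (Suc n)"
    proof -
      have "P powi (int (Suc n) - 1) = P powi (int n - 1) * P"
        using P power_int_add_1[of P "int n - 1"] by simp
      then show ?thesis by (simp only: mult.assoc)
    qed
    finally show ?case .
  qed (simp add: X_def power_int_minus)
  have lim: "(\<lambda>n. real CARD('p) powi (1 - int n)) \<longlonglongrightarrow> 0"
  proof -
    have "(\<lambda>n. real CARD('p) * inverse (real CARD('p)) ^ n) \<longlonglongrightarrow> real CARD('p) * 0"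
      using real_CARD_gt_1[where 'p = 'p] by (intro tendsto_intros LIMSEQ_power_zero) (auto simp: inverse_less_1_iff)
    then show ?thesis by (simp add: power_int_diff power_inverse divide_inverse)
  qed
  have "(\<lambda>n. of_nat (d (- 1 + int n)) * P powi (- 1 + int n)) sums (inverse P * x)"
    unfolding sums_def
  proof (subst tendsto_dist_iff, rule Lim_null_comparison[OF _ lim], intro always_eventually allI)
    fix n
    have "dist (inverse P * x) (\<Sum>i<n. of_nat (d (- 1 + int i)) * P powi (- 1 + int i))
      = padic_norm (P powi (int n - 1)) * padic_norm (X n)"
      by (simp only: dist_padic_def eq padic_norm_mult)
    also have "\<dots> \<le> real CARD('p) powi (1 - int n) * 1"
      using X1[of n] mult_mono[OF order_refl] by (simp add: P_def)
    finally show "norm (dist (\<Sum>i<n. of_nat (d (- 1 + int i)) * P powi (- 1 + int i)) (inverse P * x))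
         \<le> real CARD('p) powi (1 - int n)" by (simp add: dist_commute)
  qed
  then show ?thesis using dl by (auto simp: padic_expansion_def P_def)
qed

definition root_unity :: "nat \<Rightarrow> nat \<Rightarrow> complex" where
  "root_unity N m = exp (2 * of_real pi * \<i> * of_nat m / of_nat N)"

text \<open>
  Both \<open>n/p\<close> and the part of any expansion below the radix point approximate \<open>p\<^sup>-\<^sup>1x\<close> up to \<open>\<int>\<^sub>p\<close>, so
  they differ by an integer and give the same exponential.
\<close>

lemma padic_wavelet_eq:
  fixes x :: "'p::prime_card padic"
  assumes x: "padic_norm (x - of_nat n) \<le> real CARD('p) powi (-1)"
  shows "padic_wavelet x = root_unity CARD('p) n"
proof -
  define y where "y = inverse (of_nat CARD('p)) * x"
  have xn: "padic_norm x \<le> 1"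
  proof -
    have "real CARD('p) powi (-1) \<le> real CARD('p) powi 0" by (subst CARD_powi_le_iff) simp
    then show ?thesis
      using padic_norm_add_le[of "x - of_nat n" 1 "of_nat n"] x padic_norm_of_nat_le_1[of n, where 'p = 'p] by simp
  qed
  have yn: "padic_norm (y - of_rat (of_nat n / of_nat CARD('p))) \<le> 1"
  proof -
    have "y - of_rat (of_nat n / of_nat CARD('p)) = inverse (of_nat CARD('p)) * (x - of_nat n)"
      by (simp add: y_def of_rat_divide field_simps)
    then have "padic_norm (y - of_rat (of_nat n / of_nat CARD('p))) = real CARD('p) * padic_norm (x - of_nat n)"
      by (simp add: padic_norm_mult padic_norm_inverse padic_norm_CARD)
    also have "\<dots> \<le> real CARD('p) * real CARD('p) powi (-1)" using x by (intro mult_left_mono) auto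
    finally show ?thesis by (simp add: power_int_minus)
  qed
  have val: "exp (2 * of_real pi * \<i> * (\<Sum>j\<in>{\<gamma>..-1}. of_nat (d j) * of_nat CARD('p) powi j)) = root_unity CARD('p) n"
    if "padic_expansion y \<gamma> d" for \<gamma> d
  proof -
    define h :: rat where "h = (\<Sum>j\<in>{\<gamma>..-1}. of_nat (d j) * of_nat CARD('p) powi j)"
    define r where "r = h - of_nat n / of_nat CARD('p)"
    have powi_of_rat: "of_rat (of_nat CARD('p) powi j) = (of_nat CARD('p) powi j :: 'a :: field_char_0)" for j
      by (simp add: power_int_def of_rat_power of_rat_inverse)
    have hof: "of_rat h = (\<Sum>j\<in>{\<gamma>..-1}. of_nat (d j) * of_nat CARD('p) powi j :: 'a :: field_char_0)"
      by (simp add: h_def of_rat_sum of_rat_mult powi_of_rat)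
    have "padic_norm ((y - of_rat (of_nat n / of_nat CARD('p))) - (y - of_rat h)) \<le> 1"
      using padic_expansion_head[OF that] by (intro padic_norm_diff_le[OF yn]) (simp add: hof)
    then have "padic_norm (of_rat r :: 'p padic) \<le> 1" by (simp add: r_def of_rat_diff)
    then have r1: "padic_abs CARD('p) r \<le> 1" by (simp add: padic_norm_of_rat)
    \<comment> \<open>the exponent clears both the denominators \<open>p\<^sup>-\<^sup>j\<close> of the head and the denominator \<open>p\<close> of \<open>n/p\<close>\<close>
    have "r * of_nat CARD('p) ^ nat (max 1 (- \<gamma>)) \<in> \<int>"
    proof -
      define M where "M = nat (max 1 (- \<gamma>))"
      have "of_nat (d j) * of_nat CARD('p) powi j * of_nat CARD('p) ^ M \<in> (\<int> :: rat set)" if "j \<ge> \<gamma>" for j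
      proof -
        have e: "(of_nat CARD('p) powi j * of_nat CARD('p) ^ M :: rat) = of_nat CARD('p) ^ nat (j + int M)"
          using that power_int_add[of "of_nat CARD('p) :: rat" j "int M"] unfolding M_def
          by (subst power_int_of_nat[symmetric]) (auto simp: power_int_def)
        show ?thesis unfolding mult.assoc e by auto
      qed
      then have "h * of_nat CARD('p) ^ M \<in> \<int>" by (auto simp: h_def sum_distrib_right intro!: Ints_sum)
      moreover have "of_nat n / of_nat CARD('p) * of_nat CARD('p) ^ M \<in> (\<int> :: rat set)"
      proof -
        obtain K where "M = Suc K" by (cases M) (auto simp: M_def)
        then have "of_nat n / of_nat CARD('p) * of_nat CARD('p) ^ M = (of_nat (n * CARD('p) ^ K) :: rat)" by simp
        then show ?thesis by simp
      qed
      ultimately show ?thesis unfolding r_def M_def[symmetric] left_diff_distrib by (intro Ints_diff)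
    qed
    then have "r \<in> \<int>" by (rule rat_Int_of_padic_integral[OF r1])
    then obtain z where z: "r = of_int z" by (elim Ints_cases)
    have "h = of_nat n / of_nat CARD('p) + of_int z" using z by (simp add: r_def)
    then have "of_rat h = (of_nat n / of_nat CARD('p) + of_int z :: complex)" by (simp add: of_rat_add of_rat_divide)
    then have "exp (2 * of_real pi * \<i> * of_rat h) = root_unity CARD('p) n * exp (2 * of_real pi * \<i> * of_int z)"
      unfolding root_unity_def exp_add[symmetric] by (simp add: distrib_left)
    also have "exp (2 * of_real pi * \<i> * of_int z) = (1 :: complex)"
      using exp_integer_2pi[of "of_int z"] by (simp add: mult_ac)
    finally show ?thesis by (simp add: hof)
  qed
  have "padic_char y = root_unity CARD('p) n" unfolding padic_char_def
  proof (rule the_equality)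
    obtain d where "padic_expansion y (-1) d" using padic_expansion_exists[OF xn] unfolding y_def by blast
    then show "\<exists>\<gamma> d. padic_expansion y \<gamma> d \<and>
        root_unity CARD('p) n = exp (2 * of_real pi * \<i> * (\<Sum>j\<in>{\<gamma>..-1}. of_nat (d j) * of_nat CARD('p) powi j))"
      using val by metis
  next
    fix z assume "\<exists>\<gamma> d. padic_expansion y \<gamma> d \<and>
        z = exp (2 * of_real pi * \<i> * (\<Sum>j\<in>{\<gamma>..-1}. of_nat (d j) * of_nat CARD('p) powi j))"
    then show "z = root_unity CARD('p) n" using val by metis
  qed
  then show ?thesis using xn by (simp add: padic_wavelet_def y_def padic_integers_def)
qed

lemma padic_wavelet_outside: "padic_norm x > 1 \<Longrightarrow> padic_wavelet x = 0"
  by (simp add: padic_wavelet_def padic_integers_def)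


section \<open>Balls and their maximal subballs\<close>

text \<open>
  The exponent is an explicit argument because it is determined by the ball
  (\<open>padic_cball_eq_iff\<close>), whereas every point of the ball may serve as centre.
\<close>

definition padic_cball :: "'p::prime_card padic \<Rightarrow> int \<Rightarrow> 'p padic set" where
  "padic_cball a k = {x. padic_norm (x - a) \<le> real CARD('p) powi k}"

lemma padic_ball_iff: "padic_ball B \<longleftrightarrow> (\<exists>a k. B = padic_cball a k)"
  by (simp add: padic_ball_def padic_cball_def)

lemma padic_ball_cball [simp]: "padic_ball (padic_cball a k)"
  by (auto simp: padic_ball_iff)

lemma mem_padic_cball:
  "x \<in> padic_cball a k \<longleftrightarrow> padic_norm (x - a :: 'p::prime_card padic) \<le> real CARD('p) powi k"
  by (simp add: padic_cball_def)

lemma center_in_padic_cball [simp]: "a \<in> padic_cball a k"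
  by (simp add: mem_padic_cball less_imp_le)

lemma padic_cball_nonempty [simp]: "padic_cball a k \<noteq> {}" "{} \<noteq> padic_cball a k"
  using center_in_padic_cball by blast+

lemma padic_cball_sym: "x \<in> padic_cball a k \<longleftrightarrow> a \<in> padic_cball x k"
  by (simp only: mem_padic_cball padic_norm_minus_commute[of x a])

lemma padic_cball_trans: "x \<in> padic_cball y k \<Longrightarrow> y \<in> padic_cball z k \<Longrightarrow> x \<in> padic_cball z k"
  using padic_norm_add_le[of "x - y" _ "y - z"] by (simp add: mem_padic_cball)

lemma padic_cball_eq_of_mem: "b \<in> padic_cball a k \<Longrightarrow> padic_cball b k = padic_cball a k"
  using padic_cball_sym padic_cball_trans by blast

lemma padic_cball_mono: "k \<le> l \<Longrightarrow> padic_cball a k \<subseteq> padic_cball (a :: 'p::prime_card padic) l"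
  by (auto simp: mem_padic_cball intro: order_trans[OF _ CARD_powi_le_iff[THEN iffD2]])

text \<open>
  The point at distance exactly \<open>p\<^sup>k\<close> from the centre detects the exponent of a ball.
\<close>

lemma boundary_in_padic_cball:
  "a + of_nat CARD('p) powi (- k) \<in> padic_cball (a :: 'p::prime_card padic) l \<longleftrightarrow> k \<le> l"
  by (simp add: mem_padic_cball)

lemma padic_cball_subset_iff:
  "padic_cball a k \<subseteq> padic_cball (b :: 'p::prime_card padic) l \<longleftrightarrow> k \<le> l \<and> a \<in> padic_cball b l"
proof
  assume s: "padic_cball a k \<subseteq> padic_cball b l"
  then have a: "a \<in> padic_cball b l" by auto
  have "a + of_nat CARD('p) powi (- k) \<in> padic_cball a k" by (simp add: boundary_in_padic_cball)
  then have "a + of_nat CARD('p) powi (- k) \<in> padic_cball a l"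
    using s padic_cball_eq_of_mem[OF a] by auto
  then show "k \<le> l \<and> a \<in> padic_cball b l" using a by (simp add: boundary_in_padic_cball)
next
  assume "k \<le> l \<and> a \<in> padic_cball b l"
  then show "padic_cball a k \<subseteq> padic_cball b l"
    using padic_cball_mono[of k l a] padic_cball_eq_of_mem[of a b l] by auto
qed

lemma padic_cball_eq_iff:
  "padic_cball a k = padic_cball (b :: 'p::prime_card padic) l \<longleftrightarrow> k = l \<and> a \<in> padic_cball b l"
  using padic_cball_subset_iff[of a k b l] padic_cball_subset_iff[of b l a k] padic_cball_eq_of_mem[of a b l]
  by (metis order_antisym order_refl)

lemma padic_cball_disjoint:
  "padic_cball a k \<noteq> padic_cball b k \<Longrightarrow> padic_cball a k \<inter> padic_cball b k = {}"
  using padic_cball_eq_of_mem by blast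

lemma eventually_in_padic_cball: "\<exists>n. \<forall>i\<ge>n. x \<in> padic_cball (0 :: 'p::prime_card padic) (int i)"
proof (cases "x = 0")
  case False
  then obtain k where k: "padic_norm x = real CARD('p) powi k" by (rule padic_norm_value)
  have "x \<in> padic_cball 0 k" by (simp add: mem_padic_cball k)
  then have "x \<in> padic_cball 0 (int i)" if "nat k \<le> i" for i
    by (rule subsetD[OF padic_cball_mono, rotated]) (use that in simp)
  then show ?thesis by blast
qed auto

text \<open>
  Adding \<open>j p\<^sup>-\<^sup>k\<close> to \<open>a\<close> with \<open>0 \<le> j < p\<close> runs through centres of the maximal subballs of
  \<open>padic_cball a k\<close>, and \<open>rel_digit a k x\<close> is the index of the one that contains \<open>x\<close>.
\<close>

definition subball :: "'p::prime_card padic \<Rightarrow> int \<Rightarrow> nat \<Rightarrow> 'p padic set" where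
  "subball a k j = padic_cball (a + of_nat j * of_nat CARD('p) powi (- k)) (k - 1)"

definition rel_digit :: "'p::prime_card padic \<Rightarrow> int \<Rightarrow> 'p padic \<Rightarrow> nat" where
  "rel_digit a k x = padic_digit (of_nat CARD('p) powi k * (x - a))"

lemma padic_norm_rescale:
  "padic_norm (of_nat CARD('p) powi k * z :: 'p::prime_card padic) \<le> real CARD('p) powi l
     \<longleftrightarrow> padic_norm z \<le> real CARD('p) powi (k + l)"
proof -
  have "real CARD('p) powi (k + l) = real CARD('p) powi k * real CARD('p) powi l"
    by (simp add: power_int_add)
  then show ?thesis
    by (simp add: padic_norm_mult power_int_minus field_simps)
qed

lemma mem_padic_cball_rescale:
  "x \<in> padic_cball a k \<longleftrightarrow> padic_norm (of_nat CARD('p) powi k * (x - a) :: 'p::prime_card padic) \<le> 1"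
  using padic_norm_rescale[of k "x - a" 0] by (simp add: mem_padic_cball)

lemma mem_subball:
  fixes a :: "'p::prime_card padic"
  assumes "j < CARD('p)"
  shows "x \<in> subball a k j \<longleftrightarrow> x \<in> padic_cball a k \<and> rel_digit a k x = j"
proof -
  define z where "z = of_nat CARD('p) powi k * (x - a)"
  have "of_nat CARD('p) powi k * (x - (a + of_nat j * of_nat CARD('p) powi (- k))) = z - of_nat j"
    by (simp add: z_def power_int_minus field_simps)
  then have "x \<in> subball a k j \<longleftrightarrow> padic_norm (z - of_nat j) \<le> real CARD('p) powi (-1)"
    using padic_norm_rescale[of k "x - (a + of_nat j * of_nat CARD('p) powi (- k))" "-1"]
    by (simp add: subball_def mem_padic_cball)
  also have "\<dots> \<longleftrightarrow> padic_norm z \<le> 1 \<and> padic_digit z = j"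
    using padic_digit_eqI[OF _ assms, of z] padic_digit(2)[of z] by blast
  finally show ?thesis by (simp add: mem_padic_cball_rescale z_def rel_digit_def)
qed

lemma rel_digit_less: "x \<in> padic_cball a k \<Longrightarrow> rel_digit a k x < CARD('p)"
  for a :: "'p::prime_card padic"
  unfolding rel_digit_def mem_padic_cball_rescale by (rule padic_digit(1))

lemma UN_subball: "(\<Union>j<CARD('p). subball a k j) = padic_cball (a :: 'p::prime_card padic) k"
proof (intro set_eqI iffI)
  fix x assume "x \<in> padic_cball a k"
  then show "x \<in> (\<Union>j<CARD('p). subball a k j)"
    using mem_subball[OF rel_digit_less, of x a k x] rel_digit_less[of x a k] by auto
qed (auto simp: mem_subball)

lemma center_in_subball: "a + of_nat j * of_nat CARD('p) powi (- k) \<in> subball (a :: 'p::prime_card padic) k j"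
  by (simp add: subball_def)

lemma subball_disjoint:
  "i < CARD('p) \<Longrightarrow> j < CARD('p) \<Longrightarrow> i \<noteq> j \<Longrightarrow> subball a k i \<inter> subball (a :: 'p::prime_card padic) k j = {}"
  by (auto simp: mem_subball)

lemma inj_on_subball: "inj_on (subball (a :: 'p::prime_card padic) k) {..<CARD('p)}"
proof (rule inj_onI)
  fix i j assume ij: "i \<in> {..<CARD('p)}" "j \<in> {..<CARD('p)}" "subball a k i = subball a k j"
  then show "i = j" using subball_disjoint[of i j a k] center_in_subball[of a i k] by auto
qed

lemma maximal_subballs_cball:
  fixes a :: "'p::prime_card padic"
  shows "maximal_subballs (padic_cball a k) = subball a k ` {..<CARD('p)}"
proof -
  have psub: "padic_cball c l \<subset> padic_cball a k \<longleftrightarrow> l \<le> k - 1 \<and> c \<in> padic_cball a k" for c l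
    using padic_cball_eq_iff[of c l a k] padic_cball_subset_iff[of c l a k] by (auto simp: psubset_eq)
  have "C \<in> maximal_subballs (padic_cball a k) \<longleftrightarrow> (\<exists>c\<in>padic_cball a k. C = padic_cball c (k - 1))" for C
  proof
    assume C: "C \<in> maximal_subballs (padic_cball a k)"
    then obtain c l where c: "C = padic_cball c l" by (auto simp: maximal_subballs_def padic_ball_iff)
    with C have "l \<le> k - 1" "c \<in> padic_cball a k" by (auto simp: maximal_subballs_def psub)
    moreover from this have "padic_cball c (k - 1) = C"
      using C psub[of c "k - 1"] padic_cball_mono[of l "k - 1" c] c by (auto simp: maximal_subballs_def)
    ultimately show "\<exists>c\<in>padic_cball a k. C = padic_cball c (k - 1)" by blast
  next
    assume "\<exists>c\<in>padic_cball a k. C = padic_cball c (k - 1)"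
    then obtain c where c: "c \<in> padic_cball a k" "C = padic_cball c (k - 1)" by blast
    show "C \<in> maximal_subballs (padic_cball a k)"
      unfolding maximal_subballs_def
    proof (intro CollectI conjI allI impI)
      show "C \<subset> padic_cball a k" using c psub by simp
      fix D assume D: "padic_ball D \<and> D \<subset> padic_cball a k \<and> C \<subseteq> D"
      then obtain d l where d: "D = padic_cball d l" by (auto simp: padic_ball_iff)
      then have "l \<le> k - 1" using D psub by auto
      moreover have "k - 1 \<le> l" "c \<in> padic_cball d l"
        using D c d padic_cball_subset_iff[of c "k - 1" d l] by auto
      ultimately show "D = C" using padic_cball_eq_of_mem[of c d l] unfolding c(2) d
        by (metis order_antisym)
    qed (simp add: c)
  qed
  then have "maximal_subballs (padic_cball a k) = (\<lambda>c. padic_cball c (k - 1)) ` padic_cball a k" by auto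
  also have "\<dots> = subball a k ` {..<CARD('p)}"
  proof (intro set_eqI iffI)
    fix C assume "C \<in> (\<lambda>c. padic_cball c (k - 1)) ` padic_cball a k"
    then obtain c where c: "c \<in> padic_cball a k" "C = padic_cball c (k - 1)" by auto
    then obtain j where "c \<in> subball a k j" "j < CARD('p)" using UN_subball[of a k] by blast
    moreover from this have "C = subball a k j" unfolding c(2) subball_def by (intro padic_cball_eq_of_mem)
    ultimately show "C \<in> subball a k ` {..<CARD('p)}" by simp
  next
    fix C assume "C \<in> subball a k ` {..<CARD('p)}"
    then obtain j where j: "j < CARD('p)" "C = subball a k j" by auto
    then have "a + of_nat j * of_nat CARD('p) powi (- k) \<in> padic_cball a k"
      using center_in_subball[of a j k] UN_subball[of a k] by blast
    then show "C \<in> (\<lambda>c. padic_cball c (k - 1)) ` padic_cball a k" using j by (auto simp: subball_def)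
  qed
  finally show ?thesis .
qed

section \<open>Ball-morphisms and the orbit of the wavelet\<close>

text \<open>
  An explicit form of \<open>x \<mapsto> \<phi>(p\<^sup>k x)\<close> with \<open>\<phi>\<close> an isometry that avoids the choice of \<open>\<phi>\<close>.
\<close>

definition scales_distances :: "int \<Rightarrow> ('p::prime_card padic \<Rightarrow> 'p padic) \<Rightarrow> bool" where
  "scales_distances k G \<longleftrightarrow>
     bij G \<and> (\<forall>x y. padic_norm (G x - G y) = real CARD('p) powi (- k) * padic_norm (x - y))"

lemma scales_distancesD:
  assumes "scales_distances k (G :: 'p::prime_card padic \<Rightarrow> 'p padic)"
  shows "G y \<in> padic_cball (G x) l \<longleftrightarrow> y \<in> padic_cball x (l + k)"
proof -
  have "padic_norm (G y - G x) = padic_norm (of_nat CARD('p) powi k * (y - x))"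
    using assms by (simp add: scales_distances_def padic_norm_mult)
  then show ?thesis by (simp only: mem_padic_cball padic_norm_rescale add.commute)
qed

lemma scales_distances_ball_morphism:
  assumes "scales_distances k (G :: 'p::prime_card padic \<Rightarrow> 'p padic)"
  shows "ball_morphism G"
proof -
  have G: "bij G" using assms by (simp add: scales_distances_def)
  have "padic_ball (G ` B) \<and> padic_ball (G -` B)" if "padic_ball B" for B
  proof -
    obtain a l where B: "B = padic_cball a l" using \<open>padic_ball B\<close> by (auto simp: padic_ball_iff)
    obtain b where b: "G b = a" using G by (metis bij_pointE)
    have "G -` B = padic_cball b (l + k)"
      using scales_distancesD[OF assms, of _ b l] by (auto simp: B b)
    moreover have "G ` B = padic_cball (G a) (l - k)"
    proof (intro set_eqI iffI)
      fix z assume z: "z \<in> padic_cball (G a) (l - k)"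
      obtain y where "G y = z" using G by (metis bij_pointE)
      then show "z \<in> G ` B" using z scales_distancesD[OF assms, of y a "l - k"] by (auto simp: B)
    next
      fix z assume "z \<in> G ` B"
      then show "z \<in> padic_cball (G a) (l - k)"
        using scales_distancesD[OF assms, of _ a "l - k"] by (auto simp: B)
    qed
    ultimately show ?thesis by simp
  qed
  then show ?thesis using G by (simp add: ball_morphism_def)
qed

text \<open>
  Let \<open>l x k\<close> be the exponent of the image of \<open>padic_cball x k\<close>. No ball lies strictly between two
  nested balls of consecutive exponents, and by assumption this is preserved in both directions, so
  \<open>l x (k + 1) = l x k + 1\<close>. Two points share all sufficiently large balls, so \<open>l x k - k\<close> is the
  same integer for all \<open>x\<close>. Distances are recovered from the balls that contain them.
\<close>

lemma ball_morphism_scales_distances: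
  assumes "ball_morphism (G :: 'p::prime_card padic \<Rightarrow> 'p padic)"
  obtains k where "scales_distances k G"
proof -
  have G: "bij G" using assms by (simp add: ball_morphism_def)
  have "\<exists>m. G ` padic_cball x k = padic_cball (G x) m" for x k
  proof -
    have "padic_ball (G ` padic_cball x k)" using assms by (simp add: ball_morphism_def)
    then obtain b m where "G ` padic_cball x k = padic_cball b m" by (auto simp: padic_ball_iff)
    moreover from this have "G x \<in> padic_cball b m" by auto
    ultimately show ?thesis using padic_cball_eq_of_mem by blast
  qed
  then obtain l where l: "\<And>x k. G ` padic_cball x k = padic_cball (G x) (l x k)" by metis
  have step: "l x (k + 1) = l x k + 1" for x k
  proof -
    have "padic_cball x k \<subset> padic_cball x (k + 1)"
      using padic_cball_mono[of k "k + 1" x] padic_cball_eq_iff[of x k x "k + 1"] by auto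
    then have "padic_cball (G x) (l x k) \<subset> padic_cball (G x) (l x (k + 1))"
      unfolding l[symmetric] using G by (metis bij_is_inj image_strict_mono inj_on_subset subset_UNIV)
    then have less: "l x k < l x (k + 1)"
      using padic_cball_subset_iff[of "G x" "l x (k+1)" "G x" "l x k"] by (auto simp: not_less)
    moreover have "\<not> l x k + 1 < l x (k + 1)"
    proof
      assume gap: "l x k + 1 < l x (k + 1)"
      \<comment> \<open>the preimage would be a ball strictly between those of exponents \<open>k\<close> and \<open>k + 1\<close>\<close>
      have "padic_ball (G -` padic_cball (G x) (l x k + 1))" using assms by (simp add: ball_morphism_def)
      then obtain b m where "G -` padic_cball (G x) (l x k + 1) = padic_cball b m" by (auto simp: padic_ball_iff)
      moreover from this have "x \<in> padic_cball b m" by auto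
      ultimately have m: "G -` padic_cball (G x) (l x k + 1) = padic_cball x m" using padic_cball_eq_of_mem by blast
      then have "padic_cball (G x) (l x m) = padic_cball (G x) (l x k + 1)"
        unfolding l[symmetric] using G by (metis bij_is_surj surj_image_vimage_eq)
      then have lm: "l x m = l x k + 1" by (simp add: padic_cball_eq_iff)
      have mono: "l x i \<le> l x j" if "i \<le> j" for i j
      proof -
        have "padic_cball (G x) (l x i) \<subseteq> padic_cball (G x) (l x j)"
          unfolding l[symmetric] using that by (intro image_mono padic_cball_mono)
        then show ?thesis by (simp add: padic_cball_subset_iff)
      qed
      show False using mono[of m k] mono[of "k + 1" m] lm gap by linarith
    qed
    ultimately show ?thesis by linarith
  qed
  have lin: "l x k = l x 0 + k" for x k
  proof (induction k rule: int_induct[of _ 0])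
    case (step2 i)
    then show ?case using step[of x "i - 1"] by simp
  qed (use step in auto)
  have const: "l x 0 = l 0 0" for x
  proof -
    obtain K where "padic_norm (x - 0) \<le> real CARD('p) powi K"
    proof (cases "x = 0")
      case False
      then show ?thesis using that by (metis diff_zero order_refl padic_norm_value)
    qed (use that[of 0] in auto)
    then have "x \<in> padic_cball 0 K" by (simp add: mem_padic_cball)
    then have "padic_cball (G x) (l x K) = padic_cball (G 0) (l 0 K)"
      unfolding l[symmetric] by (simp add: padic_cball_eq_of_mem)
    then have "l x K = l 0 K" by (simp add: padic_cball_eq_iff)
    then show ?thesis using lin[of x K] lin[of 0 K] by simp
  qed
  define g where "g = - l 0 0"
  have mem: "G y \<in> padic_cball (G x) k \<longleftrightarrow> y \<in> padic_cball x (k + g)" for x y k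
  proof -
    have "padic_cball (G x) k = G ` padic_cball x (k + g)"
      unfolding l lin[of x "k + g"] const[of x] by (simp add: g_def)
    then show ?thesis using G by (auto simp: bij_is_inj inj_image_mem_iff)
  qed
  have "padic_norm (G x - G y) = real CARD('p) powi (- g) * padic_norm (x - y)" for x y
  proof (cases "x = y")
    case False
    then obtain i where i: "padic_norm (x - y) = real CARD('p) powi i" using padic_norm_value[of "x - y"] by auto
    have "G x - G y \<noteq> 0" using False G by (auto simp: bij_is_inj inj_eq)
    then obtain j where j: "padic_norm (G x - G y) = real CARD('p) powi j" using padic_norm_value by blast
    have "j \<le> m \<longleftrightarrow> i \<le> m + g" for m
      using mem[of x y m] unfolding mem_padic_cball i j by simp
    from this[of j] this[of "i - g"] have "j = i - g" by linarith
    then show ?thesis by (simp add: i j power_int_add[symmetric])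
  qed auto
  then show ?thesis using that G by (auto simp: scales_distances_def)
qed

lemma dilation_exponent_eq:
  assumes "scales_distances k (G :: 'p::prime_card padic \<Rightarrow> 'p padic)"
  shows "dilation_exponent G = k"
  unfolding dilation_exponent_def
proof (rule the_equality)
  let ?P = "of_nat CARD('p) :: 'p padic"
  define \<phi> where "\<phi> x = G (?P powi (- k) * x)" for x
  have "bij (\<lambda>x. ?P powi (- k) * x)"
    by (rule bij_betw_byWitness[of _ "\<lambda>x. ?P powi k * x"]) (auto simp: power_int_minus)
  moreover have "\<phi> = G \<circ> (\<lambda>x. ?P powi (- k) * x)" by (auto simp: \<phi>_def)
  ultimately have "bij \<phi>" using assms bij_comp unfolding scales_distances_def by blast
  moreover have "padic_norm (\<phi> x - \<phi> y) = padic_norm (x - y)" for x y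
  proof -
    have "padic_norm (\<phi> x - \<phi> y) = real CARD('p) powi (- k) * (real CARD('p) powi k * padic_norm (x - y))"
      using assms by (simp add: scales_distances_def \<phi>_def right_diff_distrib[symmetric] padic_norm_mult)
    then show ?thesis by (simp add: power_int_minus)
  qed
  ultimately have "padic_isometry \<phi>" by (simp add: padic_isometry_def)
  moreover have "G = (\<lambda>x. \<phi> (?P powi k * x))" by (simp add: \<phi>_def power_int_minus fun_eq_iff mult.assoc[symmetric])
  ultimately show "\<exists>\<phi>. padic_isometry \<phi> \<and> G = (\<lambda>x. \<phi> (of_nat CARD('p) powi k * x))" by blast
next
  fix g assume "\<exists>\<phi>. padic_isometry \<phi> \<and> G = (\<lambda>x. \<phi> (of_nat CARD('p) powi g * x))"
  then obtain \<phi> where \<phi>: "padic_isometry \<phi>" "G = (\<lambda>x. \<phi> (of_nat CARD('p) powi g * x))" by blast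
  have "padic_norm (G 1 - G 0) = padic_norm (of_nat CARD('p) powi g * 1 - of_nat CARD('p) powi g * 0 :: 'p padic)"
    using \<phi> unfolding padic_isometry_def by blast
  moreover have "padic_norm (G 1 - G 0) = real CARD('p) powi (- k)"
    using assms by (simp add: scales_distances_def)
  ultimately have "real CARD('p) powi (- k) = real CARD('p) powi (- g)" by simp
  then have "real CARD('p) powi (- k) \<le> real CARD('p) powi (- g)" "real CARD('p) powi (- g) \<le> real CARD('p) powi (- k)"
    by simp_all
  then show "g = k" unfolding CARD_powi_le_iff by linarith
qed

text \<open>
  The scalar is \<open>\<mu>(B)\<^sup>-\<^sup>1\<^sup>/\<^sup>2\<close> for the ball \<open>B = padic_cball a k\<close>.
\<close>

definition ball_wavelet :: "'p::prime_card padic \<Rightarrow> int \<Rightarrow> (nat \<Rightarrow> nat) \<Rightarrow> 'p padic \<Rightarrow> complex" where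
  "ball_wavelet a k \<sigma> x = of_real (real CARD('p) powr (- real_of_int k / 2)) *
     (if x \<in> padic_cball a k then root_unity CARD('p) (\<sigma> (rel_digit a k x)) else 0)"

text \<open>
  The hypothesis on \<open>G a\<close> says that \<open>a\<close> lies in the preimage of \<open>\<int>\<^sub>p\<close>, which is then the ball
  of exponent \<open>k\<close> about \<open>a\<close>.
\<close>

lemma unitary_action_wavelet_eqI:
  fixes G :: "'p::prime_card padic \<Rightarrow> 'p padic"
  assumes G: "scales_distances k G" and a: "padic_norm (G a) \<le> 1"
    and \<sigma>: "\<And>x. x \<in> padic_cball a k \<Longrightarrow> padic_norm (G x - of_nat (\<sigma> (rel_digit a k x))) \<le> real CARD('p) powi (-1)"
  shows "unitary_action G padic_wavelet = ball_wavelet a k \<sigma>"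
proof
  fix x
  have "padic_norm (G x) \<le> 1 \<longleftrightarrow> x \<in> padic_cball a k"
    using scales_distancesD[OF G, of x a 0] padic_norm_add_le[OF _ a, of "G x - G a"]
      padic_norm_diff_le[OF _ a, of "G x"] by (auto simp: mem_padic_cball)
  then show "unitary_action G padic_wavelet x = ball_wavelet a k \<sigma> x"
    using padic_wavelet_eq[OF \<sigma>, of x] padic_wavelet_outside[of "G x"]
    by (auto simp: unitary_action_def ball_wavelet_def dilation_exponent_eq[OF G])
qed

text \<open>
  Replaces the zeroth digit of a \<open>p\<close>-adic integer by its image under \<open>\<sigma>\<close> and keeps all other digits.
\<close>

definition digit_permutation :: "(nat \<Rightarrow> nat) \<Rightarrow> 'p::prime_card padic \<Rightarrow> 'p padic" where
  "digit_permutation \<sigma> z =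
     (if padic_norm z \<le> 1 then z - of_nat (padic_digit z) + of_nat (\<sigma> (padic_digit z)) else z)"

lemma digit_permutation:
  fixes z :: "'p::prime_card padic"
  assumes "\<sigma> permutes {..<CARD('p)}" "padic_norm z \<le> 1"
  shows "padic_norm (digit_permutation \<sigma> z - of_nat (\<sigma> (padic_digit z))) \<le> real CARD('p) powi (-1)"
    "padic_digit (digit_permutation \<sigma> z) = \<sigma> (padic_digit z)"
    "padic_norm (digit_permutation \<sigma> z) \<le> 1"
proof -
  show 1: "padic_norm (digit_permutation \<sigma> z - of_nat (\<sigma> (padic_digit z))) \<le> real CARD('p) powi (-1)"
    using assms padic_digit(2)[of z] by (simp add: digit_permutation_def)
  have "\<sigma> (padic_digit z) < CARD('p)"
    using assms padic_digit(1)[of z] permutes_in_image[OF assms(1)] by auto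
  from padic_digit_eqI[OF 1 this]
  show "padic_digit (digit_permutation \<sigma> z) = \<sigma> (padic_digit z)" "padic_norm (digit_permutation \<sigma> z) \<le> 1"
    by auto
qed

text \<open>
  Points with the same zeroth digit are translated by the same integer; points of \<open>\<int>\<^sub>p\<close> with
  different zeroth digits are at distance \<open>1\<close> before and after, as \<open>\<sigma>\<close> is injective; and the
  distance from a point outside \<open>\<int>\<^sub>p\<close> to any point of \<open>\<int>\<^sub>p\<close> is the norm of the former.
\<close>

lemma digit_permutation_isometry:
  assumes \<sigma>: "\<sigma> permutes {..<CARD('p::prime_card)}"
  shows "padic_isometry (digit_permutation \<sigma> :: 'p padic \<Rightarrow> 'p padic)"
proof -
  let ?\<iota> = "digit_permutation \<sigma> :: 'p padic \<Rightarrow> 'p padic"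
  have inv: "digit_permutation \<tau> (digit_permutation \<rho> z) = z"
    if "\<rho> permutes {..<CARD('p)}" "\<And>i. \<tau> (\<rho> i) = i" for \<tau> \<rho> and z :: "'p padic"
  proof (cases "padic_norm z \<le> 1")
    case True
    note d = digit_permutation[OF that(1) True]
    have "digit_permutation \<tau> (digit_permutation \<rho> z)
        = digit_permutation \<rho> z - of_nat (\<rho> (padic_digit z)) + of_nat (padic_digit z)"
      unfolding digit_permutation_def[of \<tau>] using d(2,3) that(2) by simp
    then show ?thesis using True by (simp add: digit_permutation_def)
  qed (simp add: digit_permutation_def)
  have "bij ?\<iota>"
    by (rule bij_betw_byWitness[of _ "digit_permutation (inv \<sigma>)"])
      (use inv[OF \<sigma>, of "inv \<sigma>"] inv[OF permutes_inv[OF \<sigma>], of \<sigma>] permutes_inverses[OF \<sigma>] in auto)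
  moreover have far: "padic_norm (x - y) = padic_norm y" if "padic_norm x \<le> 1" "padic_norm y > 1" for x y :: "'p padic"
    using padic_norm_eq_of_near[of y "y - x"] that padic_norm_minus_commute[of x y] by simp
  have "padic_norm (?\<iota> x - ?\<iota> y) = padic_norm (x - y)" for x y
  proof -
    consider "padic_norm x \<le> 1" "padic_norm y \<le> 1" | "padic_norm x \<le> 1" "padic_norm y > 1"
      | "padic_norm x > 1" "padic_norm y \<le> 1" | "padic_norm x > 1" "padic_norm y > 1" by linarith
    then show ?thesis
    proof cases
      case 1
      note dx = digit_permutation[OF \<sigma> 1(1)] and dy = digit_permutation[OF \<sigma> 1(2)]
      show ?thesis
      proof (cases "padic_digit x = padic_digit y")
        case True
        then show ?thesis using 1 by (simp add: digit_permutation_def)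
      next
        case False
        have one: "padic_norm (u - v) = 1"
          if "padic_norm u \<le> 1" "padic_norm v \<le> 1" "padic_digit u \<noteq> padic_digit v" for u v :: "'p padic"
        proof -
          have "padic_norm (u - v) \<le> 1" using that by (intro padic_norm_diff_le)
          moreover have "\<not> padic_norm (u - v) < real CARD('p) powi 0"
            unfolding padic_norm_less_iff using padic_digit_eq_iff[OF that(1,2)] that(3) by simp
          ultimately show ?thesis by simp
        qed
        have "\<sigma> (padic_digit x) \<noteq> \<sigma> (padic_digit y)"
          using False permutes_inj[OF \<sigma>] by (auto simp: inj_eq)
        then show ?thesis using one[of "?\<iota> x" "?\<iota> y"] one[OF 1 False] dx(2,3) dy(2,3) by simp
      qed
    next
      case 2
      then show ?thesis
        using far[of "?\<iota> x" y] far[of x y] digit_permutation(3)[OF \<sigma>, of x] by (simp add: digit_permutation_def[of _ y])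
    next
      case 3
      then show ?thesis
        using far[of "?\<iota> y" x] far[of y x] digit_permutation(3)[OF \<sigma>, of y]
        by (simp add: digit_permutation_def[of _ x] padic_norm_minus_commute[of x])
    qed (simp add: digit_permutation_def)
  qed
  ultimately show ?thesis by (simp add: padic_isometry_def)
qed

text \<open>
  A ball-morphism \<open>G\<close> maps the maximal subballs of the preimage of \<open>\<int>\<^sub>p\<close> onto the residue classes
  modulo \<open>p\<close>, and \<open>\<sigma>\<close> records this correspondence. Conversely \<open>\<sigma>\<close> is realised by an affine map of the
  ball onto \<open>\<int>\<^sub>p\<close> followed by a permutation of the zeroth digit.
\<close>

lemma ball_morphism_orbit_wavelet:
  "ball_morphism_orbit (padic_wavelet :: 'p::prime_card padic \<Rightarrow> complex) =
     {ball_wavelet a k \<sigma> | a k \<sigma>. \<sigma> permutes {..<CARD('p)}}"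
proof (intro set_eqI iffI)
  fix f :: "'p padic \<Rightarrow> complex" assume "f \<in> ball_morphism_orbit padic_wavelet"
  then obtain G :: "'p padic \<Rightarrow> 'p padic" where G: "ball_morphism G" "f = unitary_action G padic_wavelet"
    by (auto simp: ball_morphism_orbit_def)
  obtain k where k: "scales_distances k G" using ball_morphism_scales_distances[OF G(1)] .
  have b: "bij G" using k by (simp add: scales_distances_def)
  then obtain a where a: "G a = 0" by (metis bij_pointE)
  define c where "c j = a + of_nat j * of_nat CARD('p) powi (- k)" for j
  \<comment> \<open>extended by the identity, as required of a permutation of \<open>{..<p}\<close>\<close>
  define \<sigma> where "\<sigma> j = (if j < CARD('p) then padic_digit (G (c j)) else j)" for j
  have mem0: "padic_norm (G x) \<le> 1 \<longleftrightarrow> x \<in> padic_cball a k" for x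
    using scales_distancesD[OF k, of x a 0] a by (simp add: mem_padic_cball)
  have cm: "c j \<in> padic_cball a k" if "j < CARD('p)" for j
    using center_in_subball[of a j k] that by (simp add: mem_subball c_def)
  have near: "x \<in> subball a k j \<longleftrightarrow> padic_norm (G x - G (c j)) \<le> real CARD('p) powi (-1)" for x j
    using scales_distancesD[OF k, of x "c j" "-1"] by (simp add: subball_def c_def mem_padic_cball)
  have "inj_on \<sigma> {..<CARD('p)}"
  proof (rule inj_onI)
    fix i j assume ij: "i \<in> {..<CARD('p)}" "j \<in> {..<CARD('p)}" "\<sigma> i = \<sigma> j"
    then have "padic_norm (G (c i) - G (c j)) \<le> real CARD('p) powi (-1)"
      using padic_digit_eq_iff[of "G (c i)" "G (c j)"] mem0 cm by (auto simp: \<sigma>_def)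
    then have "c i \<in> subball a k j" by (simp only: near)
    then show "i = j" using subball_disjoint[of i j a k] center_in_subball[of a i k] ij by (auto simp: c_def)
  qed
  moreover have "\<sigma> ` {..<CARD('p)} \<subseteq> {..<CARD('p)}"
    using padic_digit(1) mem0 cm by (auto simp: \<sigma>_def)
  ultimately have "bij_betw \<sigma> {..<CARD('p)} {..<CARD('p)}"
    by (simp add: bij_betw_def endo_inj_surj)
  then have perm: "\<sigma> permutes {..<CARD('p)}"
    by (rule bij_imp_permutes) (simp add: \<sigma>_def)
  have "f = ball_wavelet a k \<sigma>" unfolding G(2)
  proof (rule unitary_action_wavelet_eqI[OF k])
    show "padic_norm (G a) \<le> 1" by (simp add: a)
    fix x assume x: "x \<in> padic_cball a k"
    define j where "j = rel_digit a k x"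
    have j: "j < CARD('p)" using rel_digit_less[OF x] by (simp add: j_def)
    then have "x \<in> subball a k j" using x by (simp add: mem_subball j_def)
    then have "padic_digit (G x) = \<sigma> j"
      using padic_digit_eq_iff[of "G x" "G (c j)"] mem0 x cm[OF j] j near by (simp add: \<sigma>_def)
    then show "padic_norm (G x - of_nat (\<sigma> (rel_digit a k x))) \<le> real CARD('p) powi - 1"
      using padic_digit(2)[of "G x"] mem0 x by (simp add: j_def)
  qed
  then show "f \<in> {ball_wavelet a k \<sigma> | a k \<sigma>. \<sigma> permutes {..<CARD('p)}}" using perm by blast
next
  fix f :: "'p padic \<Rightarrow> complex" assume "f \<in> {ball_wavelet a k \<sigma> | a k \<sigma>. \<sigma> permutes {..<CARD('p)}}"
  then obtain a k \<sigma> where f: "f = ball_wavelet a k \<sigma>" and \<sigma>: "\<sigma> permutes {..<CARD('p)}" by blast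
  let ?P = "of_nat CARD('p) :: 'p padic"
  define G where "G x = digit_permutation \<sigma> (?P powi k * (x - a))" for x
  have iso: "padic_isometry (digit_permutation \<sigma> :: 'p padic \<Rightarrow> 'p padic)"
    by (rule digit_permutation_isometry[OF \<sigma>])
  have "bij (\<lambda>x. ?P powi k * (x - a))"
    by (rule bij_betw_byWitness[of _ "\<lambda>x. ?P powi (- k) * x + a"])
      (auto simp: power_int_minus mult.assoc[symmetric])
  moreover have "G = digit_permutation \<sigma> \<circ> (\<lambda>x. ?P powi k * (x - a))" by (auto simp: G_def)
  ultimately have "bij G" using iso bij_comp unfolding padic_isometry_def by blast
  moreover have "padic_norm (G x - G y) = real CARD('p) powi (- k) * padic_norm (x - y)" for x y
  proof -
    have "padic_norm (G x - G y) = padic_norm (?P powi k * (x - a) - ?P powi k * (y - a))"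
      using iso by (simp only: padic_isometry_def G_def)
    also have "?P powi k * (x - a) - ?P powi k * (y - a) = ?P powi k * (x - y)" by (simp add: algebra_simps)
    finally show ?thesis by (simp add: padic_norm_mult)
  qed
  ultimately have G: "scales_distances k G" by (simp add: scales_distances_def)
  have "unitary_action G padic_wavelet = f"
    unfolding f
  proof (rule unitary_action_wavelet_eqI[OF G])
    show "padic_norm (G a) \<le> 1" using digit_permutation(3)[OF \<sigma>, of 0] by (simp add: G_def)
    fix x assume "x \<in> padic_cball a k"
    then show "padic_norm (G x - of_nat (\<sigma> (rel_digit a k x))) \<le> real CARD('p) powi - 1"
      unfolding G_def rel_digit_def mem_padic_cball_rescale by (rule digit_permutation(1)[OF \<sigma>])
  qed
  then show "f \<in> ball_morphism_orbit padic_wavelet"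
    using scales_distances_ball_morphism[OF G] by (auto simp: ball_morphism_orbit_def)
qed


section \<open>Averaging over permutations of the roots of unity\<close>

lemma root_unity_cis: "root_unity N m = cis (2 * pi * real m / real N)"
  by (simp add: root_unity_def cis_conv_exp mult_ac)

lemma cmod_root_unity [simp]: "cmod (root_unity N m) = 1"
  by (simp add: root_unity_cis)

lemma sum_root_unity: "N > 1 \<Longrightarrow> (\<Sum>j<N. root_unity N j) = 0"
  using sum.reindex_bij_betw[OF bij_betw_roots_unity[of N], of "\<lambda>z. z"] sum_roots_unity[of N]
    complex_roots_unity[of N]
  by (simp add: root_unity_def)

lemma inj_on_root_unity: "N > 0 \<Longrightarrow> inj_on (root_unity N) {..<N}"
  using bij_betw_imp_inj_on[OF bij_betw_roots_unity, of N] by (simp add: root_unity_def[abs_def])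

lemma cnj_root_unity_mult [simp]: "cnj (root_unity N m) * root_unity N m = 1"
  by (simp add: root_unity_cis cis_cnj cis_mult)

text \<open>
  Expanding the squares gives the quadratic form with matrix
  \<open>X\<^sub>i\<^sub>j = \<Sum>\<^sub>\<sigma> \<omega>\<^sup>\<sigma>\<^sup>(\<^sup>j\<^sup>)\<^sup>-\<^sup>\<sigma>\<^sup>(\<^sup>i\<^sup>)\<close>. Its diagonal entries are \<open>N!\<close>, its rows sum to zero because the roots of unity
  do, and composing \<open>\<sigma>\<close> with a transposition shows that the off-diagonal entries of a row agree. So these
  are all equal to \<open>-N!/(N-1)\<close>.
\<close>

lemma sum_permutations_cmod2:
  fixes a :: "nat \<Rightarrow> complex"
  assumes N: "N > 1"
  shows "(\<Sum>\<sigma> | \<sigma> permutes {..<N}. (cmod (\<Sum>j<N. a j * cnj (root_unity N (\<sigma> j))))\<^sup>2) =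
    fact N / (real N - 1) * (real N * (\<Sum>j<N. (cmod (a j))\<^sup>2) - (cmod (\<Sum>j<N. a j))\<^sup>2)"
proof -
  define w where "w = root_unity N"
  define S where "S = {\<sigma>. \<sigma> permutes {..<N}}"
  define X where "X i j = (\<Sum>\<sigma>\<in>S. cnj (w (\<sigma> i)) * w (\<sigma> j))" for i j
  define K :: complex where "K = fact N / (of_nat N - 1)"
  have N1: "of_nat N - 1 \<noteq> (0 :: complex)" using N by (metis eq_iff_diff_eq_0 of_nat_1_eq_iff less_irrefl)
  have Xii: "X i i = fact N" for i
    using card_permutations[of "{..<N}" N] by (simp add: X_def w_def S_def)
  have X0: "(\<Sum>j<N. X i j) = 0" for i
  proof -
    have "(\<Sum>j<N. w (\<sigma> j)) = 0" if "\<sigma> \<in> S" for \<sigma>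
      using sum.permute[of \<sigma> "{..<N}" w] that sum_root_unity[OF N] by (simp add: S_def w_def o_def)
    then have "(\<Sum>\<sigma>\<in>S. \<Sum>j<N. cnj (w (\<sigma> i)) * w (\<sigma> j)) = 0" by (simp flip: sum_distrib_left)
    then show ?thesis unfolding X_def by (subst sum.swap)
  qed
  have Xeq: "X i j = X i j'" if "j < N" "j' < N" "j \<noteq> i" "j' \<noteq> i" for i j j'
  proof -
    have "Transposition.transpose j j' permutes {..<N}" using that by (intro permutes_swap_id) auto
    from sum_permutations_compose_right[OF this, of "\<lambda>\<sigma>. cnj (w (\<sigma> i)) * w (\<sigma> j)"]
    show ?thesis using that by (simp add: X_def S_def)
  qed
  have X: "X i j = K * ((if i = j then of_nat N else 0) - 1)" if "i < N" "j < N" for i j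
  proof (cases "i = j")
    case True
    then show ?thesis using N1 by (simp add: Xii K_def)
  next
    case False
    have "(\<Sum>l<N. X i l) = X i i + (\<Sum>l\<in>{..<N} - {i}. X i l)" using that by (simp add: sum.remove)
    also have "(\<Sum>l\<in>{..<N} - {i}. X i l) = (\<Sum>l\<in>{..<N} - {i}. X i j)"
      using False that by (intro sum.cong refl Xeq) auto
    also have "\<dots> = (of_nat N - 1) * X i j" using that by (simp add: of_nat_diff)
    finally have "(of_nat N - 1) * X i j = - fact N" using X0[of i] Xii[of i] by (simp add: eq_neg_iff_add_eq_0 add.commute)
    then show ?thesis using N1 False by (simp add: K_def field_simps)
  qed
  have "complex_of_real (\<Sum>\<sigma>\<in>S. (cmod (\<Sum>j<N. a j * cnj (w (\<sigma> j))))\<^sup>2)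
    = (\<Sum>\<sigma>\<in>S. \<Sum>i<N. \<Sum>j<N. a i * cnj (a j) * (cnj (w (\<sigma> i)) * w (\<sigma> j)))"
    unfolding of_real_sum
    by (intro sum.cong refl) (simp only: complex_norm_square, simp add: sum_product mult_ac)
  also have "\<dots> = (\<Sum>i<N. \<Sum>j<N. a i * cnj (a j) * X i j)"
    unfolding X_def sum_distrib_left by (subst sum.swap, intro sum.cong refl, subst sum.swap, rule refl)
  also have "\<dots> = (\<Sum>i<N. \<Sum>j<N. a i * cnj (a j) * (K * ((if i = j then of_nat N else 0) - 1)))"
    by (intro sum.cong refl) (simp add: X)
  also have "\<dots> = K * ((\<Sum>i<N. \<Sum>j<N. if i = j then of_nat N * (a i * cnj (a j)) else 0)
       - (\<Sum>i<N. \<Sum>j<N. a i * cnj (a j)))"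
    by (simp only: sum_distrib_left sum_subtractf[symmetric])
      (intro sum.cong refl, simp add: algebra_simps)
  also have "(\<Sum>i<N. \<Sum>j<N. if i = j then of_nat N * (a i * cnj (a j)) else 0) = of_nat N * (\<Sum>i<N. a i * cnj (a i))"
    by (simp add: sum_distrib_left)
  also have "(\<Sum>i<N. \<Sum>j<N. a i * cnj (a j)) = (\<Sum>i<N. a i) * cnj (\<Sum>j<N. a j)"
    by (simp add: sum_product)
  also have "K * (of_nat N * (\<Sum>i<N. a i * cnj (a i)) - (\<Sum>i<N. a i) * cnj (\<Sum>j<N. a j))
     = complex_of_real (fact N / (real N - 1) * (real N * (\<Sum>j<N. (cmod (a j))\<^sup>2) - (cmod (\<Sum>j<N. a j))\<^sup>2))"
    by (simp add: K_def complex_norm_square[symmetric] del: cnj_sum)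
  finally show ?thesis unfolding of_real_eq_iff S_def w_def .
qed

section \<open>Haar measure of balls and the wavelets of a ball\<close>

lemma open_padic_cball: "open (padic_cball (a :: 'p::prime_card padic) k)"
  unfolding open_dist
proof (intro ballI exI[of _ "real CARD('p) powi k"] conjI allI impI)
  fix x y assume x: "x \<in> padic_cball a k" and "dist y x < real CARD('p) powi k"
  then have "y \<in> padic_cball x k" by (simp add: mem_padic_cball dist_padic_def)
  then show "y \<in> padic_cball a k" using x by (rule padic_cball_trans)
qed simp

lemma scale_factor_sq: "(real CARD('p::prime_card) powr (- real_of_int k / 2))\<^sup>2 = real CARD('p) powi (- k)"
proof -
  have "(real CARD('p) powr (- real_of_int k / 2))\<^sup>2 = real CARD('p) powr (real_of_int (- k))"
    by (simp add: power2_eq_square powr_add[symmetric])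
  then show ?thesis by (subst (asm) powr_real_of_int') auto
qed

locale padic_haar =
  fixes \<mu> :: "'p::prime_card padic measure"
  assumes haar: "normalized_haar \<mu>"
begin

lemma sets_mu [simp, measurable_cong]: "sets \<mu> = sets borel"
  using haar by (simp add: normalized_haar_def)

lemma space_mu [simp]: "space \<mu> = UNIV"
  using sets_eq_imp_space_eq[OF sets_mu] by simp

lemma sets_padic_cball [measurable, simp]: "padic_cball (a :: 'p padic) k \<in> sets borel"
  by (intro borel_open open_padic_cball)

lemma sets_subball [measurable, simp]: "subball (a :: 'p padic) k j \<in> sets borel"
  by (simp add: subball_def)

lemma emeasure_cball_translate: "emeasure \<mu> (padic_cball a k) = emeasure \<mu> (padic_cball 0 k)"
proof -
  have "(\<lambda>x. a + x) ` padic_cball 0 k = padic_cball a k"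
  proof (intro set_eqI iffI)
    fix x assume "x \<in> padic_cball a k"
    then have "x = a + (x - a)" "x - a \<in> padic_cball 0 k" by (simp_all add: mem_padic_cball)
    then show "x \<in> (\<lambda>x. a + x) ` padic_cball 0 k" by (rule image_eqI)
  qed (auto simp: mem_padic_cball)
  moreover have "\<forall>a. \<forall>A\<in>sets borel. emeasure \<mu> ((\<lambda>x. a + x) ` A) = emeasure \<mu> A"
    using haar by (simp add: normalized_haar_def)
  ultimately show ?thesis using sets_padic_cball[of 0 k] by metis
qed

lemma emeasure_cball_step: "emeasure \<mu> (padic_cball a k) = of_nat CARD('p) * emeasure \<mu> (padic_cball 0 (k - 1))"
proof -
  have "emeasure \<mu> (padic_cball a k) = emeasure \<mu> (\<Union>j<CARD('p). subball a k j)"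
    by (simp only: UN_subball)
  also have "\<dots> = (\<Sum>j<CARD('p). emeasure \<mu> (subball a k j))"
    by (rule sum_emeasure[symmetric]) (auto simp: disjoint_family_on_def subball_disjoint)
  also have "\<dots> = of_nat CARD('p) * emeasure \<mu> (padic_cball 0 (k - 1))"
    unfolding subball_def by (subst emeasure_cball_translate) simp
  finally show ?thesis .
qed

text \<open>
  A ball is the disjoint union of \<open>p\<close> translates of a ball of the next smaller exponent, which
  propagates the normalization \<open>\<mu>(\<int>\<^sub>p) = 1\<close> to all exponents in both directions.
\<close>

lemma emeasure_cball: "emeasure \<mu> (padic_cball a k) = ennreal (real CARD('p) powi k)"
proof -
  have "emeasure \<mu> (padic_cball 0 k) = ennreal (real CARD('p) powi k)"
  proof (induction k rule: int_induct[of _ 0])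
    case base
    have "padic_cball 0 0 = (padic_integers :: 'p padic set)"
      by (auto simp: mem_padic_cball padic_integers_def)
    then show ?case using haar by (simp add: normalized_haar_def)
  next
    case (step1 i)
    have "emeasure \<mu> (padic_cball 0 (i + 1)) = of_nat CARD('p) * ennreal (real CARD('p) powi i)"
      using emeasure_cball_step[of 0 "i + 1"] step1 by simp
    also have "\<dots> = ennreal (real CARD('p) powi (i + 1))"
      by (subst ennreal_of_nat_eq_real_of_nat) (simp add: ennreal_mult'[symmetric] power_int_add mult.commute)
    finally show ?case .
  next
    case (step2 i)
    have "of_nat CARD('p) * emeasure \<mu> (padic_cball 0 (i - 1)) = ennreal (real CARD('p) powi i)"
      using emeasure_cball_step[of 0 i] step2 by simp
    also have "\<dots> = of_nat CARD('p) * ennreal (real CARD('p) powi (i - 1))"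
      by (subst ennreal_of_nat_eq_real_of_nat) (simp add: ennreal_mult'[symmetric] power_int_diff)
    finally show ?case by (simp add: ennreal_mult_cancel_left)
  qed
  then show ?thesis by (simp add: emeasure_cball_translate[of a])
qed

lemma measure_cball [simp]: "measure \<mu> (padic_cball a k) = real CARD('p) powi k"
  by (simp add: measure_def emeasure_cball less_imp_le)

lemma integrable_indicator_cball [simp]: "integrable \<mu> (indicator (padic_cball a k) :: _ \<Rightarrow> real)"
  by (simp add: emeasure_cball)

lemma indicator_cball_complex:
  "integrable \<mu> (indicator (padic_cball a k) :: _ \<Rightarrow> complex)"
  "(\<integral>x. indicator (padic_cball a k) x \<partial>\<mu>) = complex_of_real (real CARD('p) powi k)"
proof -
  have "(indicator (padic_cball a k) :: _ \<Rightarrow> complex) = (\<lambda>x. complex_of_real (indicator (padic_cball a k) x))"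
    by (auto simp: indicator_def)
  then show "integrable \<mu> (indicator (padic_cball a k) :: _ \<Rightarrow> complex)"
    "(\<integral>x. indicator (padic_cball a k) x \<partial>\<mu>) = complex_of_real (real CARD('p) powi k)"
    by simp_all
qed

lemma ball_wavelet_outside: "x \<notin> padic_cball a k \<Longrightarrow> ball_wavelet (a :: 'p padic) k \<sigma> x = 0"
  by (simp add: ball_wavelet_def)

lemma cmod_ball_wavelet_sq:
  "(cmod (ball_wavelet (a :: 'p padic) k \<sigma> x))\<^sup>2 = real CARD('p) powi (- k) * indicator (padic_cball a k) x"
  using scale_factor_sq[where 'p = 'p, of k]
  by (simp add: ball_wavelet_def norm_mult power_mult_distrib indicator_def)

lemma ball_wavelet_eq_sum:
  "ball_wavelet (a :: 'p padic) k \<sigma> x =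
    (\<Sum>j<CARD('p). of_real (real CARD('p) powr (- real_of_int k / 2)) * root_unity CARD('p) (\<sigma> j) * indicator (subball a k j) x)"
proof (cases "x \<in> padic_cball a k")
  case True
  have "(\<Sum>j<CARD('p). of_real (real CARD('p) powr (- real_of_int k / 2)) * root_unity CARD('p) (\<sigma> j) * indicator (subball a k j) x)
    = (\<Sum>j<CARD('p). if j = rel_digit a k x then of_real (real CARD('p) powr (- real_of_int k / 2)) * root_unity CARD('p) (\<sigma> j) else 0)"
    using True by (intro sum.cong refl) (auto simp: indicator_def mem_subball)
  then show ?thesis using True rel_digit_less[OF True] by (simp add: ball_wavelet_def)
next
  case False
  then show ?thesis by (simp add: ball_wavelet_def indicator_def mem_subball)
qed

lemma borel_measurable_ball_wavelet [measurable]: "ball_wavelet (a :: 'p padic) k \<sigma> \<in> borel_measurable borel"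
  unfolding ball_wavelet_eq_sum[abs_def] by measurable

lemma l2_norm_ball_wavelet [simp]: "l2_norm \<mu> (ball_wavelet a k \<sigma>) = 1"
  by (simp add: l2_norm_def cmod_ball_wavelet_sq power_int_minus)

lemma square_integrable_ball_wavelet: "square_integrable \<mu> (ball_wavelet a k \<sigma>)"
  unfolding square_integrable_def cmod_ball_wavelet_sq by simp

text \<open>
  The numbering of the maximal subballs by \<open>subball a k\<close> turns the injective labelling \<open>m\<close> into a
  permutation, and the normalization \<open>c\<^sup>2 \<mu>(B) = 1\<close> determines the positive factor.
\<close>

lemma ball_wavelets_cball:
  "ball_wavelets \<mu> (padic_cball a k) = {ball_wavelet a k \<sigma> | \<sigma>. \<sigma> permutes {..<CARD('p)}}"
proof (intro set_eqI iffI)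
  fix f assume "f \<in> ball_wavelets \<mu> (padic_cball a k)"
  then obtain c :: real and m where f0: "\<And>x. x \<notin> padic_cball a k \<Longrightarrow> f x = 0" and n1: "l2_norm \<mu> f = 1"
    and c: "c > 0" and m: "m ` maximal_subballs (padic_cball a k) \<subseteq> {..<CARD('p)}"
      "inj_on m (maximal_subballs (padic_cball a k))"
    and f1: "\<And>C x. C \<in> maximal_subballs (padic_cball a k) \<Longrightarrow> x \<in> C \<Longrightarrow> f x = of_real c * root_unity CARD('p) (m C)"
    unfolding ball_wavelets_def root_unity_def by blast
  define \<sigma> where "\<sigma> j = (if j < CARD('p) then m (subball a k j) else j)" for j
  have "inj_on \<sigma> {..<CARD('p)}"
    using comp_inj_on[OF inj_on_subball[of a k], of m] m(2)
    by (auto simp: maximal_subballs_cball \<sigma>_def inj_on_def)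
  moreover have "\<sigma> ` {..<CARD('p)} \<subseteq> {..<CARD('p)}"
    using m(1) by (auto simp: maximal_subballs_cball \<sigma>_def)
  ultimately have "bij_betw \<sigma> {..<CARD('p)} {..<CARD('p)}"
    by (simp add: bij_betw_def endo_inj_surj)
  then have perm: "\<sigma> permutes {..<CARD('p)}"
    by (rule bij_imp_permutes) (simp add: \<sigma>_def)
  have f: "f x = of_real c * (if x \<in> padic_cball a k then root_unity CARD('p) (\<sigma> (rel_digit a k x)) else 0)" for x
  proof (cases "x \<in> padic_cball a k")
    case True
    then have "x \<in> subball a k (rel_digit a k x)" using rel_digit_less[OF True] by (simp add: mem_subball)
    then show ?thesis using f1[of "subball a k (rel_digit a k x)" x] True rel_digit_less[OF True]
      by (simp add: maximal_subballs_cball \<sigma>_def)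
  qed (simp add: f0)
  have "(cmod (f x))\<^sup>2 = c\<^sup>2 * indicator (padic_cball a k) x" for x
    using c by (simp add: f norm_mult power_mult_distrib)
  then have "c\<^sup>2 * real CARD('p) powi k = 1" using n1 by (simp add: l2_norm_def)
  then have "c\<^sup>2 = (real CARD('p) powr (- real_of_int k / 2))\<^sup>2"
    unfolding scale_factor_sq by (simp add: power_int_minus field_simps)
  then have "c = real CARD('p) powr (- real_of_int k / 2)" using c by (simp add: power2_eq_iff_nonneg)
  then have "f = ball_wavelet a k \<sigma>" by (simp add: fun_eq_iff f ball_wavelet_def)
  then show "f \<in> {ball_wavelet a k \<sigma> | \<sigma>. \<sigma> permutes {..<CARD('p)}}" using perm by blast
next
  fix f assume "f \<in> {ball_wavelet a k \<sigma> | \<sigma>. \<sigma> permutes {..<CARD('p)}}"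
  then obtain \<sigma> where f: "f = ball_wavelet a k \<sigma>" and \<sigma>: "\<sigma> permutes {..<CARD('p)}" by blast
  define m where "m C = \<sigma> (the_inv_into {..<CARD('p)} (subball a k) C)" for C
  have m: "m (subball a k j) = \<sigma> j" if "j < CARD('p)" for j
    using that by (simp add: m_def the_inv_into_f_f[OF inj_on_subball])
  have "\<sigma> j < CARD('p)" if "j < CARD('p)" for j
    using permutes_in_image[OF \<sigma>, of j] that by simp
  then have "m ` maximal_subballs (padic_cball a k) \<subseteq> {..<CARD('p)}"
    by (auto simp: maximal_subballs_cball m)
  moreover have "inj_on m (maximal_subballs (padic_cball a k))"
    by (auto simp: maximal_subballs_cball m inj_on_def inj_eq[OF permutes_inj[OF \<sigma>]])
  moreover have "f x = of_real (real CARD('p) powr (- real_of_int k / 2)) *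
      exp (2 * of_real pi * \<i> * of_nat (m C) / of_nat CARD('p))"
    if "C \<in> maximal_subballs (padic_cball a k)" "x \<in> C" for C x
    using that by (auto simp: maximal_subballs_cball m f ball_wavelet_def mem_subball root_unity_def)
  moreover have "real CARD('p) powr (- real_of_int k / 2) > 0" by simp
  ultimately show "f \<in> ball_wavelets \<mu> (padic_cball a k)"
    unfolding ball_wavelets_def mem_Collect_eq f by (metis ball_wavelet_outside l2_norm_ball_wavelet)
qed

lemma ball_wavelets_related:
  assumes "padic_ball B" "f \<in> ball_wavelets \<mu> B"
  shows "related_to_ball \<mu> B f"
proof -
  obtain a k where B: "B = padic_cball a k" using assms(1) by (auto simp: padic_ball_iff)
  then obtain \<sigma> where f: "f = ball_wavelet a k \<sigma>" and \<sigma>: "\<sigma> permutes {..<CARD('p)}"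
    using assms(2) by (auto simp: ball_wavelets_cball)
  let ?s = "complex_of_real (real CARD('p) powr (- real_of_int k / 2))"
  define c where "c C = ?s * root_unity CARD('p) (\<sigma> (the_inv_into {..<CARD('p)} (subball a k) C))" for C
  have "f = (\<lambda>x. \<Sum>C\<in>maximal_subballs B. c C * indicator C x)"
    unfolding f B maximal_subballs_cball
    by (subst sum.reindex[OF inj_on_subball]) (auto simp: ball_wavelet_eq_sum c_def the_inv_into_f_f[OF inj_on_subball] intro!: sum.cong)
  moreover have "(\<integral>x. f x \<partial>\<mu>) = 0"
  proof -
    have "(\<integral>x. f x \<partial>\<mu>) = (\<Sum>j<CARD('p). \<integral>x. ?s * root_unity CARD('p) (\<sigma> j) * indicator (subball a k j) x \<partial>\<mu>)"
      unfolding f ball_wavelet_eq_sum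
      by (intro Bochner_Integration.integral_sum integrable_mult_right) (auto simp: subball_def indicator_cball_complex)
    also have "\<dots> = (\<Sum>j<CARD('p). ?s * root_unity CARD('p) (\<sigma> j) * of_real (real CARD('p) powi (k - 1)))"
      by (intro sum.cong refl) (simp add: subball_def indicator_cball_complex)
    also have "\<dots> = ?s * of_real (real CARD('p) powi (k - 1)) * (\<Sum>j<CARD('p). root_unity CARD('p) (\<sigma> j))"
      by (subst sum_distrib_left) (simp add: mult_ac)
    also have "(\<Sum>j<CARD('p). root_unity CARD('p) (\<sigma> j)) = 0"
      using sum.permute[OF \<sigma>, of "root_unity CARD('p)"] sum_root_unity[OF CARD_prime_gt_1[where 'p = 'p]] by (simp add: o_def)
    finally show ?thesis by simp
  qed
  ultimately show ?thesis unfolding related_to_ball_def by blast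
qed

end


section \<open>Density of locally constant functions\<close>

text \<open>
  The scale \<open>p\<^sup>n\<close> is uniform over the whole space, but infinitely many values and noncompact support are
  permitted: this keeps the class closed under sums and complements.
\<close>

definition locally_constant :: "int \<Rightarrow> ('p::prime_card padic \<Rightarrow> 'a) \<Rightarrow> bool" where
  "locally_constant n h \<longleftrightarrow> (\<forall>x. \<forall>y\<in>padic_cball x n. h y = h x)"

lemma locally_constant_mono:
  "locally_constant n h \<Longrightarrow> m \<le> n \<Longrightarrow> locally_constant m h"
  using padic_cball_mono unfolding locally_constant_def by blast

lemma locally_constant_measurable:
  fixes h :: "'p::prime_card padic \<Rightarrow> 'a::topological_space"
  assumes "locally_constant n h"
  shows "h \<in> borel_measurable borel"
proof (rule borel_measurableI)
  fix S :: "'a set"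
  have "\<exists>T. open T \<and> x \<in> T \<and> T \<subseteq> h -` S" if "x \<in> h -` S" for x
    using that assms by (intro exI[of _ "padic_cball x n"]) (auto simp: open_padic_cball locally_constant_def)
  then have "open (h -` S)" by (subst open_subopen) blast
  then show "h -` S \<inter> space borel \<in> sets borel" by simp
qed

text \<open>
  A substitute for the triangle inequality of \<open>L\<^sup>2\<close> that can be integrated pointwise.
\<close>

lemma cmod_add_sq_le: "(cmod (a + b))\<^sup>2 \<le> 2 * (cmod a)\<^sup>2 + 2 * (cmod b)\<^sup>2"
proof -
  have "(cmod (a + b))\<^sup>2 \<le> (cmod a + cmod b)\<^sup>2" by (intro power_mono norm_triangle_ineq) auto
  also have "\<dots> \<le> 2 * (cmod a)\<^sup>2 + 2 * (cmod b)\<^sup>2"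
    using sum_squares_bound[of "cmod a" "cmod b"] by (simp add: power2_sum)
  finally show ?thesis .
qed

context padic_haar
begin

text \<open>
  Membership in the \<open>L\<^sup>2\<close>-closure of the locally constant functions. The error is a nonnegative
  integral, so that no integrability of \<open>h\<close> has to be carried along.
\<close>

definition approximable :: "('p padic \<Rightarrow> complex) \<Rightarrow> bool" where
  "approximable g \<longleftrightarrow> g \<in> borel_measurable \<mu> \<and>
     (\<forall>e>0. \<exists>n h. locally_constant n h \<and> (\<integral>\<^sup>+x. ennreal ((cmod (g x - h x))\<^sup>2) \<partial>\<mu>) < ennreal e)"

lemma approximable_measurable [measurable_dest]: "approximable g \<Longrightarrow> g \<in> borel_measurable \<mu>"
  by (simp add: approximable_def)

lemma locally_constant_measurable_mu [measurable_dest]: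
  "locally_constant n (h :: 'p padic \<Rightarrow> complex) \<Longrightarrow> h \<in> borel_measurable \<mu>"
  using locally_constant_measurable[of n h] by (simp cong: measurable_cong_sets)

lemma nn_integral_cmod_add_sq_le:
  assumes [measurable]: "u \<in> borel_measurable \<mu>" "v \<in> borel_measurable \<mu>"
  shows "(\<integral>\<^sup>+x. ennreal ((cmod (u x + v x))\<^sup>2) \<partial>\<mu>)
    \<le> 2 * (\<integral>\<^sup>+x. ennreal ((cmod (u x))\<^sup>2) \<partial>\<mu>) + 2 * (\<integral>\<^sup>+x. ennreal ((cmod (v x))\<^sup>2) \<partial>\<mu>)"
proof -
  have "(\<integral>\<^sup>+x. ennreal ((cmod (u x + v x))\<^sup>2) \<partial>\<mu>)
      \<le> (\<integral>\<^sup>+x. 2 * ennreal ((cmod (u x))\<^sup>2) + 2 * ennreal ((cmod (v x))\<^sup>2) \<partial>\<mu>)"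
  proof (rule nn_integral_mono)
    fix x
    have "ennreal ((cmod (u x + v x))\<^sup>2) \<le> ennreal (2 * (cmod (u x))\<^sup>2 + 2 * (cmod (v x))\<^sup>2)"
      by (intro ennreal_leI cmod_add_sq_le)
    then show "ennreal ((cmod (u x + v x))\<^sup>2) \<le> 2 * ennreal ((cmod (u x))\<^sup>2) + 2 * ennreal ((cmod (v x))\<^sup>2)"
      by (simp add: ennreal_mult' ennreal_plus)
  qed
  then show ?thesis by (simp add: nn_integral_add nn_integral_cmult)
qed

lemma approximable_locally_constant: "locally_constant n h \<Longrightarrow> approximable h"
  unfolding approximable_def
  using locally_constant_measurable_mu by (auto intro!: exI[of _ n] exI[of _ h])

lemma approximable_closed:
  assumes g [measurable]: "g \<in> borel_measurable \<mu>"
    and a: "\<And>e. e > 0 \<Longrightarrow> \<exists>g'. approximable g' \<and> (\<integral>\<^sup>+x. ennreal ((cmod (g x - g' x))\<^sup>2) \<partial>\<mu>) < ennreal e"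
  shows "approximable g"
  unfolding approximable_def
proof (intro conjI allI impI g)
  fix e :: real assume e: "e > 0"
  \<comment> \<open>the constant \<open>4\<close> absorbs two factors \<open>2\<close> from \<open>cmod_add_sq_le\<close> for two errors\<close>
  obtain g' where g': "approximable g'" "(\<integral>\<^sup>+x. ennreal ((cmod (g x - g' x))\<^sup>2) \<partial>\<mu>) < ennreal (e / 4)"
    using a[of "e / 4"] e by auto
  obtain n h where h: "locally_constant n h" "(\<integral>\<^sup>+x. ennreal ((cmod (g' x - h x))\<^sup>2) \<partial>\<mu>) < ennreal (e / 4)"
    using g'(1) e unfolding approximable_def by (meson zero_less_divide_iff zero_less_numeral)
  note [measurable] = approximable_measurable[OF g'(1)] locally_constant_measurable_mu[OF h(1)]
  have "(\<integral>\<^sup>+x. ennreal ((cmod (g x - h x))\<^sup>2) \<partial>\<mu>)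
     = (\<integral>\<^sup>+x. ennreal ((cmod ((g x - g' x) + (g' x - h x)))\<^sup>2) \<partial>\<mu>)" by simp
  also have "\<dots> \<le> 2 * (\<integral>\<^sup>+x. ennreal ((cmod (g x - g' x))\<^sup>2) \<partial>\<mu>) + 2 * (\<integral>\<^sup>+x. ennreal ((cmod (g' x - h x))\<^sup>2) \<partial>\<mu>)"
    by (rule nn_integral_cmod_add_sq_le) measurable
  also have "\<dots> < 2 * ennreal (e / 4) + 2 * ennreal (e / 4)"
    using g'(2) h(2) by (intro add_strict_mono ennreal_mult_strict_left_mono) auto
  also have "\<dots> = ennreal e"
    using e by (simp add: ennreal_mult'[symmetric] ennreal_plus[symmetric] flip: ennreal_numeral)
  finally show "\<exists>n h. locally_constant n h \<and> (\<integral>\<^sup>+x. ennreal ((cmod (g x - h x))\<^sup>2) \<partial>\<mu>) < ennreal e"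
    using h(1) by blast
qed

lemma approximable_add:
  assumes "approximable f" "approximable g"
  shows "approximable (\<lambda>x. f x + g x)"
  unfolding approximable_def
proof (intro conjI allI impI)
  note [measurable] = assms[THEN approximable_measurable]
  show "(\<lambda>x. f x + g x) \<in> borel_measurable \<mu>" by measurable
  fix e :: real assume e: "e > 0"
  obtain n u where u: "locally_constant n u" "(\<integral>\<^sup>+x. ennreal ((cmod (f x - u x))\<^sup>2) \<partial>\<mu>) < ennreal (e / 4)"
    using assms(1) e unfolding approximable_def by (meson zero_less_divide_iff zero_less_numeral)
  obtain m v where v: "locally_constant m v" "(\<integral>\<^sup>+x. ennreal ((cmod (g x - v x))\<^sup>2) \<partial>\<mu>) < ennreal (e / 4)"
    using assms(2) e unfolding approximable_def by (meson zero_less_divide_iff zero_less_numeral)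
  note [measurable] = locally_constant_measurable_mu[OF u(1)] locally_constant_measurable_mu[OF v(1)]
  have "locally_constant (min n m) (\<lambda>x. u x + v x)"
    using locally_constant_mono[OF u(1), of "min n m"] locally_constant_mono[OF v(1), of "min n m"]
    by (auto simp: locally_constant_def)
  moreover have "(\<integral>\<^sup>+x. ennreal ((cmod (f x + g x - (u x + v x)))\<^sup>2) \<partial>\<mu>) < ennreal e"
  proof -
    have "(\<integral>\<^sup>+x. ennreal ((cmod (f x + g x - (u x + v x)))\<^sup>2) \<partial>\<mu>)
     = (\<integral>\<^sup>+x. ennreal ((cmod ((f x - u x) + (g x - v x)))\<^sup>2) \<partial>\<mu>)" by (simp add: algebra_simps)
    also have "\<dots> \<le> 2 * (\<integral>\<^sup>+x. ennreal ((cmod (f x - u x))\<^sup>2) \<partial>\<mu>) + 2 * (\<integral>\<^sup>+x. ennreal ((cmod (g x - v x))\<^sup>2) \<partial>\<mu>)"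
      by (rule nn_integral_cmod_add_sq_le) measurable
    also have "\<dots> < 2 * ennreal (e / 4) + 2 * ennreal (e / 4)"
      using u(2) v(2) by (intro add_strict_mono ennreal_mult_strict_left_mono) auto
    also have "\<dots> = ennreal e"
      using e by (simp add: ennreal_mult'[symmetric] ennreal_plus[symmetric] flip: ennreal_numeral)
    finally show ?thesis .
  qed
  ultimately show "\<exists>n h. locally_constant n h \<and>
      (\<integral>\<^sup>+x. ennreal ((cmod (f x + g x - h x))\<^sup>2) \<partial>\<mu>) < ennreal e" by blast
qed

lemma approximable_sum:
  "(\<And>i. i \<in> I \<Longrightarrow> approximable (f i)) \<Longrightarrow> approximable (\<lambda>x. \<Sum>i\<in>I. f i x)"
proof (induction I rule: infinite_finite_induct)
  case (insert i I)
  then show ?case by (simp add: approximable_add)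
qed (auto intro!: approximable_locally_constant[of 0] simp: locally_constant_def)

text \<open>
  Dominated convergence turns pointwise limits into \<open>L\<^sup>2\<close>-limits, under which the closure is stable.
\<close>

lemma approximable_dominated_limit:
  assumes f: "\<And>i. approximable (f i)" and g [measurable]: "g \<in> borel_measurable \<mu>"
    and lim: "\<And>x. (\<lambda>i. f i x) \<longlonglongrightarrow> g x"
    and w [measurable]: "w \<in> borel_measurable \<mu>" and fw: "\<And>i x. cmod (f i x) \<le> w x"
    and fin: "(\<integral>\<^sup>+x. ennreal ((w x)\<^sup>2) \<partial>\<mu>) < \<infinity>"
  shows "approximable g"
proof (rule approximable_closed[OF g])
  fix e :: real assume e: "e > 0"
  note [measurable] = f[THEN approximable_measurable]
  have gw: "cmod (g x) \<le> w x" for x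
    by (rule LIMSEQ_le_const2[OF tendsto_norm[OF lim]]) (use fw in auto)
  have "(\<lambda>i. \<integral>\<^sup>+x. ennreal ((cmod (g x - f i x))\<^sup>2) \<partial>\<mu>) \<longlonglongrightarrow> (\<integral>\<^sup>+x. 0 \<partial>\<mu>)"
  proof (rule nn_integral_dominated_convergence[where w = "\<lambda>x. ennreal (4 * (w x)\<^sup>2)"])
    show "AE x in \<mu>. ennreal ((cmod (g x - f i x))\<^sup>2) \<le> ennreal (4 * (w x)\<^sup>2)" for i
    proof (intro AE_I2 ennreal_leI)
      fix x
      have "cmod (g x - f i x) \<le> 2 * w x" using norm_triangle_ineq4[of "g x" "f i x"] gw[of x] fw[of i x] by simp
      from power_mono[OF this, of 2] show "(cmod (g x - f i x))\<^sup>2 \<le> 4 * (w x)\<^sup>2" by (simp add: power_mult_distrib)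
    qed
    have "(\<integral>\<^sup>+x. ennreal (4 * (w x)\<^sup>2) \<partial>\<mu>) = 4 * (\<integral>\<^sup>+x. ennreal ((w x)\<^sup>2) \<partial>\<mu>)"
      by (simp add: ennreal_mult' nn_integral_cmult)
    then show "(\<integral>\<^sup>+x. ennreal (4 * (w x)\<^sup>2) \<partial>\<mu>) < \<infinity>" using fin by (simp add: ennreal_mult_less_top)
    show "AE x in \<mu>. (\<lambda>i. ennreal ((cmod (g x - f i x))\<^sup>2)) \<longlonglongrightarrow> 0"
    proof (intro AE_I2)
      fix x
      have "(\<lambda>i. ennreal ((cmod (g x - f i x))\<^sup>2)) \<longlonglongrightarrow> ennreal ((cmod (g x - g x))\<^sup>2)"
        by (intro tendsto_intros lim)
      then show "(\<lambda>i. ennreal ((cmod (g x - f i x))\<^sup>2)) \<longlonglongrightarrow> 0" by simp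
    qed
  qed measurable
  then have "(\<lambda>i. \<integral>\<^sup>+x. ennreal ((cmod (g x - f i x))\<^sup>2) \<partial>\<mu>) \<longlonglongrightarrow> 0" by simp
  from order_tendstoD(2)[OF this, of "ennreal e"] e
  obtain i where "(\<integral>\<^sup>+x. ennreal ((cmod (g x - f i x))\<^sup>2) \<partial>\<mu>) < ennreal e"
    by (auto simp: eventually_sequentially)
  then show "\<exists>g'. approximable g' \<and> (\<integral>\<^sup>+x. ennreal ((cmod (g x - g' x))\<^sup>2) \<partial>\<mu>) < ennreal e"
    using f by blast
qed

lemma approximable_cmult:
  assumes "approximable f" shows "approximable (\<lambda>x. c * f x)"
  unfolding approximable_def
proof (intro conjI allI impI)
  note [measurable] = assms[THEN approximable_measurable]
  show "(\<lambda>x. c * f x) \<in> borel_measurable \<mu>" by measurable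
  fix e :: real assume e: "e > 0"
  define d where "d = (cmod c)\<^sup>2 + 1"
  have d: "d > 0" "(cmod c)\<^sup>2 \<le> d" by (auto simp: d_def add_nonneg_pos)
  obtain n h where h: "locally_constant n h" "(\<integral>\<^sup>+x. ennreal ((cmod (f x - h x))\<^sup>2) \<partial>\<mu>) < ennreal (e / d)"
    using assms e d unfolding approximable_def by (meson zero_less_divide_iff)
  note [measurable] = locally_constant_measurable_mu[OF h(1)]
  have "(\<integral>\<^sup>+x. ennreal ((cmod (c * f x - c * h x))\<^sup>2) \<partial>\<mu>)
      \<le> (\<integral>\<^sup>+x. ennreal d * ennreal ((cmod (f x - h x))\<^sup>2) \<partial>\<mu>)"
    using d by (intro nn_integral_mono)
      (auto simp: right_diff_distrib[symmetric] norm_mult power_mult_distrib ennreal_mult'[symmetric] intro!: ennreal_leI mult_right_mono)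
  also have "\<dots> = ennreal d * (\<integral>\<^sup>+x. ennreal ((cmod (f x - h x))\<^sup>2) \<partial>\<mu>)" by (intro nn_integral_cmult) measurable
  also have "\<dots> < ennreal d * ennreal (e / d)" using d h(2) by (intro ennreal_mult_strict_left_mono) auto
  also have "\<dots> = ennreal e" using d by (simp add: ennreal_mult'[symmetric])
  finally show "\<exists>n h. locally_constant n h \<and> (\<integral>\<^sup>+x. ennreal ((cmod (c * f x - h x))\<^sup>2) \<partial>\<mu>) < ennreal e"
    using h(1) by (intro exI[of _ n] exI[of _ "\<lambda>x. c * h x"]) (auto simp: locally_constant_def)
qed

text \<open>
  The sets \<open>A\<close> with this property form a Dynkin system that contains the open sets: an open set \<open>S\<close> is
  the increasing union of the sets of points whose ball of radius \<open>p\<^sup>-\<^sup>i\<close> is contained in \<open>S\<close>, and these have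
  locally constant indicators. Intersecting with a fixed ball provides the integrable majorant.
\<close>

lemma approximable_indicator:
  assumes "A \<in> sets borel"
  shows "approximable (indicator (A \<inter> padic_cball 0 N))"
proof -
  let ?B = "padic_cball 0 N :: 'p padic set"
  have fin: "(\<integral>\<^sup>+x. ennreal ((indicator ?B x :: real)\<^sup>2) \<partial>\<mu>) < \<infinity>"
  proof -
    have "((indicator ?B x :: real)\<^sup>2) = indicator ?B x" for x by (simp add: indicator_def)
    then show ?thesis by (simp add: ennreal_indicator emeasure_cball)
  qed
  have B: "locally_constant N (indicator ?B :: _ \<Rightarrow> complex)"
    unfolding locally_constant_def
    using padic_cball_trans[of _ _ N 0] padic_cball_sym[of _ _ N] by (auto simp: indicator_def) 
  note limit = approximable_dominated_limit[where w = "indicator ?B", OF _ _ _ _ _ fin]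
  have "Int_stable {S :: 'p padic set. open S}" by (auto simp: Int_stable_def)
  moreover have "{S :: 'p padic set. open S} \<subseteq> Pow UNIV" by simp
  moreover have "A \<in> sigma_sets UNIV {S. open S}" using assms by (simp add: borel_def)
  ultimately show ?thesis
  proof (induction rule: sigma_sets_induct_disjoint)
    case (basic S)
    then have basic: "open S" by simp
    then have [measurable]: "S \<in> sets borel" by simp
    define f :: "nat \<Rightarrow> 'p padic \<Rightarrow> complex" where
      "f i = indicator ({x. padic_cball x (- int i) \<subseteq> S} \<inter> ?B)" for i
    show ?case
    proof (rule limit)
      show "approximable (f i)" for i
      proof (rule approximable_locally_constant)
        show "locally_constant (min N (- int i)) (f i)"
          unfolding locally_constant_def
        proof (intro allI ballI)
          fix x y :: "'p padic" assume y: "y \<in> padic_cball x (min N (- int i))"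
          have "y \<in> padic_cball x N" "y \<in> padic_cball x (- int i)"
            by (rule subsetD[OF padic_cball_mono y], simp)+
          then have "padic_cball y (- int i) = padic_cball x (- int i)" "y \<in> ?B \<longleftrightarrow> x \<in> ?B"
            using padic_cball_eq_of_mem padic_cball_trans padic_cball_sym by blast+
          then show "f i y = f i x" by (simp add: f_def indicator_def)
        qed
      qed
      show "indicator (S \<inter> ?B) \<in> borel_measurable \<mu>" using basic by measurable
      show "cmod (f i x) \<le> indicator ?B x" for i x by (auto simp: f_def indicator_def)
      show "(\<lambda>i. f i x) \<longlonglongrightarrow> indicator (S \<inter> ?B) x" for x
      proof (cases "x \<in> S")
        case True
        then obtain e where e: "e > 0" "\<And>y. dist y x < e \<Longrightarrow> y \<in> S" using basic by (auto simp: open_dist)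
        have "(\<lambda>i. inverse (real CARD('p)) ^ i) \<longlonglongrightarrow> 0"
          using real_CARD_gt_1[where 'p = 'p] by (intro LIMSEQ_power_zero) (auto simp: inverse_less_1_iff)
        then have "\<forall>\<^sub>F i in sequentially. inverse (real CARD('p)) ^ i < e" using e(1) by (rule order_tendstoD)
        then have "\<forall>\<^sub>F i in sequentially. f i x = indicator (S \<inter> ?B) x"
        proof eventually_elim
          case (elim i)
          have "padic_cball x (- int i) \<subseteq> S"
            using elim e(2) by (auto simp: mem_padic_cball dist_padic_def power_int_minus power_inverse)
          then show ?case by (simp add: f_def indicator_def True)
        qed
        then show ?thesis by (rule tendsto_eventually)
      next
        case False
        then have "\<not> padic_cball x (- int i) \<subseteq> S" for i using center_in_padic_cball by blast
        then show ?thesis using False by (simp add: f_def indicator_def)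
      qed
    qed measurable
  next
    case empty
    then show ?case by (intro approximable_locally_constant[of 0]) (simp add: locally_constant_def)
  next
    case (compl S)
    have "approximable (\<lambda>x. indicator ?B x + (- 1) * indicator (S \<inter> ?B) x)"
      by (intro approximable_add approximable_cmult compl(2) approximable_locally_constant[OF B])
    moreover have "(\<lambda>x. indicator ?B x + (- 1) * indicator (S \<inter> ?B) x) = (indicator ((UNIV - S) \<inter> ?B) :: _ \<Rightarrow> complex)"
      by (auto simp: indicator_def)
    ultimately show ?case by simp
  next
    case (union S)
    define f :: "nat \<Rightarrow> 'p padic \<Rightarrow> complex" where "f n x = (\<Sum>i<n. indicator (S i \<inter> ?B) x)" for n x
    have S [measurable]: "S i \<in> sets borel" for i using union(2) by (auto simp: borel_def)
    have dis: "disjoint_family (\<lambda>i. S i \<inter> ?B)" using union(1) by (auto simp: disjoint_family_on_def)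
    have feq: "f n x = indicator (\<Union>i<n. S i \<inter> ?B) x" for n x
      unfolding f_def using dis by (intro indicator_UN_disjoint[symmetric]) (auto simp: disjoint_family_on_def)
    show ?case
    proof (rule limit)
      show "approximable (f i)" for i unfolding f_def by (intro approximable_sum union(3))
      show "indicator (\<Union> (range S) \<inter> ?B) \<in> borel_measurable \<mu>" by measurable
      show "cmod (f i x) \<le> indicator ?B x" for i x unfolding feq by (auto simp: indicator_def)
      show "(\<lambda>i. f i x) \<longlonglongrightarrow> indicator (\<Union> (range S) \<inter> ?B) x" for x
      proof (cases "x \<in> \<Union> (range S) \<inter> ?B")
        case True
        then obtain j where j: "x \<in> S j \<inter> ?B" by auto
        have "\<forall>\<^sub>F n in sequentially. f n x = indicator (\<Union> (range S) \<inter> ?B) x"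
          using eventually_gt_at_top[of j] by eventually_elim (use j in \<open>auto simp: feq indicator_def\<close>)
        then show ?thesis by (rule tendsto_eventually)
      next
        case False
        then have "f n x = 0" for n by (auto simp: feq indicator_def)
        then show ?thesis using False by simp
      qed
    qed measurable
  qed
qed

text \<open>
  Simple functions that converge to \<open>g\<close> and are bounded by \<open>2|g|\<close> are cut off to growing balls, which
  makes them finite combinations of the indicators of \<open>approximable_indicator\<close>.
\<close>

lemma approximable_square_integrable:
  assumes "square_integrable \<mu> g" shows "approximable g"
proof -
  have g [measurable]: "g \<in> borel_measurable \<mu>" and i: "integrable \<mu> (\<lambda>x. (cmod (g x))\<^sup>2)"
    using assms by (auto simp: square_integrable_def)
  obtain s where s: "\<And>i. simple_function \<mu> (s i)" "\<And>x. (\<lambda>i. s i x) \<longlonglongrightarrow> g x"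
      "\<And>i x. dist (s i x) 0 \<le> 2 * dist (g x) 0"
    using borel_measurable_implies_sequence_metric[OF g, of 0] by auto
  define f where "f i x = s i x * indicator (padic_cball 0 (int i)) x" for i x
  show ?thesis
  proof (rule approximable_dominated_limit[where w = "\<lambda>x. 2 * cmod (g x)"])
    show "approximable (f i)" for i
    proof -
      have rep: "s i x = (\<Sum>y\<in>range (s i). y * indicator (s i -` {y}) x)" for x
        by (subst simple_function_indicator_representation_banach[OF s(1)])
          (auto simp: indicator_def intro!: sum.cong)
      have "f i = (\<lambda>x. \<Sum>y\<in>range (s i). y * indicator (s i -` {y} \<inter> padic_cball 0 (int i)) x)"
      proof
        fix x
        have "f i x = (\<Sum>y\<in>range (s i). y * indicator (s i -` {y}) x) * indicator (padic_cball 0 (int i)) x"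
          unfolding f_def by (rule arg_cong2[where f = "(*)", OF rep refl])
        then show "f i x = (\<Sum>y\<in>range (s i). y * indicator (s i -` {y} \<inter> padic_cball 0 (int i)) x)"
          by (simp only: sum_distrib_right indicator_inter_arith mult.assoc)
      qed
      moreover have "s i -` {y} \<in> sets borel" for y
        using simple_functionD(2)[OF s(1), of i "{y}"] by simp
      ultimately show ?thesis by (auto intro!: approximable_sum approximable_cmult approximable_indicator)
    qed
    show "(\<lambda>i. f i x) \<longlonglongrightarrow> g x" for x
    proof -
      obtain n where n: "\<And>i. i \<ge> n \<Longrightarrow> x \<in> padic_cball 0 (int i)" using eventually_in_padic_cball by blast
      have "\<forall>\<^sub>F i in sequentially. s i x = f i x"
        using eventually_ge_at_top[of n] by eventually_elim (simp add: f_def n)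
      then show ?thesis using s(2)[of x] by (rule Lim_transform_eventually[rotated])
    qed
    show "cmod (f i x) \<le> 2 * cmod (g x)" for i x
      using s(3)[of i x] by (auto simp: f_def indicator_def)
    have "(\<integral>\<^sup>+x. ennreal ((2 * cmod (g x))\<^sup>2) \<partial>\<mu>) = ennreal (\<integral>x. (2 * cmod (g x))\<^sup>2 \<partial>\<mu>)"
      using i by (intro nn_integral_eq_integral) (auto simp: power_mult_distrib)
    then show "(\<integral>\<^sup>+x. ennreal ((2 * cmod (g x))\<^sup>2) \<partial>\<mu>) < \<infinity>" by simp
  qed (rule g, measurable)
qed

end


section \<open>Energy of a function on a ball\<close>

context padic_haar
begin

text \<open>
  The squared norm of the orthogonal projection of \<open>g\<close> to the multiples of the indicator of \<open>B\<close>.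
  Consequently \<open>detail_energy g B\<close> is the squared norm of the projection to the functions related
  to \<open>B\<close>.
\<close>

definition energy :: "('p padic \<Rightarrow> complex) \<Rightarrow> 'p padic set \<Rightarrow> real" where
  "energy g B = (cmod (\<integral>x. g x * indicator B x \<partial>\<mu>))\<^sup>2 / measure \<mu> B"

definition detail_energy :: "('p padic \<Rightarrow> complex) \<Rightarrow> 'p padic set \<Rightarrow> real" where
  "detail_energy g B = (\<Sum>C\<in>maximal_subballs B. energy g C) - energy g B"

lemma integrable_on_cball:
  assumes "square_integrable \<mu> g"
  shows "integrable \<mu> (\<lambda>x. g x * indicator (padic_cball a k) x)"
proof (rule Bochner_Integration.integrable_bound)
  have [measurable]: "g \<in> borel_measurable \<mu>" using assms by (simp add: square_integrable_def)
  show "(\<lambda>x. g x * indicator (padic_cball a k) x) \<in> borel_measurable \<mu>" by measurable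
  show "integrable \<mu> (\<lambda>x. (cmod (g x))\<^sup>2 + indicator (padic_cball a k) x)"
    using assms by (simp add: square_integrable_def)
  have "t \<le> t\<^sup>2 + 1" for t :: real using zero_le_power2[of "t - 1 / 2"] by (simp add: power2_diff power_divide)
  then show "AE x in \<mu>. norm (g x * indicator (padic_cball a k) x) \<le> norm ((cmod (g x))\<^sup>2 + indicator (padic_cball a k) x)"
    by (intro AE_I2) (auto simp: indicator_def norm_mult)
qed

lemma integrable_sq_on:
  assumes "square_integrable \<mu> g" "B \<in> sets borel"
  shows "integrable \<mu> (\<lambda>x. (cmod (g x))\<^sup>2 * indicator B x)"
  using assms by (intro integrable_real_mult_indicator) (auto simp: square_integrable_def)

lemma integral_sq_on_diff:
  assumes g: "square_integrable \<mu> g"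
  shows "(\<integral>x. (cmod (g x - c))\<^sup>2 * indicator (padic_cball a k) x \<partial>\<mu>) =
    (\<integral>x. (cmod (g x))\<^sup>2 * indicator (padic_cball a k) x \<partial>\<mu>)
    - 2 * Re (cnj c * (\<integral>x. g x * indicator (padic_cball a k) x \<partial>\<mu>)) + (cmod c)\<^sup>2 * measure \<mu> (padic_cball a k)"
proof -
  let ?B = "padic_cball a k"
  have sq: "(cmod (z - c))\<^sup>2 = (cmod z)\<^sup>2 - 2 * Re (cnj c * z) + (cmod c)\<^sup>2" for z
    unfolding cmod_power2 by (simp add: power2_eq_square algebra_simps)
  have "(\<integral>x. (cmod (g x - c))\<^sup>2 * indicator ?B x \<partial>\<mu>) =
    (\<integral>x. (cmod (g x))\<^sup>2 * indicator ?B x - 2 * Re (cnj c * (g x * indicator ?B x)) + (cmod c)\<^sup>2 * indicator ?B x \<partial>\<mu>)"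
    by (intro Bochner_Integration.integral_cong refl) (auto simp: sq indicator_def)
  also have "\<dots> = (\<integral>x. (cmod (g x))\<^sup>2 * indicator ?B x \<partial>\<mu>)
      - 2 * Re (cnj c * (\<integral>x. g x * indicator ?B x \<partial>\<mu>)) + (cmod c)\<^sup>2 * measure \<mu> ?B"
  proof -
    define w where "w x = g x * indicator ?B x" for x
    have w: "integrable \<mu> (\<lambda>x. cnj c * w x)"
      using integrable_on_cball[OF g, of a k] unfolding w_def by (rule integrable_mult_right)
    have i: "integrable \<mu> (\<lambda>x. (cmod (g x))\<^sup>2 * indicator ?B x)"
        "integrable \<mu> (\<lambda>x. 2 * Re (cnj c * w x))" "integrable \<mu> (\<lambda>x. (cmod c)\<^sup>2 * indicator ?B x)"
      using integrable_sq_on[OF g, of ?B] integrable_mult_right[OF integrable_Re[OF w], of 2] by auto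
    have "(\<integral>x. 2 * Re (cnj c * w x) \<partial>\<mu>) = 2 * Re (cnj c * (\<integral>x. w x \<partial>\<mu>))"
      by (simp only: integral_mult_right_zero integral_Re[OF w])
    moreover have "(\<integral>x. (cmod c)\<^sup>2 * indicator ?B x \<partial>\<mu>) = (cmod c)\<^sup>2 * measure \<mu> ?B" by simp
    ultimately show ?thesis
      unfolding w_def[symmetric]
      by (simp only: Bochner_Integration.integral_add[OF Bochner_Integration.integrable_diff[OF i(1,2)] i(3)]
          Bochner_Integration.integral_diff[OF i(1,2)])
  qed
  finally show ?thesis .
qed

text \<open>
  Choose \<open>c\<close> in \<open>integral_sq_on_diff\<close> to be the mean of \<open>g\<close> over the ball.
\<close>

lemma energy_le:
  assumes g: "square_integrable \<mu> g"
  shows "energy g (padic_cball a k) \<le> (\<integral>x. (cmod (g x))\<^sup>2 * indicator (padic_cball a k) x \<partial>\<mu>)"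
proof -
  define v where "v = real CARD('p) powi k"
  define I where "I = (\<integral>x. g x * indicator (padic_cball a k) x \<partial>\<mu>)"
  have v: "v > 0" by (simp add: v_def)
  have "0 \<le> (\<integral>x. (cmod (g x - I / of_real v))\<^sup>2 * indicator (padic_cball a k) x \<partial>\<mu>)"
    by (intro Bochner_Integration.integral_nonneg) simp
  also have "\<dots> = (\<integral>x. (cmod (g x))\<^sup>2 * indicator (padic_cball a k) x \<partial>\<mu>)
     - 2 * Re (cnj (I / of_real v) * I) + (cmod (I / of_real v))\<^sup>2 * v"
    unfolding integral_sq_on_diff[OF g] by (simp add: I_def v_def)
  also have "cnj (I / of_real v) * I = of_real ((cmod I)\<^sup>2 / v)"
    using complex_norm_square[of I] by (simp add: mult.commute)
  also have "(cmod (I / of_real v))\<^sup>2 * v = (cmod I)\<^sup>2 / v"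
    using v by (simp add: norm_divide power_divide power2_eq_square)
  finally have "(cmod I)\<^sup>2 / v \<le> (\<integral>x. (cmod (g x))\<^sup>2 * indicator (padic_cball a k) x \<partial>\<mu>)"
    unfolding Re_complex_of_real by simp
  then show ?thesis by (simp add: energy_def I_def v_def)
qed

text \<open>
  The mean minimises the quadratic mean distance from a constant; the difference between the two
  sides is \<open>|\<integral>\<^sub>B g - \<mu>(B) c|\<^sup>2 / \<mu>(B)\<close>.
\<close>

lemma energy_ge:
  assumes g: "square_integrable \<mu> g"
  shows "(\<integral>x. (cmod (g x))\<^sup>2 * indicator (padic_cball a k) x \<partial>\<mu>)
    - (\<integral>x. (cmod (g x - c))\<^sup>2 * indicator (padic_cball a k) x \<partial>\<mu>) \<le> energy g (padic_cball a k)"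
proof -
  define v where "v = real CARD('p) powi k"
  define I where "I = (\<integral>x. g x * indicator (padic_cball a k) x \<partial>\<mu>)"
  have v: "v > 0" by (simp add: v_def)
  have "0 \<le> (cmod (I - of_real v * c))\<^sup>2 / v" using v by simp
  also have "(cmod (I - of_real v * c))\<^sup>2 = (cmod I)\<^sup>2 - 2 * v * Re (cnj c * I) + v\<^sup>2 * (cmod c)\<^sup>2"
    unfolding cmod_power2 by (simp add: power2_eq_square algebra_simps)
  also have "\<dots> / v = (cmod I)\<^sup>2 / v - 2 * Re (cnj c * I) + (cmod c)\<^sup>2 * v"
    using v by (simp add: field_simps power2_eq_square)
  finally show ?thesis
    unfolding integral_sq_on_diff[OF g] by (simp add: energy_def I_def[symmetric] v_def)
qed

lemma l2_inner_ball_wavelet: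
  assumes g: "square_integrable \<mu> g"
  shows "l2_inner \<mu> g (ball_wavelet a k \<sigma>) = of_real (real CARD('p) powr (- real_of_int k / 2)) *
    (\<Sum>j<CARD('p). (\<integral>x. g x * indicator (subball a k j) x \<partial>\<mu>) * cnj (root_unity CARD('p) (\<sigma> j)))"
proof -
  let ?s = "complex_of_real (real CARD('p) powr (- real_of_int k / 2))"
  have "g x * cnj (ball_wavelet a k \<sigma> x) =
     (\<Sum>j<CARD('p). ?s * cnj (root_unity CARD('p) (\<sigma> j)) * (g x * indicator (subball a k j) x))" for x
    unfolding ball_wavelet_eq_sum cnj_sum sum_distrib_left
    by (intro sum.cong refl) (auto simp: indicator_def)
  then have "l2_inner \<mu> g (ball_wavelet a k \<sigma>) =
     (\<Sum>j<CARD('p). \<integral>x. ?s * cnj (root_unity CARD('p) (\<sigma> j)) * (g x * indicator (subball a k j) x) \<partial>\<mu>)"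
    unfolding l2_inner_def
    using integrable_on_cball[OF g] by (simp only:) (intro Bochner_Integration.integral_sum integrable_mult_right, simp add: subball_def)
  then show ?thesis by (simp only: integral_mult_right_zero sum_distrib_left) (simp only: mult_ac)
qed

text \<open>
  Needed since the orbit is a set: distinct permutations give distinct functions, so that sums over
  the wavelets of a ball are sums over permutations.
\<close>

lemma inj_on_ball_wavelet: "inj_on (ball_wavelet (a :: 'p padic) k) {\<sigma>. \<sigma> permutes {..<CARD('p)}}"
proof (rule inj_onI, rule ext)
  fix \<sigma> \<tau> j assume \<sigma>\<tau>: "\<sigma> \<in> {\<sigma>. \<sigma> permutes {..<CARD('p)}}" "\<tau> \<in> {\<sigma>. \<sigma> permutes {..<CARD('p)}}"
    and eq: "ball_wavelet a k \<sigma> = ball_wavelet a k \<tau>"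
  then have perm: "\<sigma> permutes {..<CARD('p)}" "\<tau> permutes {..<CARD('p)}" by auto
  show "\<sigma> j = \<tau> j"
  proof (cases "j < CARD('p)")
    case True
    define x where "x = a + of_nat j * of_nat CARD('p) powi (- k)"
    have "x \<in> subball a k j" unfolding x_def by (rule center_in_subball)
    then have "x \<in> padic_cball a k" "rel_digit a k x = j" using True by (auto simp: mem_subball)
    then have "root_unity CARD('p) (\<sigma> j) = root_unity CARD('p) (\<tau> j)"
      using fun_cong[OF eq, of x] by (simp add: ball_wavelet_def)
    moreover have "\<sigma> j < CARD('p)" "\<tau> j < CARD('p)"
      using permutes_in_image[OF perm(1), of j] permutes_in_image[OF perm(2), of j] True by auto
    ultimately show ?thesis using inj_onD[OF inj_on_root_unity[of "CARD('p)"], of "\<sigma> j" "\<tau> j"] by simp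
  next
    case False
    then show ?thesis using perm by (simp add: permutes_def)
  qed
qed

definition frame_bound :: real where
  "frame_bound = fact CARD('p) / (real CARD('p) - 1)"

lemma frame_bound_pos: "frame_bound > 0"
  using real_CARD_gt_1[where 'p = 'p] by (simp add: frame_bound_def)

text \<open>
  The tight frame identity for a single ball: \<open>sum_permutations_cmod2\<close> applied to the integrals of
  \<open>g\<close> over the maximal subballs, whose measure is \<open>1/p\<close> times that of the ball.
\<close>

lemma sum_ball_wavelets:
  assumes g: "square_integrable \<mu> g" and B: "padic_ball B"
  shows "finite (ball_wavelets \<mu> B)"
    "(\<Sum>f\<in>ball_wavelets \<mu> B. (cmod (l2_inner \<mu> g f))\<^sup>2) = frame_bound * detail_energy g B"
proof -
  obtain a k where B: "B = padic_cball a k" using B by (auto simp: padic_ball_iff)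
  have W: "ball_wavelets \<mu> B = ball_wavelet a k ` {\<sigma>. \<sigma> permutes {..<CARD('p)}}"
    unfolding B ball_wavelets_cball by blast
  show "finite (ball_wavelets \<mu> B)" unfolding W by (simp add: finite_permutations)
  define J where "J j = (\<integral>x. g x * indicator (subball a k j) x \<partial>\<mu>)" for j
  have sumJ: "(\<Sum>j<CARD('p). J j) = (\<integral>x. g x * indicator B x \<partial>\<mu>)"
  proof -
    have "(\<Sum>j<CARD('p). J j) = (\<integral>x. (\<Sum>j<CARD('p). g x * indicator (subball a k j) x) \<partial>\<mu>)"
      unfolding J_def subball_def by (intro Bochner_Integration.integral_sum[symmetric] integrable_on_cball g)
    also have "\<dots> = (\<integral>x. g x * indicator B x \<partial>\<mu>)"
    proof (intro Bochner_Integration.integral_cong refl)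
      fix x
      have "(indicator (\<Union>j<CARD('p). subball a k j) x :: complex) = (\<Sum>j<CARD('p). indicator (subball a k j) x)"
        by (intro indicator_UN_disjoint) (auto simp: disjoint_family_on_def subball_disjoint)
      then show "(\<Sum>j<CARD('p). g x * indicator (subball a k j) x) = g x * indicator B x"
        by (simp add: UN_subball B sum_distrib_left)
    qed
    finally show ?thesis .
  qed
  have "(\<Sum>f\<in>ball_wavelets \<mu> B. (cmod (l2_inner \<mu> g f))\<^sup>2)
     = (\<Sum>\<sigma> | \<sigma> permutes {..<CARD('p)}. (cmod (l2_inner \<mu> g (ball_wavelet a k \<sigma>)))\<^sup>2)"
    unfolding W by (subst sum.reindex[OF inj_on_ball_wavelet]) simp
  also have "\<dots> = (\<Sum>\<sigma> | \<sigma> permutes {..<CARD('p)}. real CARD('p) powi (- k) *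
        (cmod (\<Sum>j<CARD('p). J j * cnj (root_unity CARD('p) (\<sigma> j))))\<^sup>2)"
    unfolding l2_inner_ball_wavelet[OF g] norm_mult power_mult_distrib J_def[symmetric]
    using scale_factor_sq[where 'p = 'p, of k] by simp
  also have "\<dots> = real CARD('p) powi (- k) * (frame_bound * (real CARD('p) * (\<Sum>j<CARD('p). (cmod (J j))\<^sup>2) - (cmod (\<Sum>j<CARD('p). J j))\<^sup>2))"
    unfolding sum_distrib_left[symmetric] sum_permutations_cmod2[OF CARD_prime_gt_1[where 'p = 'p]] frame_bound_def ..
  also have "\<dots> = frame_bound * ((\<Sum>j<CARD('p). (cmod (J j))\<^sup>2 / real CARD('p) powi (k - 1)) - energy g B)"
  proof -
    have "real CARD('p) powi (- k) * (real CARD('p) * S - T) = S / real CARD('p) powi (k - 1) - T / real CARD('p) powi k"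
      for S T by (simp add: power_int_diff power_int_minus field_simps)
    then show ?thesis
      by (simp only: energy_def sumJ B measure_cball sum_divide_distrib[symmetric] mult.left_commute[of _ frame_bound])
  qed
  also have "(\<Sum>j<CARD('p). (cmod (J j))\<^sup>2 / real CARD('p) powi (k - 1)) = (\<Sum>C\<in>maximal_subballs B. energy g C)"
    unfolding B maximal_subballs_cball by (subst sum.reindex[OF inj_on_subball]) (simp add: energy_def J_def subball_def)
  finally show "(\<Sum>f\<in>ball_wavelets \<mu> B. (cmod (l2_inner \<mu> g f))\<^sup>2) = frame_bound * detail_energy g B"
    by (simp add: detail_energy_def)
qed

text \<open>
  Up to a positive factor it is a sum of squares.
\<close>

lemma detail_energy_nonneg:
  assumes "square_integrable \<mu> g" "padic_ball B"
  shows "detail_energy g B \<ge> 0"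
proof -
  have "0 \<le> frame_bound * detail_energy g B"
    unfolding sum_ball_wavelets(2)[OF assms, symmetric] by (intro sum_nonneg) simp
  then show ?thesis using frame_bound_pos by (simp add: zero_le_mult_iff)
qed

end

section \<open>Telescoping over generations of subballs\<close>

text \<open>
  The balls contained in the ball of exponent \<open>N\<close> about zero that are \<open>r\<close> generations below it.
\<close>

definition descendants :: "int \<Rightarrow> nat \<Rightarrow> 'p::prime_card padic set set" where
  "descendants N r = (\<lambda>a. padic_cball a (N - int r)) ` padic_cball 0 N"

lemma descendants_0: "descendants N 0 = {padic_cball 0 N}"
  using padic_cball_eq_of_mem by (fastforce simp: descendants_def image_iff intro: bexI[of _ 0])

lemma descendants_Suc: "descendants N (Suc r) = (\<Union>B\<in>descendants N r. maximal_subballs (B :: 'p::prime_card padic set))"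
proof (intro set_eqI iffI)
  fix C :: "'p padic set" assume "C \<in> descendants N (Suc r)"
  then obtain a where a: "a \<in> padic_cball 0 N" "C = padic_cball a (N - int r - 1)"
    by (auto simp: descendants_def algebra_simps)
  define j where "j = rel_digit a (N - int r) a"
  have "j < CARD('p)" unfolding j_def by (rule rel_digit_less) simp
  moreover from this have "a \<in> subball a (N - int r) j" by (simp add: mem_subball j_def)
  then have "C = subball a (N - int r) j" unfolding a(2) subball_def by (rule padic_cball_eq_of_mem)
  ultimately have "C \<in> maximal_subballs (padic_cball a (N - int r))" by (simp add: maximal_subballs_cball)
  then show "C \<in> (\<Union>B\<in>descendants N r. maximal_subballs B)" using a(1) by (auto simp: descendants_def)
next
  fix C :: "'p padic set" assume "C \<in> (\<Union>B\<in>descendants N r. maximal_subballs B)"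
  then obtain a j where a: "a \<in> padic_cball 0 N" "j < CARD('p)" "C = subball a (N - int r) j"
    by (auto simp: descendants_def maximal_subballs_cball)
  define c where "c = a + of_nat j * of_nat CARD('p) powi (- (N - int r))"
  have "c \<in> subball a (N - int r) j" unfolding c_def by (rule center_in_subball)
  then have "c \<in> padic_cball a (N - int r)" using a(2) by (simp add: mem_subball)
  then have "c \<in> padic_cball a N" by (rule subsetD[OF padic_cball_mono, rotated]) simp
  then have "c \<in> padic_cball 0 N" using a(1) by (rule padic_cball_trans)
  moreover have "C = padic_cball c (N - int (Suc r))" by (simp add: a(3) subball_def c_def algebra_simps)
  ultimately show "C \<in> descendants N (Suc r)" by (auto simp: descendants_def)
qed

lemma finite_maximal_subballs: "padic_ball B \<Longrightarrow> finite (maximal_subballs (B :: 'p::prime_card padic set))"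
  by (auto simp: padic_ball_iff maximal_subballs_cball)

lemma descendants_ball: "B \<in> descendants N r \<Longrightarrow> padic_ball B"
  by (auto simp: descendants_def)

lemma finite_descendants: "finite (descendants N r :: 'p::prime_card padic set set)"
  by (induction r) (auto simp: descendants_0 descendants_Suc intro!: finite_maximal_subballs descendants_ball)

lemma descendants_disjoint_levels:
  "r \<noteq> s \<Longrightarrow> descendants N r \<inter> (descendants N s :: 'p::prime_card padic set set) = {}"
  by (auto simp: descendants_def padic_cball_eq_iff)

lemma sum_descendants_Suc:
  fixes F :: "'p::prime_card padic set \<Rightarrow> 'a::comm_monoid_add"
  shows "sum F (descendants N (Suc r)) = (\<Sum>B\<in>descendants N r. \<Sum>C\<in>maximal_subballs B. F C)"
  unfolding descendants_Suc
proof (rule sum.UNION_disjoint)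
  show "\<forall>B\<in>descendants N r. \<forall>B'\<in>descendants N r. B \<noteq> B' \<longrightarrow> maximal_subballs B \<inter> maximal_subballs (B' :: 'p padic set) = {}"
  proof (intro ballI impI)
    fix B B' :: "'p padic set" assume B: "B \<in> descendants N r" "B' \<in> descendants N r" "B \<noteq> B'"
    then have dis: "B \<inter> B' = {}" by (auto simp: descendants_def dest!: padic_cball_disjoint)
    have "False" if "C \<in> maximal_subballs B" "C \<in> maximal_subballs B'" for C
    proof -
      have "C \<subseteq> B \<inter> B'" "padic_ball C" using that by (auto simp: maximal_subballs_def)
      then show False using dis by (auto simp: padic_ball_iff dest: subsetD[OF _ center_in_padic_cball])
    qed
    then show "maximal_subballs B \<inter> maximal_subballs B' = {}" by blast
  qed
qed (auto intro: finite_descendants finite_maximal_subballs descendants_ball)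

context padic_haar
begin

lemma sum_descendants_detail_energy:
  "(\<Sum>i<r. \<Sum>B\<in>descendants N i. detail_energy g B) = (\<Sum>C\<in>descendants N r. energy g C) - energy g (padic_cball 0 N)"
proof (induction r)
  case (Suc r)
  have "(\<Sum>B\<in>descendants N r. detail_energy g B) = (\<Sum>C\<in>descendants N (Suc r). energy g C) - (\<Sum>B\<in>descendants N r. energy g B)"
    by (simp add: detail_energy_def sum_subtractf sum_descendants_Suc)
  then show ?case using Suc by simp
qed (simp add: descendants_0)

lemma sum_descendants_integral:
  fixes F :: "'p padic \<Rightarrow> real"
  assumes F: "integrable \<mu> F"
  shows "(\<Sum>C\<in>descendants N r. \<integral>x. F x * indicator C x \<partial>\<mu>) = (\<integral>x. F x * indicator (padic_cball 0 N) x \<partial>\<mu>)"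
proof -
  have ind: "(\<Sum>C\<in>descendants N r. indicator C x) = (indicator (padic_cball 0 N) x :: real)" for x :: "'p padic"
  proof (induction r)
    case (Suc r)
    have "(\<Sum>C\<in>maximal_subballs B. indicator C x) = (indicator B x :: real)" if Bd: "B \<in> descendants N r" for B
    proof -
      obtain a k where B: "B = padic_cball a k" using descendants_ball[OF Bd] by (auto simp: padic_ball_iff)
      have "(indicator (\<Union>j<CARD('p). subball a k j) x :: real) = (\<Sum>j<CARD('p). indicator (subball a k j) x)"
        by (intro indicator_UN_disjoint) (auto simp: disjoint_family_on_def mem_subball)
      then show ?thesis unfolding B maximal_subballs_cball
        by (subst sum.reindex[OF inj_on_subball]) (simp add: UN_subball)
    qed
    then show ?case by (simp add: sum_descendants_Suc Suc)
  qed (simp add: descendants_0)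
  have "(\<Sum>C\<in>descendants N r. \<integral>x. F x * indicator C x \<partial>\<mu>) = (\<integral>x. (\<Sum>C\<in>descendants N r. F x * indicator C x) \<partial>\<mu>)"
    by (intro Bochner_Integration.integral_sum[symmetric] integrable_real_mult_indicator F)
      (auto simp: descendants_def)
  also have "\<dots> = (\<integral>x. F x * indicator (padic_cball 0 N) x \<partial>\<mu>)"
    by (simp add: sum_distrib_left[symmetric] ind)
  finally show ?thesis .
qed

lemma l2_norm_sq: "(l2_norm \<mu> g)\<^sup>2 = (\<integral>x. (cmod (g x))\<^sup>2 \<partial>\<mu>)"
  unfolding l2_norm_def by (intro real_sqrt_pow2 Bochner_Integration.integral_nonneg) simp

lemma integral_sq_on_mono:
  assumes g: "square_integrable \<mu> g" and "A \<in> sets borel"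
  shows "(\<integral>x. (cmod (g x))\<^sup>2 * indicator A x \<partial>\<mu>) \<le> (\<integral>x. (cmod (g x))\<^sup>2 \<partial>\<mu>)"
  using g integrable_sq_on[OF assms] unfolding square_integrable_def
  by (intro integral_mono) (auto simp: indicator_def)

lemma integral_sq_on_cball_tendsto:
  assumes g: "square_integrable \<mu> g"
  shows "(\<lambda>N. \<integral>x. (cmod (g x))\<^sup>2 * indicator (padic_cball 0 (int N)) x \<partial>\<mu>) \<longlonglongrightarrow> (\<integral>x. (cmod (g x))\<^sup>2 \<partial>\<mu>)"
proof (rule integral_dominated_convergence)
  show "integrable \<mu> (\<lambda>x. (cmod (g x))\<^sup>2)" using g by (simp add: square_integrable_def)
  show "AE x in \<mu>. (\<lambda>N. (cmod (g x))\<^sup>2 * indicator (padic_cball 0 (int N)) x) \<longlonglongrightarrow> (cmod (g x))\<^sup>2"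
  proof (intro AE_I2)
    fix x :: "'p padic"
    obtain n where n: "\<And>i. i \<ge> n \<Longrightarrow> x \<in> padic_cball 0 (int i)" using eventually_in_padic_cball by blast
    have "\<forall>\<^sub>F N in sequentially. (cmod (g x))\<^sup>2 * indicator (padic_cball 0 (int N)) x = (cmod (g x))\<^sup>2"
      using eventually_ge_at_top[of n] by eventually_elim (simp add: n)
    then show "(\<lambda>N. (cmod (g x))\<^sup>2 * indicator (padic_cball 0 (int N)) x) \<longlonglongrightarrow> (cmod (g x))\<^sup>2"
      by (rule tendsto_eventually)
  qed
  have [measurable]: "g \<in> borel_measurable \<mu>" using g by (simp add: square_integrable_def)
  show "(\<lambda>x. (cmod (g x))\<^sup>2) \<in> borel_measurable \<mu>" by measurable
  show "(\<lambda>x. (cmod (g x))\<^sup>2 * indicator (padic_cball 0 (int N)) x) \<in> borel_measurable \<mu>" for N by measurable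
qed (auto simp: indicator_def)

text \<open>
  Split \<open>g\<close> at a fixed ball outside which little of its norm remains. The integral over the fixed
  ball does not change as \<open>N\<close> grows while the measure tends to infinity, and the energy of the remainder \<open>u\<close> is
  at most its squared norm.
\<close>

lemma energy_big_cball_small:
  assumes g: "square_integrable \<mu> g" and e: "e > 0"
  shows "\<forall>\<^sub>F N in sequentially. energy g (padic_cball 0 (int N)) < e"
proof -
  have "\<forall>\<^sub>F M in sequentially. (\<integral>x. (cmod (g x))\<^sup>2 * indicator (padic_cball 0 (int M)) x \<partial>\<mu>) > (\<integral>x. (cmod (g x))\<^sup>2 \<partial>\<mu>) - e / 4"
    using e by (intro order_tendstoD(1)[OF integral_sq_on_cball_tendsto[OF g]]) simp
  then obtain M :: nat where M: "(\<integral>x. (cmod (g x))\<^sup>2 * indicator (padic_cball 0 (int M)) x \<partial>\<mu>) > (\<integral>x. (cmod (g x))\<^sup>2 \<partial>\<mu>) - e / 4"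
    by (auto simp: eventually_sequentially)
  let ?A = "padic_cball 0 (int M) :: 'p padic set"
  define u where "u x = g x * indicator (- ?A) x" for x
  define I where "I = (\<integral>x. g x * indicator ?A x \<partial>\<mu>)"
  have [measurable]: "g \<in> borel_measurable \<mu>" using g by (simp add: square_integrable_def)
  have usq: "(cmod (u x))\<^sup>2 = (cmod (g x))\<^sup>2 * indicator (- ?A) x" for x by (simp add: u_def indicator_def)
  have u: "square_integrable \<mu> u"
    unfolding square_integrable_def usq
    using integrable_sq_on[OF g, of "- ?A"] by (auto simp: u_def[abs_def])
  have "(\<integral>x. (cmod (u x))\<^sup>2 \<partial>\<mu>) = (\<integral>x. (cmod (g x))\<^sup>2 - (cmod (g x))\<^sup>2 * indicator ?A x \<partial>\<mu>)"
    unfolding usq by (intro Bochner_Integration.integral_cong) (auto simp: indicator_def)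
  also have "\<dots> = (\<integral>x. (cmod (g x))\<^sup>2 \<partial>\<mu>) - (\<integral>x. (cmod (g x))\<^sup>2 * indicator ?A x \<partial>\<mu>)"
    using g integrable_sq_on[OF g, of ?A] by (simp add: square_integrable_def)
  finally have tail: "(\<integral>x. (cmod (u x))\<^sup>2 \<partial>\<mu>) < e / 4" using M by simp
  have le: "energy g (padic_cball 0 (int N)) \<le> 2 * (cmod I)\<^sup>2 * inverse (real CARD('p)) ^ N + e / 2" if "N \<ge> M" for N
  proof -
    let ?B = "padic_cball 0 (int N) :: 'p padic set"
    have "?A \<subseteq> ?B" using that by (intro padic_cball_mono) simp
    then have "(\<integral>x. g x * indicator ?B x \<partial>\<mu>) = (\<integral>x. g x * indicator ?A x + u x * indicator ?B x \<partial>\<mu>)"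
      by (intro Bochner_Integration.integral_cong) (auto simp: u_def indicator_def)
    also have "\<dots> = I + (\<integral>x. u x * indicator ?B x \<partial>\<mu>)"
      unfolding I_def by (intro Bochner_Integration.integral_add integrable_on_cball g u)
    finally have "(cmod (\<integral>x. g x * indicator ?B x \<partial>\<mu>))\<^sup>2 \<le> 2 * (cmod I)\<^sup>2 + 2 * (cmod (\<integral>x. u x * indicator ?B x \<partial>\<mu>))\<^sup>2"
      by (simp add: cmod_add_sq_le)
    then have "energy g ?B \<le> (2 * (cmod I)\<^sup>2 + 2 * (cmod (\<integral>x. u x * indicator ?B x \<partial>\<mu>))\<^sup>2) / real CARD('p) ^ N"
      by (simp add: energy_def divide_right_mono)
    also have "\<dots> = 2 * (cmod I)\<^sup>2 * inverse (real CARD('p)) ^ N + 2 * energy u ?B"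
      by (simp add: energy_def distrib_right power_inverse divide_inverse)
    also have "energy u ?B \<le> (\<integral>x. (cmod (u x))\<^sup>2 \<partial>\<mu>)"
      by (rule order_trans[OF energy_le[OF u] integral_sq_on_mono[OF u]]) simp
    finally show ?thesis using tail by simp
  qed
  have "(\<lambda>N. inverse (real CARD('p)) ^ N) \<longlonglongrightarrow> 0"
    using real_CARD_gt_1[where 'p = 'p] by (intro LIMSEQ_power_zero) (auto simp: inverse_less_1_iff)
  then have "(\<lambda>N. 2 * (cmod I)\<^sup>2 * inverse (real CARD('p)) ^ N + e / 2) \<longlonglongrightarrow> 2 * (cmod I)\<^sup>2 * 0 + e / 2"
    by (intro tendsto_add tendsto_mult tendsto_const)
  then have "\<forall>\<^sub>F N in sequentially. 2 * (cmod I)\<^sup>2 * inverse (real CARD('p)) ^ N + e / 2 < e"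
    by (rule order_tendstoD) (use e in simp)
  then show ?thesis using eventually_ge_at_top[of M]
    by eventually_elim (use le in force)
qed

text \<open>
  Take a locally constant \<open>h\<close> close to \<open>g\<close>. On balls so small that \<open>h\<close> is constant on each of them,
  \<open>energy_ge\<close> applies with that constant.
\<close>

lemma energy_descendants_lower:
  assumes g: "square_integrable \<mu> g" and e: "e > 0"
  shows "\<exists>r. (\<integral>x. (cmod (g x))\<^sup>2 * indicator (padic_cball 0 N) x \<partial>\<mu>) - e \<le> (\<Sum>C\<in>descendants N r. energy g C)"
proof -
  have [measurable]: "g \<in> borel_measurable \<mu>" using g by (simp add: square_integrable_def)
  obtain n h where h: "locally_constant n h" "(\<integral>\<^sup>+x. ennreal ((cmod (g x - h x))\<^sup>2) \<partial>\<mu>) < ennreal e"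
    using approximable_square_integrable[OF g] e unfolding approximable_def by blast
  note [measurable] = locally_constant_measurable_mu[OF h(1)]
  have int: "integrable \<mu> (\<lambda>x. (cmod (g x - h x))\<^sup>2)"
    using h(2) by (intro integrableI_nonneg) (auto intro: less_trans)
  have "ennreal (\<integral>x. (cmod (g x - h x))\<^sup>2 \<partial>\<mu>) < ennreal e"
    using h(2) nn_integral_eq_integral[OF int] by simp
  then have small: "(\<integral>x. (cmod (g x - h x))\<^sup>2 \<partial>\<mu>) < e" using e by (simp add: ennreal_less_iff)
  have gh: "square_integrable \<mu> (\<lambda>x. g x - h x)" using int by (simp add: square_integrable_def)
  define r where "r = nat (N - n)"
  have "(\<integral>x. (cmod (g x))\<^sup>2 * indicator C x \<partial>\<mu>) - (\<integral>x. (cmod (g x - h x))\<^sup>2 * indicator C x \<partial>\<mu>) \<le> energy g C"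
    if C: "C \<in> descendants N r" for C
  proof -
    obtain a where C: "C = padic_cball a (N - int r)" using C by (auto simp: descendants_def)
    have "h x = h a" if "x \<in> C" for x
      using locally_constant_mono[OF h(1), of "N - int r"] that C by (auto simp: locally_constant_def r_def)
    then have "(\<integral>x. (cmod (g x - h x))\<^sup>2 * indicator C x \<partial>\<mu>) = (\<integral>x. (cmod (g x - h a))\<^sup>2 * indicator C x \<partial>\<mu>)"
      by (intro Bochner_Integration.integral_cong refl) (auto simp: indicator_def)
    then show ?thesis using energy_ge[OF g, of a "N - int r" "h a"] C by simp
  qed
  then have "(\<Sum>C\<in>descendants N r. (\<integral>x. (cmod (g x))\<^sup>2 * indicator C x \<partial>\<mu>) - (\<integral>x. (cmod (g x - h x))\<^sup>2 * indicator C x \<partial>\<mu>))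
     \<le> (\<Sum>C\<in>descendants N r. energy g C)" by (rule sum_mono)
  then have "(\<integral>x. (cmod (g x))\<^sup>2 * indicator (padic_cball 0 N) x \<partial>\<mu>) - (\<integral>x. (cmod (g x - h x))\<^sup>2 * indicator (padic_cball 0 N) x \<partial>\<mu>)
     \<le> (\<Sum>C\<in>descendants N r. energy g C)"
    using g by (simp add: sum_subtractf sum_descendants_integral int square_integrable_def)
  then show ?thesis using integral_sq_on_mono[OF gh, of "padic_cball 0 N"] small by (intro exI[of _ r]) simp
qed

lemma ball_mem_descendants:
  fixes B :: "'p padic set"
  assumes "padic_ball B"
  shows "\<exists>N0. \<forall>N\<ge>N0. \<exists>i. B \<in> descendants (int N) i"
proof -
  obtain a k where B: "B = padic_cball a k" using assms by (auto simp: padic_ball_iff)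
  obtain n where n: "\<And>i. i \<ge> n \<Longrightarrow> a \<in> padic_cball 0 (int i)" using eventually_in_padic_cball by blast
  have "B \<in> descendants (int N) (nat (int N - k))" if "N \<ge> max n (nat k)" for N
    using that n[of N] by (auto simp: descendants_def B image_iff intro!: bexI[of _ a])
  then show ?thesis by blast
qed

text \<open>
  Every finite set of balls lies in some \<open>U N r\<close>, the first \<open>r\<close> generations below the ball of exponent \<open>N\<close>, and the
  sums over these sets telescope. This bounds all finite partial sums by \<open>\<parallel>g\<parallel>\<^sup>2\<close>, and suitable \<open>N\<close> and \<open>r\<close>
  come arbitrarily close to the bound.
\<close>

lemma detail_energy_has_sum:
  assumes g: "square_integrable \<mu> g"
  shows "(detail_energy g has_sum (l2_norm \<mu> g)\<^sup>2) {B. padic_ball B}"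
proof -
  define U :: "int \<Rightarrow> nat \<Rightarrow> 'p padic set set" where "U N r = (\<Union>i<r. descendants N i)" for N r
  have finU: "finite (U N r)" for N r by (auto simp: U_def finite_descendants)
  have ballU: "U N r \<subseteq> {B. padic_ball B}" for N r by (auto simp: U_def descendants_ball)
  have sumU: "sum (detail_energy g) (U N r) = (\<Sum>C\<in>descendants N r. energy g C) - energy g (padic_cball 0 N)" for N r
    unfolding U_def sum_descendants_detail_energy[symmetric]
    by (rule sum.UNION_disjoint) (auto simp: finite_descendants descendants_disjoint_levels)
  have nn: "detail_energy g B \<ge> 0" if "padic_ball B" for B using detail_energy_nonneg[OF g that] .
  have upper: "sum (detail_energy g) F \<le> (l2_norm \<mu> g)\<^sup>2" if F: "finite F" "F \<subseteq> {B. padic_ball B}" for F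
  proof -
    have "\<exists>N0. \<forall>N\<ge>N0. \<exists>r0. \<forall>r\<ge>r0. F \<subseteq> U (int N) r"
      using F
    proof (induction F rule: finite_induct)
      case (insert B F)
      obtain N0 where N0: "\<And>N. N \<ge> N0 \<Longrightarrow> \<exists>i. B \<in> descendants (int N) i"
        using ball_mem_descendants[of B] insert.prems by blast
      obtain N1 where N1: "\<And>N. N \<ge> N1 \<Longrightarrow> \<exists>r0. \<forall>r\<ge>r0. F \<subseteq> U (int N) r" using insert by blast
      show ?case
      proof (rule exI[of _ "max N0 N1"], intro allI impI)
        fix N assume N: "max N0 N1 \<le> N"
        obtain i where i: "B \<in> descendants (int N) i" using N0[of N] N by auto
        obtain r0 where r0: "\<And>r. r \<ge> r0 \<Longrightarrow> F \<subseteq> U (int N) r" using N1[of N] N by auto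
        show "\<exists>r0. \<forall>r\<ge>r0. insert B F \<subseteq> U (int N) r"
        proof (intro exI[of _ "max (Suc i) r0"] allI impI)
          fix r assume "max (Suc i) r0 \<le> r"
          then show "insert B F \<subseteq> U (int N) r" using r0[of r] i by (auto simp: U_def)
        qed
      qed
    qed auto
    then obtain N r where Nr: "F \<subseteq> U (int N) r" by (meson order_refl)
    have "sum (detail_energy g) F \<le> sum (detail_energy g) (U (int N) r)"
      using ballU by (intro sum_mono2 finU Nr nn) blast
    also have "\<dots> \<le> (\<Sum>C\<in>descendants (int N) r. energy g C)"
      unfolding sumU by (simp add: energy_def)
    also have "\<dots> \<le> (\<Sum>C\<in>descendants (int N) r. \<integral>x. (cmod (g x))\<^sup>2 * indicator C x \<partial>\<mu>)"
      by (intro sum_mono) (auto simp: descendants_def energy_le[OF g])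
    also have "\<dots> = (\<integral>x. (cmod (g x))\<^sup>2 * indicator (padic_cball 0 (int N)) x \<partial>\<mu>)"
      using g by (intro sum_descendants_integral) (simp add: square_integrable_def)
    also have "\<dots> \<le> (l2_norm \<mu> g)\<^sup>2" unfolding l2_norm_sq by (rule integral_sq_on_mono[OF g]) simp
    finally show ?thesis .
  qed
  have summable: "detail_energy g summable_on {B. padic_ball B}"
    using nn upper by (intro nonneg_bdd_above_summable_on) (auto intro!: bdd_aboveI)
  have "infsum (detail_energy g) {B. padic_ball B} \<le> (l2_norm \<mu> g)\<^sup>2"
    by (rule infsum_le_finite_sums[OF summable upper])
  moreover have "(l2_norm \<mu> g)\<^sup>2 \<le> infsum (detail_energy g) {B. padic_ball B}"
  proof (rule field_le_epsilon)
    fix e :: real assume e: "e > 0"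
    have "\<forall>\<^sub>F N in sequentially. (\<integral>x. (cmod (g x))\<^sup>2 * indicator (padic_cball 0 (int N)) x \<partial>\<mu>) > (\<integral>x. (cmod (g x))\<^sup>2 \<partial>\<mu>) - e / 3"
      using e by (intro order_tendstoD(1)[OF integral_sq_on_cball_tendsto[OF g]]) simp
    moreover have "\<forall>\<^sub>F N in sequentially. energy g (padic_cball 0 (int N)) < e / 3"
      using e by (intro energy_big_cball_small[OF g]) simp
    ultimately have "\<forall>\<^sub>F N in sequentially. (\<integral>x. (cmod (g x))\<^sup>2 * indicator (padic_cball 0 (int N)) x \<partial>\<mu>) > (\<integral>x. (cmod (g x))\<^sup>2 \<partial>\<mu>) - e / 3
        \<and> energy g (padic_cball 0 (int N)) < e / 3" by eventually_elim simp
    then obtain N :: nat where N: "(\<integral>x. (cmod (g x))\<^sup>2 * indicator (padic_cball 0 (int N)) x \<partial>\<mu>) > (\<integral>x. (cmod (g x))\<^sup>2 \<partial>\<mu>) - e / 3"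
        "energy g (padic_cball 0 (int N)) < e / 3" by (auto simp: eventually_sequentially)
    obtain r where r: "(\<integral>x. (cmod (g x))\<^sup>2 * indicator (padic_cball 0 (int N)) x \<partial>\<mu>) - e / 3 \<le> (\<Sum>C\<in>descendants (int N) r. energy g C)"
      using energy_descendants_lower[OF g, of "e / 3" "int N"] e by auto
    have "sum (detail_energy g) (U (int N) r) \<le> infsum (detail_energy g) {B. padic_ball B}"
      by (intro finite_sum_le_infsum[OF summable] finU ballU nn) simp
    then show "(l2_norm \<mu> g)\<^sup>2 \<le> infsum (detail_energy g) {B. padic_ball B} + e"
      using N r unfolding sumU l2_norm_sq by linarith
  qed
  ultimately show ?thesis using summable by (simp add: has_sum_iff)
qed

section \<open>The tight frame\<close>

lemma orbit_eq_ball_wavelets: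
  "ball_morphism_orbit padic_wavelet = (\<Union>B\<in>{B. padic_ball B}. ball_wavelets \<mu> B)"
  unfolding ball_morphism_orbit_wavelet by (fastforce simp: padic_ball_iff ball_wavelets_cball)

text \<open>
  A wavelet of \<open>B\<close> vanishes nowhere on \<open>B\<close>, so \<open>B\<close> is its support.
\<close>

lemma wavelet_determines_ball:
  assumes "padic_ball B" "padic_ball C" "f \<in> ball_wavelets \<mu> B" "f \<in> ball_wavelets \<mu> C"
  shows "B = C"
proof -
  have "{x. f x \<noteq> 0} = B" if Bf: "padic_ball B" "f \<in> ball_wavelets \<mu> B" for B
  proof -
    obtain a k \<sigma> where "B = padic_cball a k" "f = ball_wavelet a k \<sigma>"
      using Bf by (auto simp: padic_ball_iff ball_wavelets_cball)
    then show ?thesis by (auto simp: ball_wavelet_def root_unity_def)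
  qed
  then show ?thesis using assms by blast
qed

text \<open>
  By \<open>wavelet_determines_ball\<close> the sum over the orbit is a double sum over balls and their wavelets; the
  inner sums are multiples of the detail energies.
\<close>

lemma orbit_has_sum:
  assumes g: "square_integrable \<mu> g"
  shows "((\<lambda>f. (cmod (l2_inner \<mu> g f))\<^sup>2) has_sum frame_bound * (l2_norm \<mu> g)\<^sup>2) (ball_morphism_orbit padic_wavelet)"
proof -
  let ?S = "Sigma {B. padic_ball B} (ball_wavelets \<mu>)"
  let ?c = "\<lambda>f. (cmod (l2_inner \<mu> g f))\<^sup>2"
  have one: "((\<lambda>f. ?c (snd (B, f))) has_sum frame_bound * detail_energy g B) (ball_wavelets \<mu> B)"
    if "B \<in> {B. padic_ball B}" for B
    using has_sum_finite[OF sum_ball_wavelets(1)[OF g], of B ?c] sum_ball_wavelets(2)[OF g] that by simp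
  have all: "((\<lambda>B. frame_bound * detail_energy g B) has_sum frame_bound * (l2_norm \<mu> g)\<^sup>2) {B. padic_ball B}"
    by (rule has_sum_cmult_right[OF detail_energy_has_sum[OF g]])
  have "((\<lambda>Bf. ?c (snd Bf)) has_sum frame_bound * (l2_norm \<mu> g)\<^sup>2) ?S"
    by (rule has_sum_SigmaI[OF one all summable_on_SigmaI[OF one]])
      (use all in \<open>auto simp: summable_on_def\<close>)
  moreover have bij: "bij_betw snd ?S (ball_morphism_orbit padic_wavelet)"
    unfolding bij_betw_def orbit_eq_ball_wavelets
    using wavelet_determines_ball by (force simp: inj_on_def image_iff)
  ultimately show ?thesis using has_sum_reindex_bij_betw[OF bij, of ?c] by simp
qed

lemma ball_wavelet_locally_constant: "locally_constant (k - 1) (ball_wavelet (a :: 'p padic) k \<sigma>)"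
  unfolding locally_constant_def
proof (intro allI ballI)
  fix x y :: "'p padic" assume y: "y \<in> padic_cball x (k - 1)"
  then have "y \<in> padic_cball x k" by (rule subsetD[OF padic_cball_mono, rotated]) simp
  then have iff: "y \<in> padic_cball a k \<longleftrightarrow> x \<in> padic_cball a k"
    using padic_cball_trans padic_cball_sym by blast
  show "ball_wavelet a k \<sigma> y = ball_wavelet a k \<sigma> x"
  proof (cases "x \<in> padic_cball a k")
    case True
    then have "x \<in> subball a k (rel_digit a k x)" using rel_digit_less[OF True] by (simp add: mem_subball)
    then have "y \<in> subball a k (rel_digit a k x)" using y unfolding subball_def by (rule padic_cball_trans[rotated])
    then have "rel_digit a k y = rel_digit a k x" using rel_digit_less[OF True] by (simp add: mem_subball)
    then show ?thesis using iff by (simp add: ball_wavelet_def)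
  qed (use iff in \<open>simp add: ball_wavelet_def\<close>)
qed

text \<open>
  Locally constant functions that differ at a point differ on a whole ball, which has positive
  measure.
\<close>

lemma orbit_l2_set: "l2_set \<mu> (ball_morphism_orbit padic_wavelet)"
  unfolding l2_set_def
proof (intro conjI ballI impI)
  fix f :: "'p padic \<Rightarrow> complex" assume f: "f \<in> ball_morphism_orbit padic_wavelet"
  then show "square_integrable \<mu> f" by (auto simp: ball_morphism_orbit_wavelet square_integrable_ball_wavelet)
  fix g :: "'p padic \<Rightarrow> complex" assume g: "g \<in> ball_morphism_orbit padic_wavelet" and ae: "AE x in \<mu>. f x = g x"
  obtain a k \<sigma> b l \<tau> where "f = ball_wavelet a k \<sigma>" "g = ball_wavelet b l \<tau>"
    using f g by (auto simp: ball_morphism_orbit_wavelet)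
  then obtain m n where "locally_constant m f" "locally_constant n g"
    using ball_wavelet_locally_constant by metis
  then have lc: "locally_constant (min m n) f" "locally_constant (min m n) g"
    by (auto intro: locally_constant_mono)
  show "f = g"
  proof (rule ccontr)
    assume "f \<noteq> g"
    then obtain x where "f x \<noteq> g x" by auto
    then have "padic_cball x (min m n) \<subseteq> {y \<in> space \<mu>. \<not> f y = g y}" using lc by (auto simp: locally_constant_def)
    then obtain Z where Z: "padic_cball x (min m n) \<subseteq> Z" "Z \<in> null_sets \<mu>"
      using ae unfolding eventually_ae_filter by blast
    then have "padic_cball x (min m n) \<in> null_sets \<mu>" by (intro null_sets_subset[OF Z(2) _ Z(1)]) simp
    then have "emeasure \<mu> (padic_cball x (min m n)) = 0" by auto
    then have "real CARD('p) powi (min m n) \<le> 0" unfolding emeasure_cball by (simp only: ennreal_eq_0_iff)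
    then show False using CARD_powi_pos[of "min m n", where 'p = 'p] by linarith
  qed
qed

text \<open>
  The bound is unique because the identity can be tested on a nonzero function.
\<close>

lemma orbit_tight_frame_iff:
  "l2_tight_frame \<mu> (ball_morphism_orbit padic_wavelet) A \<longleftrightarrow> A = fact CARD('p) / (real CARD('p) - 1)"
proof
  have sum: "(\<lambda>f. (cmod (l2_inner \<mu> g f))\<^sup>2) summable_on ball_morphism_orbit padic_wavelet"
    "(\<Sum>\<^sub>\<infinity>f\<in>ball_morphism_orbit padic_wavelet. (cmod (l2_inner \<mu> g f))\<^sup>2) = frame_bound * (l2_norm \<mu> g)\<^sup>2"
    if "square_integrable \<mu> g" for g
    using orbit_has_sum[OF that] by (auto simp: has_sum_iff)
  {
    assume A: "l2_tight_frame \<mu> (ball_morphism_orbit padic_wavelet) A"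
    have w: "square_integrable \<mu> (ball_wavelet 0 0 id)" by (rule square_integrable_ball_wavelet)
    have "A * (l2_norm \<mu> (ball_wavelet 0 0 id))\<^sup>2 = frame_bound * (l2_norm \<mu> (ball_wavelet 0 0 id))\<^sup>2"
      using A w unfolding l2_tight_frame_def l2_frame_bounds_def sum(2)[OF w, symmetric] by (intro antisym) auto
    then show "A = fact CARD('p) / (real CARD('p) - 1)" by (simp add: frame_bound_def)
  next
    assume "A = fact CARD('p) / (real CARD('p) - 1)"
    then have "A = frame_bound" by (simp add: frame_bound_def)
    then show "l2_tight_frame \<mu> (ball_morphism_orbit padic_wavelet) A"
      using frame_bound_pos orbit_l2_set sum unfolding l2_tight_frame_def l2_frame_bounds_def by auto
  }
qed

end

theorem lemma6:
  fixes \<mu> :: "'p::prime_card padic measure"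
  assumes "normalized_haar \<mu>"
  shows "(\<forall>A. l2_tight_frame \<mu> (ball_morphism_orbit padic_wavelet) A \<longleftrightarrow>
            A = fact CARD('p) / (real CARD('p) - 1)) \<and>
         l2_uniform \<mu> (ball_morphism_orbit padic_wavelet) \<and>
         ball_morphism_orbit padic_wavelet = (\<Union>B\<in>{B. padic_ball B}. ball_wavelets \<mu> B) \<and>
         (\<forall>B. padic_ball B \<longrightarrow> (\<forall>f\<in>ball_wavelets \<mu> B. related_to_ball \<mu> B f))"
proof -
  interpret padic_haar \<mu> by standard (rule assms)
  have "l2_uniform \<mu> (ball_morphism_orbit padic_wavelet)"
    unfolding l2_uniform_def ball_morphism_orbit_wavelet by (intro exI[of _ 1]) auto
  then show ?thesis
    using orbit_tight_frame_iff orbit_eq_ball_wavelets ball_wavelets_related by blast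
qed

end
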